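(* Let $W$ be a finite Coxeter group with set of simple reflections $S$, $|S|\ge 3$, and let $L\subseteq S$ with $|L|=2$. Then for each $W_L$-conjugacy class $C$ of cuspidal elements of $W_L$, with fixed representative $w_C\in C$, there exist linear characters $\widetilde\varphi_{w_C}$ and $\widetilde\psi_{w_C}$ of $C_W(w_C)$ such that (i) $\widetilde\Phi_L=\sum_{C\in\mathcal C_L}\operatorname{Ind}_{C_W(w_C)}^{N_W(W_L)}\widetilde\varphi_{w_C}$; (ii) $\widetilde\Psi_L=\sum_{C\in\mathcal C_L}\operatorname{Ind}_{C_W(w_C)}^{N_W(W_L)}\widetilde\psi_{w_C}$; (iii) $\widetilde\psi_{w_C}=\widetilde\varphi_{w_C}\,\epsilon\,\alpha_L$ (restricted to $C_W(w_C)$) for all $C\in\mathcal C_L$.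
   Context: $W$ has length function $\ell$ and acts on the right as a reflection group on $V=\mathbb R^{|S|}$ (and $V_{\mathbb C}=\mathbb C^{|S|}$). Write $x^w=w^{-1}xw$ and $J^w=\{s^w:s\in J\}$. $\epsilon$ is the sign character $w\mapsto\det(w|_V)$. For $J\subseteq S$: $W_J=\langle J\rangle$; $X_J=\{w\in W:\ell(sw)>\ell(w)\ \forall s\in J\}$; $x_J=\sum_{x\in X_J}x^{-1}\in\mathbb CW$; $X_J^\sharp=\{x\in X_J:J^x\subseteq S\}$; $N_J=\{x\in X_J:J^x=J\}$, a subgroup with $N_W(W_J)=W_J\rtimes N_J$. For $K,L\subseteq S$ put $m_{KL}=|X_K\cap X_L^\sharp|$ if $L\subseteq K$ and $m_{KL}=0$ otherwise; this matrix is invertible and elements $e_L\in\mathbb CW$ are defined by $x_K=\sum_{L\subseteq S}m_{KL}e_L$ for all $K\subseteq S$. For $L\subseteq S$, let $e_L^L$ be the element $e_L$ constructed in the Coxeter group $(W_L,L)$; $\Phi_L$ is the character of $W_L$ acting by right multiplication on $e^L_L\mathbb CW_L$, and $\widetilde\Phi_L$ is the character of $N_W(W_L)$ acting by right multiplication on $e_L\mathbb CW_L$ (this space is $N_W(W_L)$-stable and its character extends $\Phi_L$). Orlik–Solomon algebra: $T=\{s^w\}$ is the set of reflections, $H_t\subseteq V_{\mathbb C}$ the hyperplane fixed by $t$. $A(W)$ is the $\mathbb C$-algebra generated by $a_t$ ($t\in T$) subject to $a_ta_{t'}=-a_{t'}a_t$ and $\sum_{i=1}^p(-1)^ia_{t_1}\cdots\widehat{a_{t_i}}\cdots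 a_{t_p}=0$ whenever $\{H_{t_1},\dots,H_{t_p}\}$ is linearly dependent; $W$ acts by $a_t.w=a_{t^w}$. For $X=\operatorname{Fix}(W_L)\subseteq V_{\mathbb C}$ of codimension $p$, $A_X$ is the span of all $a_{t_1}\cdots a_{t_p}$ with $H_{t_1}\cap\dots\cap H_{t_p}=X$; it is $N_W(W_L)$-stable, and $\widetilde\Psi_L$ denotes the character of $N_W(W_L)$ on $A_X$ (it extends the character $\Psi_L$ of $W_L$ on the top component of the Orlik–Solomon algebra of $W_L$). $\alpha_L$ is the linear character of $N_W(W_L)$ given by $\alpha_L(w)=\det(w|_{\operatorname{Fix}(W_L)})$. An element $w\in W_L$ is cuspidal in $W_L$ if it has no nonzero fixed vector in the orthogonal complement of $\operatorname{Fix}(W_L)$ in $V$; $\mathcal C_L$ is the set of $W_L$-conjugacy classes of cuspidal elements of $W_L$. For cuspidal $w$, $C_W(w)\le N_W(W_L)$. *)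

theory Defs
  imports "HOL-Analysis.Analysis"
begin

text \<open>The simple reflections are indexed by a finite type 's; the Coxeter system is
given by its Coxeter matrix m.  V = R^S with basis the simple roots alpha_s,
the W-invariant bilinear form is B(alpha_s, alpha_t) = - cos(pi / m s t), and the simple
reflection sigma_s acts on row vectors (right action) by v -> v - 2 B(v,alpha_s) alpha_s.
Group elements are matrices, the group product is matrix product, v.w = v v* w.\<close>

type_synonym 's mat = "real^'s^'s"

definition coxeter_matrix :: "('s \<Rightarrow> 's \<Rightarrow> nat) \<Rightarrow> bool" where
  "coxeter_matrix m \<longleftrightarrow> (\<forall>s. m s s = 1) \<and> (\<forall>s t. m s t = m t s)
      \<and> (\<forall>s t. s \<noteq> t \<longrightarrow> m s t \<ge> 2)"

definition Bmat :: "('s::finite \<Rightarrow> 's \<Rightarrow> nat) \<Rightarrow> 's \<Rightarrow> 's \<Rightarrow> real" where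
  "Bmat m s t = - cos (pi / real (m s t))"

definition Bform :: "('s::finite \<Rightarrow> 's \<Rightarrow> nat) \<Rightarrow> real^'s \<Rightarrow> real^'s \<Rightarrow> real" where
  "Bform m u v = (\<Sum>s\<in>UNIV. \<Sum>t\<in>UNIV. u$s * Bmat m s t * v$t)"

definition sref :: "('s::finite \<Rightarrow> 's \<Rightarrow> nat) \<Rightarrow> 's \<Rightarrow> 's mat" where
  "sref m s = (\<chi> i j. (if i = j then 1 else 0) - (if j = s then 2 * Bmat m i s else 0))"

inductive_set gen :: "'s::finite mat set \<Rightarrow> 's mat set" for A where
  gen_one: "mat 1 \<in> gen A"
| gen_step: "x \<in> gen A \<Longrightarrow> a \<in> A \<Longrightarrow> x ** a \<in> gen A"

definition WJ :: "('s::finite \<Rightarrow> 's \<Rightarrow> nat) \<Rightarrow> 's set \<Rightarrow> 's mat set" where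
  "WJ m J = gen (sref m ` J)"

abbreviation Wgrp :: "('s::finite \<Rightarrow> 's \<Rightarrow> nat) \<Rightarrow> 's mat set" where
  "Wgrp m \<equiv> WJ m UNIV"

abbreviation Sset :: "('s::finite \<Rightarrow> 's \<Rightarrow> nat) \<Rightarrow> 's mat set" where
  "Sset m \<equiv> sref m ` UNIV"

definition word_prod :: "('s::finite \<Rightarrow> 's \<Rightarrow> nat) \<Rightarrow> 's list \<Rightarrow> 's mat" where
  "word_prod m ss = foldl (\<lambda>a s. a ** sref m s) (mat 1) ss"

definition len :: "('s::finite \<Rightarrow> 's \<Rightarrow> nat) \<Rightarrow> 's mat \<Rightarrow> nat" where
  "len m w = (LEAST n. \<exists>ss. length ss = n \<and> word_prod m ss = w)"

definition conj :: "'s::finite mat \<Rightarrow> 's mat \<Rightarrow> 's mat" where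
  "conj x w = matrix_inv w ** x ** w"

definition XJ :: "('s::finite \<Rightarrow> 's \<Rightarrow> nat) \<Rightarrow> 's set \<Rightarrow> 's mat set" where
  "XJ m J = {w \<in> Wgrp m. \<forall>s\<in>J. len m (sref m s ** w) > len m w}"

definition XJsharp :: "('s::finite \<Rightarrow> 's \<Rightarrow> nat) \<Rightarrow> 's set \<Rightarrow> 's mat set" where
  "XJsharp m J = {x \<in> XJ m J. (\<lambda>s. conj (sref m s) x) ` J \<subseteq> Sset m}"

definition mKL :: "('s::finite \<Rightarrow> 's \<Rightarrow> nat) \<Rightarrow> 's set \<Rightarrow> 's set \<Rightarrow> nat" where
  "mKL m K L = (if L \<subseteq> K then card (XJ m K \<inter> XJsharp m L) else 0)"

section \<open>Group algebra CW: complex-valued functions on matrices supported on W\<close>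

definition xJ :: "('s::finite \<Rightarrow> 's \<Rightarrow> nat) \<Rightarrow> 's set \<Rightarrow> 's mat \<Rightarrow> complex" where
  "xJ m J = (\<lambda>z. if z \<in> matrix_inv ` XJ m J then 1 else 0)"

definition eL :: "('s::finite \<Rightarrow> 's \<Rightarrow> nat) \<Rightarrow> 's set \<Rightarrow> 's mat \<Rightarrow> complex" where
  "eL m = (THE e. \<forall>K. xJ m K = (\<lambda>z. \<Sum>L\<in>(UNIV::'s set set). of_nat (mKL m K L) * e L z))"

definition conv :: "('s::finite \<Rightarrow> 's \<Rightarrow> nat) \<Rightarrow> ('s mat \<Rightarrow> complex) \<Rightarrow> ('s mat \<Rightarrow> complex)
    \<Rightarrow> 's mat \<Rightarrow> complex" where
  "conv m f g = (\<lambda>z. \<Sum>p\<in>{(x,y). x \<in> Wgrp m \<and> y \<in> Wgrp m \<and> x ** y = z}. f (fst p) * g (snd p))"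

definition delta :: "'a \<Rightarrow> 'a \<Rightarrow> complex" where
  "delta w = (\<lambda>z. if z = w then 1 else 0)"

section \<open>Linear algebra: trace of an endomorphism of a quotient U/K of subspaces of a
function space (K = {0} gives the ordinary trace on U)\<close>

definition lincomb :: "nat \<Rightarrow> (nat \<Rightarrow> complex) \<Rightarrow> (nat \<Rightarrow> 'a \<Rightarrow> complex) \<Rightarrow> 'a \<Rightarrow> complex" where
  "lincomb n a b = (\<lambda>x. \<Sum>i<n. a i * b i x)"

definition lin_span :: "('a \<Rightarrow> complex) set \<Rightarrow> ('a \<Rightarrow> complex) set" where
  "lin_span B = {lincomb n a b | n a b. \<forall>i<n. b i \<in> B}"

definition trace_mod :: "('a \<Rightarrow> complex) set \<Rightarrow> ('a \<Rightarrow> complex) set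
    \<Rightarrow> (('a \<Rightarrow> complex) \<Rightarrow> ('a \<Rightarrow> complex)) \<Rightarrow> complex" where
  "trace_mod U K \<phi> = (THE tr. \<exists>n b c.
      (\<forall>i<n. b i \<in> U)
    \<and> (\<forall>f\<in>U. \<exists>a. (\<lambda>x. f x - lincomb n a b x) \<in> K)
    \<and> (\<forall>a. lincomb n a b \<in> K \<longrightarrow> (\<forall>i<n. a i = 0))
    \<and> (\<forall>i<n. (\<lambda>x. \<phi> (b i) x - lincomb n (c i) b x) \<in> K)
    \<and> tr = (\<Sum>i<n. c i i))"

definition det_on :: "(real^'s::finite) set \<Rightarrow> (real^'s \<Rightarrow> real^'s) \<Rightarrow> real" where
  "det_on X \<phi> = (THE d. \<exists>n b c.
      (\<forall>i<n. b i \<in> X)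
    \<and> (\<forall>v\<in>X. \<exists>a. v = (\<Sum>i<n. a i *\<^sub>R b i))
    \<and> (\<forall>a. (\<Sum>i<n. a i *\<^sub>R b i) = 0 \<longrightarrow> (\<forall>i<n. a i = 0))
    \<and> (\<forall>i<n. \<phi> (b i) = (\<Sum>j<n. c i j *\<^sub>R b j))
    \<and> d = (\<Sum>(p::nat\<Rightarrow>nat) | p permutes {..<n}. of_int (sign p) * (\<Prod>i<n. c i (p i))))"

definition normalizer :: "('s::finite \<Rightarrow> 's \<Rightarrow> nat) \<Rightarrow> 's mat set \<Rightarrow> 's mat set" where
  "normalizer m H = {w \<in> Wgrp m. (\<lambda>x. w ** x) ` H = (\<lambda>x. x ** w) ` H}"

definition centralizer :: "('s::finite \<Rightarrow> 's \<Rightarrow> nat) \<Rightarrow> 's mat \<Rightarrow> 's mat set" where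
  "centralizer m w = {x \<in> Wgrp m. x ** w = w ** x}"

definition lin_char :: "'s::finite mat set \<Rightarrow> ('s mat \<Rightarrow> complex) \<Rightarrow> bool" where
  "lin_char H ch \<longleftrightarrow> (\<forall>x\<in>H. ch x \<noteq> 0) \<and> (\<forall>x\<in>H. \<forall>y\<in>H. ch (x ** y) = ch x * ch y)"

definition Ind :: "'s::finite mat set \<Rightarrow> 's mat set \<Rightarrow> ('s mat \<Rightarrow> complex) \<Rightarrow> 's mat \<Rightarrow> complex" where
  "Ind H G ch g = (1 / of_nat (card H)) *
     (\<Sum>x\<in>G. if x ** g ** matrix_inv x \<in> H then ch (x ** g ** matrix_inv x) else 0)"

definition eps :: "'s::finite mat \<Rightarrow> complex" where
  "eps w = complex_of_real (det w)"

definition Fix :: "('s::finite \<Rightarrow> 's \<Rightarrow> nat) \<Rightarrow> 's set \<Rightarrow> (real^'s) set" where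
  "Fix m L = {v. \<forall>w\<in>WJ m L. v v* w = v}"

definition alphaL :: "('s::finite \<Rightarrow> 's \<Rightarrow> nat) \<Rightarrow> 's set \<Rightarrow> 's mat \<Rightarrow> complex" where
  "alphaL m L w = complex_of_real (det_on (Fix m L) (\<lambda>v. v v* w))"

definition cuspidal :: "('s::finite \<Rightarrow> 's \<Rightarrow> nat) \<Rightarrow> 's set \<Rightarrow> 's mat \<Rightarrow> bool" where
  "cuspidal m L w \<longleftrightarrow> w \<in> WJ m L \<and>
     (\<forall>v. (\<forall>x\<in>Fix m L. Bform m v x = 0) \<and> v v* w = v \<longrightarrow> v = 0)"

definition cusp_classes :: "('s::finite \<Rightarrow> 's \<Rightarrow> nat) \<Rightarrow> 's set \<Rightarrow> 's mat set set" where
  "cusp_classes m L = {(\<lambda>x. conj w x) ` WJ m L | w. cuspidal m L w}"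

definition PhiT :: "('s::finite \<Rightarrow> 's \<Rightarrow> nat) \<Rightarrow> 's set \<Rightarrow> 's mat \<Rightarrow> complex" where
  "PhiT m L g = trace_mod
     {conv m (eL m L) a | a. \<forall>z. z \<notin> WJ m L \<longrightarrow> a z = 0}
     {\<lambda>_. 0}
     (\<lambda>f. conv m f (delta g))"

section \<open>Orlik-Solomon algebra as quotient of the free algebra on T
(elements: complex functions on words of reflections)\<close>

definition refls :: "('s::finite \<Rightarrow> 's \<Rightarrow> nat) \<Rightarrow> 's mat set" where
  "refls m = {conj s w | s w. s \<in> Sset m \<and> w \<in> Wgrp m}"

definition Hyp :: "'s::finite mat \<Rightarrow> (real^'s) set" where
  "Hyp t = {v. v v* t = v}"

definition hyp_dep :: "'s::finite mat list \<Rightarrow> bool" where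
  "hyp_dep ts \<longleftrightarrow> (\<exists>f c. (\<forall>i<length ts. f i \<noteq> 0 \<and> {v. f i \<bullet> v = 0} = Hyp (ts ! i))
      \<and> (\<exists>i<length ts. c i \<noteq> 0) \<and> (\<Sum>i<length ts. c i *\<^sub>R f i) = (0::real^'s))"

definition mono :: "'a list \<Rightarrow> 'a list \<Rightarrow> complex" where
  "mono u = (\<lambda>v. if v = u then 1 else 0)"

definition fa_mult :: "('a list \<Rightarrow> complex) \<Rightarrow> ('a list \<Rightarrow> complex) \<Rightarrow> 'a list \<Rightarrow> complex" where
  "fa_mult f g = (\<lambda>w. \<Sum>k\<le>length w. f (take k w) * g (drop k w))"

definition remove_nth :: "nat \<Rightarrow> 'a list \<Rightarrow> 'a list" where
  "remove_nth i xs = take i xs @ drop (Suc i) xs"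

definition os_rels :: "('s::finite \<Rightarrow> 's \<Rightarrow> nat) \<Rightarrow> ('s mat list \<Rightarrow> complex) set" where
  "os_rels m =
     {(\<lambda>v. mono [t, t'] v + mono [t', t] v) | t t'. t \<in> refls m \<and> t' \<in> refls m}
   \<union> {(\<lambda>v. \<Sum>i<length ts. (-1) ^ (i + 1) * mono (remove_nth i ts) v) | ts.
        set ts \<subseteq> refls m \<and> hyp_dep ts}"

definition os_ideal :: "('s::finite \<Rightarrow> 's \<Rightarrow> nat) \<Rightarrow> ('s mat list \<Rightarrow> complex) set" where
  "os_ideal m = lin_span {fa_mult (fa_mult (mono u) r) (mono v) | u r v.
      set u \<subseteq> refls m \<and> set v \<subseteq> refls m \<and> r \<in> os_rels m}"

text \<open>W acts by a_t.w = a_{t^w}\<close>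
definition os_act :: "('s::finite mat list \<Rightarrow> complex) \<Rightarrow> 's mat \<Rightarrow> 's mat list \<Rightarrow> complex" where
  "os_act f w = (\<lambda>v. f (map (\<lambda>t. w ** t ** matrix_inv w) v))"

definition codim :: "(real^'s::finite) set \<Rightarrow> nat" where
  "codim X = CARD('s) - dim X"

text \<open>A_X (as a subspace of the free algebra, taken modulo the ideal), X = Fix(W_L)\<close>
definition AX_lift :: "('s::finite \<Rightarrow> 's \<Rightarrow> nat) \<Rightarrow> 's set \<Rightarrow> ('s mat list \<Rightarrow> complex) set" where
  "AX_lift m L = lin_span {mono ts | ts. set ts \<subseteq> refls m \<and> length ts = codim (Fix m L)
      \<and> {v. \<forall>t\<in>set ts. v \<in> Hyp t} = Fix m L}"

definition PsiT :: "('s::finite \<Rightarrow> 's \<Rightarrow> nat) \<Rightarrow> 's set \<Rightarrow> 's mat \<Rightarrow> complex" where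
  "PsiT m L g = trace_mod (AX_lift m L) (os_ideal m) (\<lambda>f. os_act f g)"

end

theory Submission
  imports Defs
begin

text \<open>
  For \<open>L = {s, t}\<close> with \<open>n = m s t\<close>, the normalizer \<open>N\<close> of the dihedral group \<open>WL\<close> acts on the plane of the two
  simple roots by rotations and reflections of the regular \<open>2n\<close>-gon of roots. From the explicit formula for \<open>eL m L\<close>
  one finds that \<open>PhiT\<close> is the permutation character of \<open>N\<close> on the \<open>n\<close> lines bisecting the chambers, minus one. The degree
  two boundary map identifies the component \<open>A_X\<close> of the Orlik-Solomon algebra with the functions of sum zero on the reflections of \<open>WL\<close>,
  so \<open>PsiT\<close> is the permutation character of \<open>N\<close> on the \<open>n\<close> root lines, minus one. If \<open>g\<close> rotates the plane by an angle whose
  double is that of the root of unity \<open>\<mu>\<close>, both values are \<open>\<mu> + \<mu>^2 + ... + \<mu>^(n-1)\<close>; if \<open>g\<close> reflects the plane, counting fixed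
  lines gives opposite values, which vanish for odd \<open>n\<close>. The cuspidal elements are the rotations \<open>r^k\<close> with \<open>0 < k < n\<close>, and attaching \<open>\<mu>^k\<close> to the
  centralizer of \<open>r^k\<close>, twisted by the determinant on the plane in the case of \<open>PhiT\<close>, gives the required linear characters.
  The determinant on the plane equals \<open>eps * alphaL\<close>.
\<close>

section \<open>Matrix groups and the invariant form\<close>

text \<open>The element \<open>eL m L\<close> is a function on all of \<open>W\<close>, given by a
  linear system built from lengths in \<open>W\<close>. The theorem \<open>row_pos\<close> turns
  length comparisons into signs of roots, and the counts \<open>card_decomp\<close>,
  \<open>card_X_single\<close> and \<open>card_Xsharp\<close> solve the system: up to the factor
  \<open>mLL\<close>, the value is \<open>1/2 - 1/(2n)\<close> if two rows of the inverse have the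
  same sign, and \<open>-1/(2n)\<close> otherwise. Equality of the two signs characterises a line in
  the plane, not a vector.

  An element \<open>g\<close> of the normalizer may turn the plane by an angle that does not occur
  in \<open>WL\<close>. Lines do not distinguish a vector from its negative, so only the square
  \<open>mu g\<close> of the coordinate \<open>lam g\<close> enters, and this square is always an
  \<open>n\<close>-th root of unity.

  On labels, a reversing \<open>g\<close> acts by \<open>mu g * \<zeta> * cnj x\<close> on the
  bisectors and by \<open>mu g * cnj x\<close> on the root lines. The fixed points are square roots
  of \<open>mu g * \<zeta>\<close> and of \<open>mu g\<close>. For even \<open>n\<close> the
  relation \<open>\<zeta> ^ (n div 2) = -1\<close> is the whole difference between
  \<open>PhiT\<close> and \<open>PsiT\<close>.\<close>

lemma gen_mult: assumes "x \<in> gen A" "y \<in> gen A" shows "x ** y \<in> gen A"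
  using assms(2,1)
proof (induction y rule: gen.induct)
  case gen_one then show ?case by simp
next
  case (gen_step y a)
  then show ?case by (metis gen.gen_step matrix_mul_assoc)
qed

lemma gen_base: "a \<in> A \<Longrightarrow> a \<in> gen A"
  by (metis gen.intros matrix_mul_lid)

lemma gen_mono: assumes "x \<in> gen A" "A \<subseteq> B" shows "x \<in> gen B"
  using assms by (induction x rule: gen.induct) (auto intro: gen.intros)

lemma matrix_inv_unique:
  fixes A B :: "real^'n^'n"
  assumes "A ** B = mat 1" "B ** A = mat 1"
  shows "matrix_inv A = B"
proof -
  have "A ** matrix_inv A = mat 1 \<and> matrix_inv A ** A = mat 1"
    unfolding matrix_inv_def by (rule someI[of _ B]) (use assms in auto)
  then show ?thesis by (metis assms(2) matrix_mul_assoc matrix_mul_lid matrix_mul_rid)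
qed

lemma vector_matrix_diff:
  fixes A :: "real^'m^'n" shows "(x - y) v* A = x v* A - y v* A"
  using vector_matrix_left_distrib[of "x - y" y A] by simp

lemma vector_matrix_minus:
  fixes A :: "real^'m^'n" shows "(- x) v* A = - (x v* A)"
  using vector_matrix_diff[of 0 x A] by simp

lemma matrix_eqI_rows:
  fixes A B :: "real^'n^'n"
  assumes "\<And>v. v v* A = v v* B" shows "A = B"
proof -
  have "transpose A *v v = transpose B *v v" for v using assms[of v] by simp
  then have "transpose A = transpose B" using matrix_eq by blast
  then show ?thesis by (metis transpose_transpose)
qed

abbreviation al :: "'s::finite \<Rightarrow> real^'s" where "al s \<equiv> axis s 1"

text \<open>Row \<open>s\<close> of a matrix holds the coordinates of the image of the simple root
  \<open>al s\<close>; the later statements about signs of rows are statements about positive and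
  negative roots.\<close>

lemma al_mult_nth [simp]: "(al s v* w) $ j = w $ s $ j"
proof -
  have "(\<Sum>i\<in>UNIV. w $ i $ j * (if i = s then 1 else 0)) = w $ s $ j"
    by (simp add: if_distrib sum.delta cong: if_cong)
  then show ?thesis unfolding vector_matrix_mult_def axis_def by (simp add: mult.commute)
qed

lemma al_expand: "v = (\<Sum>s\<in>UNIV. (v $ s) *\<^sub>R al s)"
proof -
  have "v $ j = (\<Sum>s\<in>UNIV. (v $ s) *\<^sub>R al s) $ j" for j
  proof -
    have "(\<Sum>s\<in>UNIV. (v $ s) *\<^sub>R al s) $ j = (\<Sum>s\<in>UNIV. v $ s * (if s = j then 1 else 0))"
      unfolding sum_component by (rule sum.cong) (auto simp: axis_def)
    also have "\<dots> = v $ j" by (simp add: if_distrib sum.delta cong: if_cong)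
    finally show ?thesis ..
  qed
  then show ?thesis unfolding vec_eq_iff by blast
qed

lemma Bform_add_left: "Bform m (u + v) w = Bform m u w + Bform m v w"
  unfolding Bform_def by (simp add: algebra_simps sum.distrib)

lemma Bform_add_right: "Bform m w (u + v) = Bform m w u + Bform m w v"
  unfolding Bform_def by (simp add: algebra_simps sum.distrib)

lemma Bform_scale_left: "Bform m (c *\<^sub>R u) w = c * Bform m u w"
  unfolding Bform_def by (simp add: algebra_simps sum_distrib_left)

lemma Bform_scale_right: "Bform m w (c *\<^sub>R u) = c * Bform m w u"
  unfolding Bform_def by (simp add: algebra_simps sum_distrib_left)

lemma Bform_zero_left [simp]: "Bform m 0 w = 0" and Bform_zero_right [simp]: "Bform m w 0 = 0"
  unfolding Bform_def by simp_all

lemma Bform_minus_left: "Bform m (- u) w = - Bform m u w"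
  using Bform_scale_left[of m "-1" u w] by simp

lemma Bform_minus_right: "Bform m w (- u) = - Bform m w u"
  using Bform_scale_right[of m w "-1" u] by simp

lemma Bform_diff_left: "Bform m (u - v) w = Bform m u w - Bform m v w"
  using Bform_add_left[of m u "-v" w] Bform_minus_left[of m v w] by simp

lemma Bform_diff_right: "Bform m w (u - v) = Bform m w u - Bform m w v"
  using Bform_add_right[of m w u "-v"] Bform_minus_right[of m w v] by simp

lemmas Bform_linear = Bform_add_left Bform_add_right Bform_scale_left Bform_scale_right
  Bform_minus_left Bform_minus_right Bform_diff_left Bform_diff_right

lemma Bform_al_right: "Bform m v (al s) = (\<Sum>i\<in>UNIV. v $ i * Bmat m i s)"
  unfolding Bform_def axis_def by (simp add: if_distrib sum.delta cong: if_cong)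

lemma Bform_al [simp]: "Bform m (al s) (al t) = Bmat m s t"
proof -
  have "Bform m (al s) (al t) = (\<Sum>i\<in>UNIV. (if i = s then Bmat m i t else 0))"
    unfolding Bform_al_right by (rule sum.cong) (auto simp: axis_def)
  then show ?thesis by simp
qed

lemma sref_act: "v v* sref m s = v - (2 * Bform m v (al s)) *\<^sub>R al s"
proof -
  have "(v v* sref m s) $ j = (v - (2 * Bform m v (al s)) *\<^sub>R al s) $ j" for j
  proof -
    have "(v v* sref m s) $ j = (\<Sum>i\<in>UNIV. v $ i * (if i = j then 1 else 0))
        - (\<Sum>i\<in>UNIV. (if j = s then 2 * (v $ i * Bmat m i s) else 0))"
      unfolding vector_matrix_mult_def sref_def
      by (simp add: sum_subtractf[symmetric], rule sum.cong) (auto simp: algebra_simps)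
    also have "\<dots> = v $ j - (if j = s then 2 * Bform m v (al s) else 0)"
      unfolding Bform_al_right by (simp add: if_distrib sum.delta sum_distrib_left cong: if_cong)
    finally show ?thesis by (simp add: axis_def)
  qed
  then show ?thesis by (simp add: vec_eq_iff)
qed

locale coxeter =
  fixes m :: "'s::finite \<Rightarrow> 's \<Rightarrow> nat"
  assumes cox: "coxeter_matrix m"
begin

abbreviation "W \<equiv> Wgrp m"
abbreviation "\<sigma> \<equiv> sref m"
abbreviation "B \<equiv> Bform m"
abbreviation "iv \<equiv> matrix_inv"

lemma Bmat_refl [simp]: "Bmat m s s = 1"
  using cox unfolding coxeter_matrix_def Bmat_def by simp

lemma Bmat_sym: "Bmat m s t = Bmat m t s"
  using cox unfolding coxeter_matrix_def Bmat_def by metis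

lemma B_sym: "B u v = B v u"
proof -
  have "B u v = (\<Sum>t\<in>UNIV. \<Sum>s\<in>UNIV. u$s * Bmat m s t * v$t)"
    unfolding Bform_def by (rule sum.swap)
  also have "\<dots> = B v u" unfolding Bform_def
    by (intro sum.cong refl) (simp add: Bmat_sym mult.commute mult.left_commute)
  finally show ?thesis .
qed

lemma sref_sq [simp]: "\<sigma> s ** \<sigma> s = mat 1"
proof (rule matrix_eqI_rows)
  fix v :: "real^'s"
  have "v v* (\<sigma> s ** \<sigma> s) = (v v* \<sigma> s) v* \<sigma> s" by (simp add: vector_matrix_mul_assoc)
  also have "\<dots> = v" by (simp add: sref_act Bform_linear algebra_simps)
  finally show "v v* (\<sigma> s ** \<sigma> s) = v v* mat 1" by simp
qed

lemma sref_sq_left [simp]: "\<sigma> s ** (\<sigma> s ** w) = w"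
  by (simp add: matrix_mul_assoc)

lemma sref_sq_right [simp]: "w ** \<sigma> s ** \<sigma> s = w"
  by (simp flip: matrix_mul_assoc)

lemma al_sref [simp]: "al s v* \<sigma> s = - al s"
  unfolding sref_act by (simp add: scaleR_2)

lemma sref_B: "B (u v* \<sigma> s) (v v* \<sigma> s) = B u v"
  unfolding sref_act by (simp add: Bform_linear algebra_simps B_sym[of "al s" v])

lemma one_WJ [simp]: "mat 1 \<in> WJ m J" unfolding WJ_def by (rule gen_one)

lemma WJ_mult: "x \<in> WJ m J \<Longrightarrow> y \<in> WJ m J \<Longrightarrow> x ** y \<in> WJ m J"
  unfolding WJ_def by (rule gen_mult)

lemma sref_WJ: "s \<in> J \<Longrightarrow> \<sigma> s \<in> WJ m J"
  unfolding WJ_def by (rule gen_base) auto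

lemma WJ_sub: "x \<in> WJ m J \<Longrightarrow> x \<in> W"
  unfolding WJ_def by (erule gen_mono) auto

lemma WJ_induct [consumes 1, case_names one step]:
  assumes "w \<in> WJ m J" "P (mat 1)" "\<And>w s. w \<in> WJ m J \<Longrightarrow> P w \<Longrightarrow> s \<in> J \<Longrightarrow> P (w ** \<sigma> s)"
  shows "P w"
proof -
  have "w \<in> gen (\<sigma> ` J)" using assms(1) unfolding WJ_def .
  then show ?thesis
  proof (induction rule: gen.induct)
    case gen_one show ?case by (rule assms(2))
  next
    case (gen_step x a)
    then obtain s where "s \<in> J" "a = \<sigma> s" by auto
    then show ?case using assms(3)[of x s] gen_step unfolding WJ_def by simp
  qed
qed

lemma WJ_inv_ex: "w \<in> WJ m J \<Longrightarrow> \<exists>w'\<in>WJ m J. w ** w' = mat 1 \<and> w' ** w = mat 1"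
proof (induction rule: WJ_induct)
  case one show ?case by (rule bexI[of _ "mat 1"]) auto
next
  case (step w s)
  then obtain w' where w': "w' \<in> WJ m J" "w ** w' = mat 1" "w' ** w = mat 1" by blast
  have "\<sigma> s ** w' \<in> WJ m J" by (intro WJ_mult sref_WJ w' step)
  moreover have "(w ** \<sigma> s) ** (\<sigma> s ** w') = w ** (\<sigma> s ** (\<sigma> s ** w'))"
    by (simp add: matrix_mul_assoc)
  moreover have "(\<sigma> s ** w') ** (w ** \<sigma> s) = \<sigma> s ** (w' ** w) ** \<sigma> s"
    by (simp add: matrix_mul_assoc)
  ultimately show ?case using w' by (intro bexI[of _ "\<sigma> s ** w'"]) (simp_all add: matrix_mul_assoc)
qed

lemma WJ_inv: assumes "w \<in> WJ m J" shows "iv w \<in> WJ m J"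
  using WJ_inv_ex[OF assms] matrix_inv_unique by metis

lemma W_inv [simp]: assumes "w \<in> W" shows "w ** iv w = mat 1" "iv w ** w = mat 1"
  using WJ_inv_ex[OF assms] matrix_inv_unique by metis+

lemma W_inv_inv [simp]: "w \<in> W \<Longrightarrow> iv (iv w) = w"
  by (rule matrix_inv_unique) simp_all

lemma W_cancel [simp]: assumes "w \<in> W"
  shows "w ** (iv w ** x) = x" "iv w ** (w ** x) = x" "x ** w ** iv w = x" "x ** iv w ** w = x"
  using W_inv[OF assms] by (simp_all add: matrix_mul_assoc) (simp_all flip: matrix_mul_assoc)

lemma W_vcancel [simp]: assumes "w \<in> W"
  shows "v v* w v* iv w = v" "v v* iv w v* w = v"
  using W_inv[OF assms] by (simp_all add: vector_matrix_mul_assoc)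

lemma W_inv_mult: "w \<in> W \<Longrightarrow> x \<in> W \<Longrightarrow> iv (w ** x) = iv x ** iv w"
  by (rule matrix_inv_unique) (simp_all flip: matrix_mul_assoc)

lemma inv_sref [simp]: "iv (\<sigma> s) = \<sigma> s" by (rule matrix_inv_unique) simp_all

lemma inv_one [simp]: "iv (mat 1 :: 's mat) = mat 1" by (rule matrix_inv_unique) simp_all

lemma W_B: "w \<in> W \<Longrightarrow> B (u v* w) (v v* w) = B u v"
proof (induction arbitrary: u v rule: WJ_induct)
  case (step w s)
  then show ?case by (simp add: vector_matrix_mul_assoc[symmetric] sref_B)
qed simp

lemma W_B_inv: "w \<in> W \<Longrightarrow> B (u v* w) v = B u (v v* iv w)"
  using W_B[of "iv w" "u v* w" v] WJ_inv[of w UNIV] by simp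

lemma sref_W [simp]: "\<sigma> s \<in> W" by (rule sref_WJ) simp

lemma W_inj: "w \<in> W \<Longrightarrow> u v* w = v v* w \<Longrightarrow> u = v"
  by (metis W_vcancel(1))

section \<open>Words, the length function and the determinant\<close>

lemma foldl_word: "foldl (\<lambda>a s. a ** \<sigma> s) (x :: 's mat) ss = x ** word_prod m ss"
proof (induction ss arbitrary: x)
  case (Cons s ss)
  have "foldl (\<lambda>a s. a ** \<sigma> s) x (s # ss) = (x ** \<sigma> s) ** word_prod m ss" using Cons by simp
  also have "\<dots> = x ** ((mat 1 ** \<sigma> s) ** word_prod m ss)" by (simp add: matrix_mul_assoc)
  also have "(mat 1 ** \<sigma> s) ** word_prod m ss = word_prod m (s # ss)"
    using Cons[of "mat 1 ** \<sigma> s"] unfolding word_prod_def by simp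
  finally show ?case .
qed (simp add: word_prod_def)

lemma word_Nil [simp]: "word_prod m [] = mat 1" by (simp add: word_prod_def)

lemma word_append: "word_prod m (xs @ ys) = word_prod m xs ** word_prod m ys"
proof -
  have "word_prod m (xs @ ys) = foldl (\<lambda>a s. a ** \<sigma> s) (foldl (\<lambda>a s. a ** \<sigma> s) (mat 1) xs) ys"
    by (simp add: word_prod_def)
  also have "\<dots> = foldl (\<lambda>a s. a ** \<sigma> s) (mat 1) xs ** word_prod m ys" by (rule foldl_word)
  finally show ?thesis by (simp add: word_prod_def)
qed

lemma word_single [simp]: "word_prod m [s] = \<sigma> s"
  by (simp add: word_prod_def)

lemma word_Cons [simp]: "word_prod m (s # ss) = \<sigma> s ** word_prod m ss"
  using word_append[of "[s]" ss] by simp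

lemma word_WJ: "set ss \<subseteq> J \<Longrightarrow> word_prod m ss \<in> WJ m J"
  by (induction ss) (auto intro: WJ_mult sref_WJ)

lemma word_W [simp]: "word_prod m ss \<in> W" by (rule word_WJ) simp

lemma W_word: "w \<in> W \<Longrightarrow> \<exists>ss. word_prod m ss = w"
proof (induction rule: WJ_induct)
  case one show ?case by (rule exI[of _ "[]"]) simp
next
  case (step w s)
  then obtain ss where "word_prod m ss = w" by auto
  then show ?case by (intro exI[of _ "ss @ [s]"]) (simp add: word_append)
qed

lemma len_le: "word_prod m ss = w \<Longrightarrow> len m w \<le> length ss"
  unfolding len_def by (rule Least_le) auto

lemma len_word: assumes "w \<in> W" shows "\<exists>ss. length ss = len m w \<and> word_prod m ss = w"
proof -
  obtain ss where "word_prod m ss = w" using W_word[OF assms] by auto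
  then have "\<exists>ss'. length ss' = length ss \<and> word_prod m ss' = w" by auto
  then show ?thesis
    unfolding len_def by (rule LeastI[of "\<lambda>n. \<exists>ss. length ss = n \<and> word_prod m ss = w"])
qed

lemma len_mult: assumes "x \<in> W" "y \<in> W" shows "len m (x ** y) \<le> len m x + len m y"
proof -
  obtain xs ys where "length xs = len m x" "word_prod m xs = x" "length ys = len m y" "word_prod m ys = y"
    using len_word assms by metis
  then show ?thesis using len_le[of "xs @ ys" "x ** y"] by (simp add: word_append)
qed

lemma len_zero: "w \<in> W \<Longrightarrow> len m w = 0 \<Longrightarrow> w = mat 1"
  using len_word[of w] by auto

text \<open>The matrix differs from the identity only in column \<open>s\<close>, and a permutation
  other than the identity sends some moved index to a column other than \<open>s\<close>. Only the
  diagonal term of the determinant survives.\<close>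

lemma det_sref: "det (\<sigma> s) = -1"
proof -
  have *: "(\<Prod>i\<in>UNIV. \<sigma> s $ i $ p i) = 0" if p: "p permutes UNIV" "p \<noteq> id" for p
  proof -
    from p(2) obtain i where i: "p i \<noteq> i" by (auto simp: fun_eq_iff)
    have "\<exists>i. p i \<noteq> i \<and> p i \<noteq> s"
    proof (cases "p i = s")
      case True
      then have "p s \<noteq> s" using p(1) i by (metis permutes_inj injD)
      moreover have "p (p i) \<noteq> p i" using p(1) i by (metis permutes_inj injD)
      ultimately show ?thesis using True by (metis)
    qed (use i in auto)
    then obtain j where "p j \<noteq> j" "p j \<noteq> s" by auto
    then have "\<sigma> s $ j $ p j = 0" by (simp add: sref_def)
    then show ?thesis by (auto intro: prod_zero)
  qed
  have "det (\<sigma> s) = (\<Sum>p\<in>{p. p permutes UNIV}. of_int (sign p) * (\<Prod>i\<in>UNIV. \<sigma> s $ i $ p i))"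
    by (simp add: det_def)
  also have "\<dots> = (\<Sum>p\<in>{id}. of_int (sign p) * (\<Prod>i\<in>UNIV. \<sigma> s $ i $ p i))"
    by (rule sum.mono_neutral_right) (auto simp: permutes_id *)
  also have "\<dots> = (\<Prod>i\<in>UNIV. \<sigma> s $ i $ i)" by (simp add: sign_id)
  also have "\<dots> = (\<Prod>i\<in>UNIV. if i = s then -1 else 1)"
    by (rule prod.cong) (auto simp: sref_def)
  also have "\<dots> = -1" by (simp add: prod.delta)
  finally show ?thesis .
qed

lemma det_word: "det (word_prod m ss) = (-1) ^ length ss"
  by (induction ss) (simp_all add: det_mul det_sref)

lemma det_len: "w \<in> W \<Longrightarrow> det w = (-1) ^ len m w"
  using len_word[of w] det_word by metis

lemma det_W_sq: "w \<in> W \<Longrightarrow> det w * det w = 1"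
  by (simp add: det_len flip: power_add)

lemma len_sref_le: "w \<in> W \<Longrightarrow> len m (\<sigma> s ** w) \<le> Suc (len m w)"
  using len_mult[of "\<sigma> s" w] len_le[of "[s]" "\<sigma> s"] by simp

text \<open>The determinant of an element is the parity of its length, and a simple reflection
  changes its sign.\<close>

lemma len_sref_neq: assumes "w \<in> W" shows "len m (\<sigma> s ** w) \<noteq> len m w"
proof
  assume "len m (\<sigma> s ** w) = len m w"
  then have "det (\<sigma> s ** w) = det w" using det_len WJ_mult[OF sref_W assms] assms by metis
  moreover have "det w \<noteq> 0" using det_W_sq[OF assms] by auto
  ultimately show False by (simp add: det_mul det_sref)
qed

lemma len_sref_cases: assumes "w \<in> W"
  shows "len m (\<sigma> s ** w) = Suc (len m w) \<or> Suc (len m (\<sigma> s ** w)) = len m w"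
  using len_sref_le[OF assms, of s] len_sref_neq[OF assms, of s] len_sref_le[of "\<sigma> s ** w" s]
    WJ_mult[OF sref_W assms, of s] by fastforce

lemma len_descent: assumes "w \<in> W" "len m w > 0" shows "\<exists>s. len m (\<sigma> s ** w) < len m w"
proof -
  obtain ss where ss: "length ss = len m w" "word_prod m ss = w" using len_word assms by metis
  then obtain s ss' where "ss = s # ss'" using assms by (cases ss) auto
  then show ?thesis using ss len_le[of ss' "\<sigma> s ** w"] by (intro exI[of _ s]) auto
qed

end

section \<open>The plane of two simple roots\<close>

fun altw :: "'a \<Rightarrow> 'a \<Rightarrow> nat \<Rightarrow> 'a list" where
  "altw a b 0 = []"
| "altw a b (Suc k) = a # altw b a k"

text \<open>The recursion adds letters in front, but the right action on row vectors is computed by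
  induction on the last letter.\<close>

lemma altw_snoc: "altw a b (Suc k) = altw a b k @ [if even k then a else b]"
proof (induction k arbitrary: a b)
  case (Suc k)
  then show ?case using altw.simps(2)[of a b "Suc k"] altw.simps(2)[of a b k] by simp
qed simp

lemma length_altw [simp]: "length (altw a b k) = k"
  by (induction k arbitrary: a b) auto

lemma set_altw: "set (altw a b k) \<subseteq> {a, b}"
proof (induction k arbitrary: a b)
  case (Suc k) then show ?case by (simp, metis insert_commute)
qed simp

lemma altw_append: "altw a b (j + k) = altw a b j @ (if even j then altw a b k else altw b a k)"
  by (induction j arbitrary: a b) auto

text \<open>The complex coordinate \<open>\<tau>\<close> restricts to an isometry from the plane \<open>P\<close> of the two simple roots
  onto the complex numbers, with \<open>\<tau> (al s) = 1\<close> and \<open>\<tau> (al t) = \<epsilon>\<close>; its kernel is the fixed space of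
  the dihedral group \<open>WL\<close>.\<close>

locale rank2 = coxeter m for m :: "'s::finite \<Rightarrow> 's \<Rightarrow> nat" +
  fixes s t :: 's
  assumes st: "s \<noteq> t"
begin

definition n :: nat where "n = m s t"
definition \<theta> :: real where "\<theta> = pi / real n"
definition \<tau> :: "real^'s \<Rightarrow> complex" where
  "\<tau> v = Complex (B v (al s)) ((B v (al t) + cos \<theta> * B v (al s)) / sin \<theta>)"
definition \<epsilon> :: complex where "\<epsilon> = Complex (- cos \<theta>) (sin \<theta>)"
definition P :: "(real^'s) set" where "P = {a *\<^sub>R al s + b *\<^sub>R al t | a b. True}"
abbreviation "WL \<equiv> WJ m {s, t}"

lemma n_ge_2: "n \<ge> 2" using cox st unfolding coxeter_matrix_def n_def by blast
lemma n_pos [simp]: "0 < n" using n_ge_2 by simp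
lemma n\<theta>: "real n * \<theta> = pi" unfolding \<theta>_def using n_ge_2 by simp
lemma \<theta>_pos: "0 < \<theta>" unfolding \<theta>_def using n_ge_2 by simp
lemma \<theta>_le: "\<theta> \<le> pi / 2" unfolding \<theta>_def using n_ge_2 by (intro divide_left_mono) auto
lemma sin_pos [simp]: "0 < sin \<theta>" using \<theta>_pos \<theta>_le pi_gt_zero by (intro sin_gt_zero) linarith+
lemma sin_nz [simp]: "sin \<theta> \<noteq> 0" using sin_pos by linarith
lemma cos_nonneg: "0 \<le> cos \<theta>" using \<theta>_pos \<theta>_le by (intro cos_ge_zero) auto
lemma cos_lt1: "cos \<theta> < 1"
  using cos_monotone_0_pi[of 0 \<theta>] \<theta>_pos \<theta>_le pi_gt_zero by simp

lemma Bst: "Bmat m s t = - cos \<theta>" "Bmat m t s = - cos \<theta>"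
  using Bmat_sym[of t s] by (simp_all add: Bmat_def \<theta>_def n_def)

lemma cos_sin_sq1: "cos \<theta> * cos \<theta> + sin \<theta> * sin \<theta> = 1"
  using sin_cos_squared_add3[of \<theta>] by simp

lemma \<tau>_add: "\<tau> (u + v) = \<tau> u + \<tau> v" and \<tau>_scale: "\<tau> (c *\<^sub>R u) = of_real c * \<tau> u"
  and \<tau>_diff: "\<tau> (u - v) = \<tau> u - \<tau> v" and \<tau>_minus: "\<tau> (- u) = - \<tau> u" and \<tau>_0 [simp]: "\<tau> 0 = 0"
  unfolding \<tau>_def by (simp_all add: complex_eq_iff Bform_linear field_simps)

lemmas \<tau>_linear = \<tau>_add \<tau>_scale \<tau>_diff \<tau>_minus

lemma \<tau>_s [simp]: "\<tau> (al s) = 1"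
  unfolding \<tau>_def by (simp add: complex_eq_iff Bst)

lemma \<tau>_t [simp]: "\<tau> (al t) = \<epsilon>"
proof -
  have "1 - cos \<theta> * cos \<theta> = sin \<theta> * sin \<theta>" using cos_sin_sq1 by linarith
  then show ?thesis unfolding \<tau>_def \<epsilon>_def by (simp add: complex_eq_iff Bst)
qed

lemma Re_\<tau>: "Re (\<tau> v) = B v (al s)" by (simp add: \<tau>_def)
lemma B_t: "B v (al t) = sin \<theta> * Im (\<tau> v) - cos \<theta> * Re (\<tau> v)" by (simp add: \<tau>_def)

lemma \<epsilon>_cis: "\<epsilon> = - cis (- \<theta>)" by (simp add: \<epsilon>_def complex_eq_iff)
lemma \<epsilon>_sq: "\<epsilon> * \<epsilon> = cis (- 2 * \<theta>)" by (simp add: \<epsilon>_cis cis_mult)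

lemma \<tau>_sref_s: "\<tau> (v v* \<sigma> s) = - cnj (\<tau> v)"
  unfolding sref_act \<tau>_linear by (simp add: complex_eq_iff Re_\<tau>)

lemma \<tau>_sref_t: "\<tau> (v v* \<sigma> t) = - cis (- 2 * \<theta>) * cnj (\<tau> v)"
proof -
  have "\<tau> (v v* \<sigma> t) = \<tau> v - (2 * B v (al t)) *\<^sub>R \<epsilon>"
    unfolding sref_act \<tau>_linear by (simp add: scaleR_conv_of_real)
  also have "\<dots> = - (\<epsilon> * \<epsilon>) * cnj (\<tau> v)"
    using cos_sin_sq1 unfolding B_t \<epsilon>_def complex_eq_iff
    by (simp, algebra)
  finally show ?thesis by (simp add: \<epsilon>_sq)
qed

lemma P_s [simp]: "al s \<in> P" unfolding P_def by (rule CollectI, rule exI[of _ 1], rule exI[of _ 0]) simp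
lemma P_t [simp]: "al t \<in> P" unfolding P_def by (rule CollectI, rule exI[of _ 0], rule exI[of _ 1]) simp

lemma P_scale: "v \<in> P \<Longrightarrow> c *\<^sub>R v \<in> P"
  unfolding P_def by (auto simp: scaleR_add_right) blast
lemma P_add: "u \<in> P \<Longrightarrow> v \<in> P \<Longrightarrow> u + v \<in> P"
proof -
  assume "u \<in> P" "v \<in> P"
  then obtain a b c d where "u = a *\<^sub>R al s + b *\<^sub>R al t" "v = c *\<^sub>R al s + d *\<^sub>R al t"
    unfolding P_def by auto
  then have "u + v = (a + c) *\<^sub>R al s + (b + d) *\<^sub>R al t" by (simp add: algebra_simps)
  then show ?thesis unfolding P_def by blast
qed
lemma P_minus: "v \<in> P \<Longrightarrow> - v \<in> P" using P_scale[of v "-1"] by simp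
lemma P_diff: "u \<in> P \<Longrightarrow> v \<in> P \<Longrightarrow> u - v \<in> P" using P_add[of u "- v"] P_minus[of v] by simp

lemma \<tau>_P_inj: assumes "v \<in> P" "\<tau> v = 0" shows "v = 0"
proof -
  obtain a b where v: "v = a *\<^sub>R al s + b *\<^sub>R al t" using assms(1) unfolding P_def by auto
  have "of_real a + of_real b * \<epsilon> = 0" using assms(2) unfolding v \<tau>_linear by simp
  then have "b = 0 \<and> a = 0" unfolding \<epsilon>_def complex_eq_iff by auto
  then show ?thesis by (simp add: v)
qed

lemma P_coord: assumes "v \<in> P"
  shows "v = (Re (\<tau> v) + cos \<theta> * Im (\<tau> v) / sin \<theta>) *\<^sub>R al s + (Im (\<tau> v) / sin \<theta>) *\<^sub>R al t"
proof -
  obtain a b where v: "v = a *\<^sub>R al s + b *\<^sub>R al t" using assms(1) unfolding P_def by auto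
  have "\<tau> v = of_real a + of_real b * \<epsilon>" unfolding v \<tau>_linear by simp
  then have "Im (\<tau> v) = b * sin \<theta>" "Re (\<tau> v) = a - b * cos \<theta>" by (simp_all add: \<epsilon>_def)
  then show ?thesis using v by simp
qed

text \<open>The projection onto \<open>P\<close> along the kernel of \<open>\<tau>\<close>: the
  coefficients solve for the point of \<open>P\<close> with prescribed coordinate, as in
  \<open>P_coord\<close>.\<close>

definition prj :: "real^'s \<Rightarrow> real^'s" where
  "prj v = (Re (\<tau> v) + cos \<theta> * Im (\<tau> v) / sin \<theta>) *\<^sub>R al s + (Im (\<tau> v) / sin \<theta>) *\<^sub>R al t"

lemma prj_P [simp]: "prj v \<in> P" unfolding prj_def P_def by blast

lemma \<tau>_prj [simp]: "\<tau> (prj v) = \<tau> v"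
  unfolding prj_def \<tau>_linear by (simp add: complex_eq_iff \<epsilon>_def)

lemma WL_P: "w \<in> WL \<Longrightarrow> v v* w - v \<in> P"
proof (induction arbitrary: v rule: WJ_induct)
  case one then show ?case using P_scale[of "al s" 0] by simp
next
  case (step w r)
  have "v v* (w ** \<sigma> r) - v = (v v* w - v) - (2 * B (v v* w) (al r)) *\<^sub>R al r"
    unfolding vector_matrix_mul_assoc[symmetric] sref_act[of "v v* w"] by simp
  moreover have "al r \<in> P" using step by auto
  ultimately show ?case using step P_diff P_scale by metis
qed

text \<open>Elements of \<open>WL\<close> move a vector only by elements of \<open>P\<close>, where
  \<open>\<tau>\<close> is injective. Identities in \<open>WL\<close> thus become identities between
  complex numbers.\<close>

lemma WL_eqI: assumes "w \<in> WL" "w' \<in> WL" "\<And>v. \<tau> (v v* w) = \<tau> (v v* w')" shows "w = w'"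
proof (rule matrix_eqI_rows)
  fix v
  have "v v* w - v v* w' = (v v* w - v) - (v v* w' - v)" by simp
  then have "v v* w - v v* w' \<in> P" using WL_P[OF assms(1), of v] WL_P[OF assms(2), of v] P_diff by metis
  moreover have "\<tau> (v v* w - v v* w') = 0" using assms(3)[of v] by (simp add: \<tau>_linear)
  ultimately show "v v* w = v v* w'" using \<tau>_P_inj by force
qed

lemma \<tau>_alt_ts: "\<tau> (v v* word_prod m (altw t s k)) =
   (if even k then cis (real k * \<theta>) * \<tau> v else - cis (- (real k + 1) * \<theta>) * cnj (\<tau> v))"
proof (induction k)
  case (Suc k)
  show ?case
  proof (cases "even k")
    case True
    have "cis (- 2 * \<theta>) * cis (- (real k * \<theta>)) = cis (- (real (Suc k) + 1) * \<theta>)"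
      unfolding cis_mult by (rule arg_cong[of _ _ cis]) (simp add: algebra_simps)
    then show ?thesis unfolding altw_snoc word_append vector_matrix_mul_assoc[symmetric]
      using True by (simp add: Suc \<tau>_sref_t cis_cnj flip: mult.assoc)
  next
    case False
    have "- ((- real k - 1) * \<theta>) = (1 + real k) * \<theta>"
      by (simp add: algebra_simps)
    then show ?thesis unfolding altw_snoc word_append vector_matrix_mul_assoc[symmetric]
      using False by (simp add: Suc \<tau>_sref_s cis_cnj)
  qed
qed simp

lemma \<tau>_alt_st: "\<tau> (v v* word_prod m (altw s t k)) =
   (if even k then cis (- real k * \<theta>) * \<tau> v else - cis ((real k - 1) * \<theta>) * cnj (\<tau> v))"
proof (induction k)
  case (Suc k)
  show ?case
  proof (cases "even k")
    case True
    then show ?thesis unfolding altw_snoc word_append vector_matrix_mul_assoc[symmetric]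
      by (simp add: Suc \<tau>_sref_s cis_cnj)
  next
    case False
    have "cis (- 2 * \<theta>) * cis (- ((real k - 1) * \<theta>)) = cis (- real (Suc k) * \<theta>)"
      unfolding cis_mult by (rule arg_cong[of _ _ cis]) (simp add: algebra_simps)
    then show ?thesis unfolding altw_snoc word_append vector_matrix_mul_assoc[symmetric]
      using False by (simp add: Suc \<tau>_sref_t cis_cnj flip: mult.assoc)
  qed
qed simp

lemma alt_WL: "word_prod m (altw s t k) \<in> WL" "word_prod m (altw t s k) \<in> WL"
  using set_altw[of s t k] set_altw[of t s k] by (auto intro!: word_WJ)

text \<open>By \<open>n * \<theta> = pi\<close>, the angles of the two alternating words differ by
  \<open>2 * pi\<close>.\<close>

lemma braid: "word_prod m (altw t s n) = word_prod m (altw s t n)"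
proof (rule WL_eqI)
  fix v
  have 1: "- (real n + 1) * \<theta> = - pi - \<theta>" "(real n - 1) * \<theta> = pi - \<theta>" "- real n * \<theta> = - pi"
    using n\<theta> by (simp_all add: algebra_simps)
  have "cis (- pi - \<theta>) = - cis (- \<theta>)" "cis (pi - \<theta>) = - cis (-\<theta>)"
    by (simp_all add: complex_eq_iff sin_diff cos_diff)
  then show "\<tau> (v v* word_prod m (altw t s n)) = \<tau> (v v* word_prod m (altw s t n))"
    unfolding \<tau>_alt_ts \<tau>_alt_st 1 n\<theta> by (simp add: complex_eq_iff)
qed (auto simp: alt_WL)

text \<open>The two coefficients are \<open>sin ((k + 1) * \<theta>) / sin \<theta>\<close> and
  \<open>sin (k * \<theta>) / sin \<theta>\<close>, in this order for even \<open>k\<close> and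
  exchanged for odd \<open>k\<close>. Both angles stay within \<open>[0, pi]\<close> exactly because
  \<open>k < n\<close>.\<close>

lemma alt_pos: assumes "k < n"
  shows "\<exists>p q. 0 \<le> p \<and> 0 \<le> q \<and> al s v* word_prod m (altw t s k) = p *\<^sub>R al s + q *\<^sub>R al t"
proof -
  let ?v = "al s v* word_prod m (altw t s k)"
  have "?v - al s \<in> P" using WL_P alt_WL by blast
  then have vP: "?v \<in> P" using P_add[OF _ P_s] by fastforce
  have k1: "0 \<le> real k * \<theta>" "(real k + 1) * \<theta> \<le> pi" "real k * \<theta> \<le> pi"
  proof -
    show "0 \<le> real k * \<theta>" using \<theta>_pos by simp
    have "real k + 1 \<le> real n" using assms by simp
    then have "(real k + 1) * \<theta> \<le> real n * \<theta>" using \<theta>_pos by (intro mult_right_mono) auto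
    then show "(real k + 1) * \<theta> \<le> pi" using n\<theta> by simp
    then show "real k * \<theta> \<le> pi" using \<theta>_pos by (simp add: algebra_simps)
  qed
  have nn: "0 \<le> sin (real k * \<theta>)" "0 \<le> sin ((real k + 1) * \<theta>)"
    using k1 \<theta>_pos by (auto intro!: sin_ge_zero)
  have "0 \<le> Im (\<tau> ?v) \<and> 0 \<le> sin \<theta> * Re (\<tau> ?v) + cos \<theta> * Im (\<tau> ?v)"
  proof (cases "even k")
    case True
    then have z: "\<tau> ?v = cis (real k * \<theta>)" by (simp add: \<tau>_alt_ts)
    have "sin \<theta> * cos (real k * \<theta>) + cos \<theta> * sin (real k * \<theta>) = sin ((real k + 1) * \<theta>)"
      by (simp add: sin_add algebra_simps)
    then show ?thesis using nn by (simp add: z)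
  next
    case False
    then have z: "\<tau> ?v = - cis (- (real k + 1) * \<theta>)" by (simp add: \<tau>_alt_ts)
    have "sin (real k * \<theta>) = sin ((real k + 1) * \<theta> - \<theta>)" by (simp add: algebra_simps)
    also have "\<dots> = sin ((real k + 1) * \<theta>) * cos \<theta> - cos ((real k + 1) * \<theta>) * sin \<theta>"
      by (simp add: sin_diff)
    finally have *: "sin (real k * \<theta>) = \<dots>" .
    have "Im (\<tau> ?v) = sin ((real k + 1) * \<theta>)" "Re (\<tau> ?v) = - cos ((real k + 1) * \<theta>)"
      unfolding z cis.simps mult_minus_left sin_minus cos_minus by (simp_all)
    then show ?thesis using nn * by (simp add: algebra_simps)
  qed
  then have "0 \<le> Im (\<tau> ?v) / sin \<theta>" "0 \<le> (sin \<theta> * Re (\<tau> ?v) + cos \<theta> * Im (\<tau> ?v)) / sin \<theta>"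
    using sin_pos by (simp_all add: divide_nonneg_pos)
  then have "0 \<le> Im (\<tau> ?v) / sin \<theta>" "0 \<le> Re (\<tau> ?v) + cos \<theta> * Im (\<tau> ?v) / sin \<theta>"
    by (simp_all add: add_divide_distrib)
  then show ?thesis using P_coord[OF vP] by blast
qed

end

section \<open>Descents and the signs of roots\<close>

context coxeter
begin

text \<open>Strip the longest alternating prefix in \<open>s, t\<close> off \<open>w\<close>. By the braid relation it has fewer than
  \<open>m s t\<close> letters, so the dihedral computation \<open>alt_pos\<close> applies to it and induction to the rest.\<close>

theorem row_pos:
  assumes "w \<in> W" "len m (\<sigma> s ** w) > len m w"
  shows "w $ s $ j \<ge> 0"
  using assms
proof (induction "len m w" arbitrary: w s j rule: less_induct)
  case less
  show ?case
  proof (cases "len m w = 0")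
    case True
    then have "w = mat 1" using len_zero less by blast
    then show ?thesis by (simp add: mat_def)
  next
    case False
    then obtain t where t: "len m (\<sigma> t ** w) < len m w" using len_descent less by blast
    have ts: "s \<noteq> t" using t less by auto
    interpret rank2 m s t by unfold_locales (rule ts)
    \<comment> \<open>\<open>Q k\<close> says that some reduced expression of \<open>w\<close>
      starts with the alternating word of \<open>k\<close> letters beginning with
      \<open>t\<close>.\<close>
    define Q where "Q k \<longleftrightarrow> (\<exists>w'\<in>W. w = word_prod m (altw t s k) ** w' \<and> len m w' + k = len m w)" for k
    have Q1: "Q 1" unfolding Q_def
    proof (rule bexI[of _ "\<sigma> t ** w"])
      show "\<sigma> t ** w \<in> W" using less by (simp add: WJ_mult)
      then show "w = word_prod m (altw t s 1) ** (\<sigma> t ** w) \<and> len m (\<sigma> t ** w) + 1 = len m w"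
        using t len_sref_cases[OF less(2), of t] by auto
    qed
    have Qb: "Q k \<Longrightarrow> k \<le> len m w" for k unfolding Q_def by auto
    define k where "k = (GREATEST k. Q k)"
    have Qk: "Q k" unfolding k_def using GreatestI_nat[of Q 1 "len m w"] Q1 Qb by blast
    have kmax: "Q j \<Longrightarrow> j \<le> k" for j unfolding k_def using Greatest_le_nat[of Q j "len m w"] Qb by blast
    have k1: "1 \<le> k" using kmax[OF Q1] .
    obtain w' where w': "w' \<in> W" "w = word_prod m (altw t s k) ** w'" "len m w' + k = len m w"
      using Qk unfolding Q_def by auto
    \<comment> \<open>\<open>u\<close> is the letter that would prolong the prefix and
      \<open>u'\<close> is its last letter. Neither shortens \<open>w'\<close>: the first by
      maximality of \<open>k\<close>, the second because the expression of \<open>w\<close> is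
      reduced.\<close>
    define u where "u = (if even k then t else s)"
    define u' where "u' = (if even k then s else t)"
    have u: "len m (\<sigma> u ** w') > len m w'"
    proof (rule ccontr)
      assume "\<not> ?thesis"
      then have l: "Suc (len m (\<sigma> u ** w')) = len m w'" using len_sref_cases[OF w'(1), of u] by auto
      have "Q (Suc k)" unfolding Q_def
      proof (rule bexI[of _ "\<sigma> u ** w'"])
        show "\<sigma> u ** w' \<in> W" using w' by (simp add: WJ_mult)
        have "word_prod m (altw t s (Suc k)) ** (\<sigma> u ** w') = word_prod m (altw t s k) ** (\<sigma> u ** (\<sigma> u ** w'))"
          unfolding altw_snoc word_append u_def by (simp only: matrix_mul_assoc word_single)
        then show "w = word_prod m (altw t s (Suc k)) ** (\<sigma> u ** w') \<and> len m (\<sigma> u ** w') + Suc k = len m w"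
          using w' l by simp
      qed
      then show False using kmax[of "Suc k"] by simp
    qed
    have u': "len m (\<sigma> u' ** w') > len m w'"
    proof -
      obtain k' where k': "k = Suc k'" using k1 by (cases k) auto
      have "w = word_prod m (altw t s k') ** (\<sigma> u' ** w')"
        using w'(2) unfolding k' altw_snoc word_append u'_def by (simp add: matrix_mul_assoc)
      then have "len m w \<le> len m (word_prod m (altw t s k')) + len m (\<sigma> u' ** w')"
        using len_mult[of "word_prod m (altw t s k')" "\<sigma> u' ** w'"] w' by (simp add: WJ_mult)
      also have "\<dots> \<le> k' + len m (\<sigma> u' ** w')" using len_le[of "altw t s k'"] by simp
      finally show ?thesis using w'(3) k' by simp
    qed
    have lw: "len m w' < len m w" using w'(3) k1 by simp
    have nn: "w' $ s $ i \<ge> 0 \<and> w' $ t $ i \<ge> 0" for i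
      using less(1)[OF lw w'(1) u, of i] less(1)[OF lw w'(1) u', of i] unfolding u_def u'_def
      by (auto split: if_splits)
    have "k < n"
    proof (rule ccontr)
      assume "\<not> k < n"
      then obtain j where j: "k = n + j" using le_Suc_ex by (metis not_less)
      obtain n' where n': "n = Suc n'" using n_ge_2 by (cases n) auto
      define rest where "rest = (if even n then altw t s j else altw s t j)"
      have "word_prod m (altw t s k) = word_prod m (altw s t n) ** word_prod m rest"
        unfolding j altw_append word_append rest_def braid by simp
      then have "\<sigma> s ** w = word_prod m (altw t s n' @ rest) ** w'"
        unfolding w'(2) n' by (simp add: word_append matrix_mul_assoc)
      then have "len m (\<sigma> s ** w) \<le> len m (word_prod m (altw t s n' @ rest)) + len m w'"
        using len_mult[OF word_W w'(1)] by simp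
      also have "\<dots> \<le> (n' + j) + len m w'"
        using len_le[of "altw t s n' @ rest"] by (simp add: rest_def split: if_splits)
      finally show False using w'(3) j n' less(3) by simp
    qed
    then obtain p q where pq: "0 \<le> p" "0 \<le> q"
      "al s v* word_prod m (altw t s k) = p *\<^sub>R al s + q *\<^sub>R al t" using alt_pos by blast
    have "al s v* w = p *\<^sub>R (al s v* w') + q *\<^sub>R (al t v* w')"
      unfolding w'(2) vector_matrix_mul_assoc[symmetric] pq(3) vector_matrix_left_distrib
        scaleR_vector_matrix_assoc by simp
    then have "(al s v* w) $ j = p * w' $ s $ j + q * w' $ t $ j" by simp
    then show ?thesis using nn pq by simp
  qed
qed

end

section \<open>Positive roots, coset representatives and finiteness\<close>

lemma al_nth: "(al r :: real^'s::finite) $ j = (if j = r then 1 else 0)"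
  by (simp add: axis_def)

context coxeter
begin

lemma W_row_nz: assumes "w \<in> W" shows "\<exists>j. w $ r $ j \<noteq> 0"
proof (rule ccontr)
  assume "\<not> ?thesis"
  then have "al r v* w = 0 v* w" by (simp add: vec_eq_iff)
  then show False using W_inj[OF assms] by (metis axis_eq_0_iff zero_neq_one)
qed

lemma mult_nth: "(x ** y) $ i $ j = (\<Sum>k\<in>UNIV. x $ i $ k * y $ k $ j)" for x y :: "'s mat"
  by (simp add: matrix_matrix_mult_def)

lemma sref_row: "(\<sigma> r ** w) $ r $ j = - w $ r $ j"
proof -
  have "al r v* (\<sigma> r ** w) = - (al r v* w)"
    by (simp add: vector_matrix_mul_assoc[symmetric] vector_matrix_minus)
  then show ?thesis by (metis al_mult_nth vector_uminus_component)
qed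

lemma row_neg: assumes "w \<in> W" "len m (\<sigma> r ** w) < len m w" shows "w $ r $ j \<le> 0"
proof -
  have "(\<sigma> r ** w) $ r $ j \<ge> 0"
    using assms by (intro row_pos) (simp_all add: WJ_mult)
  then show ?thesis by (simp add: sref_row)
qed

lemma row_sign: assumes "w \<in> W" shows "(\<forall>j. w $ r $ j \<ge> 0) \<or> (\<forall>j. w $ r $ j \<le> 0)"
  using row_pos[OF assms, of r] row_neg[OF assms, of r] len_sref_cases[OF assms, of r] by fastforce

lemma row_sign_excl: assumes "w \<in> W" "\<forall>j. w $ r $ j \<ge> 0" "\<forall>j. w $ r $ j \<le> 0" shows False
  using W_row_nz[OF assms(1)] assms(2,3) by (meson order_antisym)

text \<open>This trades the length condition for signs of matrix entries, in which form products
  with coset representatives can be computed.\<close>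

lemma XJ_iff: "w \<in> XJ m J \<longleftrightarrow> w \<in> W \<and> (\<forall>r\<in>J. \<forall>j. w $ r $ j \<ge> 0)"
proof -
  have "len m (\<sigma> r ** w) > len m w \<longleftrightarrow> (\<forall>j. w $ r $ j \<ge> 0)" if "w \<in> W" for r
    using row_pos[OF that, of r] row_neg[OF that, of r] len_sref_cases[OF that, of r]
      row_sign_excl[OF that] by fastforce
  then show ?thesis unfolding XJ_def by blast
qed

lemma row_pos_one: assumes "w \<in> W" "\<forall>r j. w $ r $ j \<ge> 0" shows "w = mat 1"
proof (rule ccontr)
  assume "w \<noteq> mat 1"
  then obtain r where "len m (\<sigma> r ** w) < len m w"
    using len_descent[OF assms(1)] len_zero[OF assms(1)] by auto
  then show False using row_neg[OF assms(1)] row_sign_excl[OF assms(1)] assms(2) by blast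
qed

lemma conj_act: assumes "w \<in> W"
  shows "v v* (iv w ** \<sigma> r ** w) = v - (2 * B v (al r v* w)) *\<^sub>R (al r v* w)"
proof -
  have "v v* (iv w ** \<sigma> r ** w) = ((v v* iv w) v* \<sigma> r) v* w" by (simp add: vector_matrix_mul_assoc)
  also have "\<dots> = v - (2 * B (v v* iv w) (al r)) *\<^sub>R (al r v* w)"
    unfolding sref_act vector_matrix_diff scaleR_vector_matrix_assoc using assms by simp
  also have "B (v v* iv w) (al r) = B v (al r v* w)"
    using W_B_inv[of "iv w" v "al r"] assms by (simp add: WJ_inv)
  finally show ?thesis .
qed

lemma root_norm: "w \<in> W \<Longrightarrow> B (al r v* w) (al r v* w) = 1"
  by (simp add: W_B)

lemma conj_sref_eq: assumes "w \<in> W" "al r v* w = k *\<^sub>R al r'" shows "iv w ** \<sigma> r ** w = \<sigma> r'"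
proof (rule matrix_eqI_rows)
  fix v
  have "k * k = 1" using root_norm[OF assms(1), of r] unfolding assms(2) by (simp add: Bform_linear)
  then show "v v* (iv w ** \<sigma> r ** w) = v v* \<sigma> r'"
    unfolding conj_act[OF assms(1)] assms(2) sref_act
    by (simp add: Bform_linear)
qed

text \<open>The conjugate reflection negates its own root \<open>al r v* w\<close>, whereas
  \<open>\<sigma> r'\<close> changes vectors only along \<open>al r'\<close>.\<close>

lemma conj_sref_root: assumes "w \<in> W" "iv w ** \<sigma> r ** w = \<sigma> r'" shows "\<exists>k. k \<noteq> 0 \<and> al r v* w = k *\<^sub>R al r'"
proof -
  have "(al r v* w) v* \<sigma> r' = al r v* w - (2 * B (al r v* w) (al r v* w)) *\<^sub>R (al r v* w)"
    using conj_act[OF assms(1), of "al r v* w" r] assms(2) by simp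
  then have "(2 * B (al r v* w) (al r')) *\<^sub>R al r' = 2 *\<^sub>R (al r v* w)"
    unfolding sref_act root_norm[OF assms(1)] by simp
  then have *: "al r v* w = B (al r v* w) (al r') *\<^sub>R al r'"
    by (metis (no_types) scaleR_cancel_left scaleR_scaleR zero_neq_numeral)
  then have "B (al r v* w) (al r') \<noteq> 0" using root_norm[OF assms(1), of r]
    by (metis Bform_zero_left scaleR_zero_left zero_neq_one)
  then show ?thesis using * by blast
qed

lemma WJ_entry: "u \<in> WJ m J \<Longrightarrow> j \<notin> J \<Longrightarrow> u $ k $ j = (if k = j then 1 else 0)"
proof (induction arbitrary: k rule: WJ_induct)
  case one then show ?case by (simp add: mat_def)
next
  case (step w r)
  have "(w ** \<sigma> r) $ k $ j = (al k v* w v* \<sigma> r) $ j" by (simp add: vector_matrix_mul_assoc)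
  also have "\<dots> = (al k v* w) $ j" unfolding sref_act[of "al k v* w"] using step by (auto simp: axis_def)
  finally show ?case using step by simp
qed

text \<open>An element of least length in the coset \<open>WJ m J ** w\<close> has no descent in
  \<open>J\<close>.\<close>

lemma decomp_ex: assumes "w \<in> W" shows "\<exists>u\<in>WJ m J. \<exists>d\<in>XJ m J. w = u ** d"
proof -
  obtain u where u: "u \<in> WJ m J" "\<forall>u'\<in>WJ m J. len m (u ** w) \<le> len m (u' ** w)"
    using ex_has_least_nat[of "\<lambda>u. u \<in> WJ m J" "mat 1" "\<lambda>u. len m (u ** w)"] by auto
  have uW: "u ** w \<in> W" using u WJ_sub assms WJ_mult by blast
  have "len m (\<sigma> r ** (u ** w)) > len m (u ** w)" if "r \<in> J" for r
  proof -
    have "\<sigma> r ** u \<in> WJ m J" using that u by (simp add: WJ_mult sref_WJ)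
    then have "len m (u ** w) \<le> len m (\<sigma> r ** (u ** w))" using u by (simp add: matrix_mul_assoc)
    then show ?thesis using len_sref_neq[OF uW, of r] by simp
  qed
  then have "u ** w \<in> XJ m J" using uW unfolding XJ_def by auto
  moreover have "w = iv u ** (u ** w)" using WJ_sub[OF u(1)] by simp
  ultimately show ?thesis using WJ_inv[OF u(1)] by blast
qed

text \<open>Rows in \<open>J\<close> are nonnegative by membership in \<open>XJ\<close>. A row
  outside \<open>J\<close> has diagonal entry 1, so it is nonnegative as well.\<close>

lemma WJ_XJ_one: assumes "u \<in> WJ m J" "u \<in> XJ m J" shows "u = mat 1"
proof -
  have uW: "u \<in> W" using assms WJ_sub by blast
  have "\<forall>j. u $ r $ j \<ge> 0" for r
  proof (cases "r \<in> J")
    case True then show ?thesis using assms(2) unfolding XJ_iff by blast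
  next
    case False
    then have "u $ r $ r = 1" using WJ_entry[OF assms(1)] by simp
    then have "\<not> (\<forall>j. u $ r $ j \<le> 0)" by (metis not_one_le_zero)
    then show ?thesis using row_sign[OF uW] by blast
  qed
  then show ?thesis using row_pos_one[OF uW] by blast
qed

text \<open>A root supported on \<open>J\<close> keeps its sign under \<open>d\<close>, because
  \<open>d\<close> sends each simple root in \<open>J\<close> to a positive root. The lemma is
  applied to elements of \<open>WJ m J\<close>, and later to elements normalizing it.\<close>

lemma sign_mult: assumes "x \<in> W" "d \<in> XJ m J" "\<forall>j. j \<notin> J \<longrightarrow> x $ r $ j = 0"
  shows "(\<forall>j. (x ** d) $ r $ j \<ge> 0) \<longleftrightarrow> (\<forall>j. x $ r $ j \<ge> 0)"
proof -
  have dW: "d \<in> W" and dp: "k \<in> J \<Longrightarrow> d $ k $ j \<ge> 0" for k j using assms(2) unfolding XJ_iff by auto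
  have xd: "x ** d \<in> W" using assms(1) dW by (simp add: WJ_mult)
  have 1: "(x ** d) $ r $ j \<ge> 0" if "\<forall>j. x $ r $ j \<ge> 0" for j
    unfolding mult_nth
  proof (rule sum_nonneg)
    fix k show "0 \<le> x $ r $ k * d $ k $ j" by (cases "k \<in> J") (use that dp assms(3) in auto)
  qed
  have 2: "(x ** d) $ r $ j \<le> 0" if "\<forall>j. x $ r $ j \<le> 0" for j
    unfolding mult_nth
  proof (rule sum_nonpos)
    fix k show "x $ r $ k * d $ k $ j \<le> 0" by (cases "k \<in> J") (use that dp assms(3) in \<open>auto simp: mult_nonpos_nonneg\<close>)
  qed
  show ?thesis using 1 2 row_sign[OF assms(1), of r] row_sign_excl[OF xd, of r] by blast
qed

text \<open>The quotient \<open>x\<close> of the two factors in \<open>WJ m J\<close> carries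
  \<open>d\<close> to \<open>d'\<close>; by \<open>sign_mult\<close> its rows in \<open>J\<close>
  are nonnegative, and \<open>WJ_XJ_one\<close> makes it trivial.\<close>

lemma decomp_unique: assumes "u \<in> WJ m J" "u' \<in> WJ m J" "d \<in> XJ m J" "d' \<in> XJ m J" "u ** d = u' ** d'"
  shows "u = u' \<and> d = d'"
proof -
  have W: "u \<in> W" "u' \<in> W" "d \<in> W" "d' \<in> W" using assms WJ_sub unfolding XJ_iff by auto
  define x where "x = iv u' ** u"
  have x: "x \<in> WJ m J" unfolding x_def using assms by (simp add: WJ_mult WJ_inv)
  have "x ** d = iv u' ** (u ** d)" unfolding x_def by (simp add: matrix_mul_assoc)
  then have d': "x ** d = d'" using W by (simp add: assms(5))
  have "\<forall>j. x $ r $ j \<ge> 0" if "r \<in> J" for r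
  proof -
    have "\<forall>j. j \<notin> J \<longrightarrow> x $ r $ j = 0" using WJ_entry[OF x] that by auto
    then show ?thesis using sign_mult[OF WJ_sub[OF x] assms(3)] d' assms(4) that unfolding XJ_iff by blast
  qed
  then have "x = mat 1" using WJ_XJ_one[OF x] WJ_sub[OF x] unfolding XJ_iff by blast
  then have "d = d'" "u = u'" using d' W(2) W_cancel(1)[of u' u] unfolding x_def by auto
  then show ?thesis by simp
qed

lemma card_decomp: "card W = card (WJ m J) * card (XJ m J)"
proof -
  have "bij_betw (\<lambda>(u,d). u ** d) (WJ m J \<times> XJ m J) W"
    unfolding bij_betw_def
  proof
    show "inj_on (\<lambda>(u,d). u ** d) (WJ m J \<times> XJ m J)"
    proof (rule inj_onI)
      fix x y assume "x \<in> WJ m J \<times> XJ m J" "y \<in> WJ m J \<times> XJ m J"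
        "(case x of (u, d) \<Rightarrow> u ** d) = (case y of (u, d) \<Rightarrow> u ** d)"
      then show "x = y" using decomp_unique[of "fst x" J "fst y" "snd x" "snd y"]
        by (auto simp: prod_eq_iff split_beta)
    qed
    show "(\<lambda>(u,d). u ** d) ` (WJ m J \<times> XJ m J) = W"
    proof
      show "(\<lambda>(u,d). u ** d) ` (WJ m J \<times> XJ m J) \<subseteq> W"
        using WJ_sub by (auto simp: XJ_iff intro: WJ_mult)
      show "W \<subseteq> (\<lambda>(u,d). u ** d) ` (WJ m J \<times> XJ m J)" using decomp_ex[of _ J] by fastforce
    qed
  qed
  then show ?thesis using bij_betw_same_card card_cartesian_product by metis
qed

end

section \<open>Finite groups: the radical of the form and the longest element\<close>

locale finite_coxeter = coxeter m for m :: "'s::finite \<Rightarrow> 's \<Rightarrow> nat" +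
  assumes finW: "finite W"
begin

lemma fin_sub: "A \<subseteq> W \<Longrightarrow> finite A" using finW finite_subset by blast

text \<open>A vector in the radical is fixed by \<open>W\<close>, and averaging its inner products with a simple root over
  \<open>W\<close> gives a quantity that changes sign under that root's reflection.\<close>

lemma B_nondegenerate: assumes "\<And>r. B v (al r) = 0" shows "v = 0"
proof -
  have inv: "w \<in> W \<Longrightarrow> v v* w = v" for w
  proof (induction rule: WJ_induct)
    case (step w r) then show ?case by (simp add: vector_matrix_mul_assoc[symmetric] sref_act assms)
  qed simp
  define F where "F u = (\<Sum>w\<in>W. v \<bullet> (u v* w))" for u
  have F0: "F (al r) = 0" for r
  proof -
    have "bij_betw (\<lambda>w. \<sigma> r ** w) W W"
      by (rule bij_betw_byWitness[where f' = "\<lambda>w. \<sigma> r ** w"]) (auto intro: WJ_mult)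
    then have "F (al r) = (\<Sum>w\<in>W. v \<bullet> (al r v* (\<sigma> r ** w)))"
      unfolding F_def by (rule sum.reindex_bij_betw[symmetric])
    also have "\<dots> = - F (al r)"
      unfolding F_def by (simp add: vector_matrix_mul_assoc[symmetric] vector_matrix_minus sum_negf)
    finally show ?thesis by simp
  qed
  have "linear F" unfolding F_def
    by (rule linearI) (simp_all add: vector_matrix_left_distrib scaleR_vector_matrix_assoc inner_add_right sum.distrib sum_distrib_left)
  then have "F v = (\<Sum>r\<in>UNIV. (v $ r) *\<^sub>R F (al r))"
    by (subst al_expand) (simp add: linear_sum linear_scale)
  then have "F v = 0" by (simp add: F0)
  moreover have "F v = real (card W) * (v \<bullet> v)" unfolding F_def by (simp add: inv)
  moreover have "card W > 0" using finW one_WJ card_gt_0_iff by blast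
  ultimately show ?thesis by simp
qed

text \<open>An element of maximal length has every simple reflection as a descent, so all its rows
  are nonpositive. Its square then has nonnegative rows and is the identity. A matrix with
  nonpositive entries that is its own inverse is monomial, so it maps simple roots to multiples of
  simple roots.\<close>

lemma longest: "\<exists>w0\<in>W. (\<forall>r j. w0 $ r $ j \<le> 0) \<and> (\<forall>r. \<exists>r'. iv w0 ** \<sigma> r ** w0 = \<sigma> r')"
proof -
  obtain w0 where w0: "w0 \<in> W" "\<forall>w\<in>W. len m w \<le> len m w0"
  proof -
    have "Max (len m ` W) \<in> len m ` W" using finW one_WJ[of UNIV] by (intro Max_in) blast+
    then obtain w where "w \<in> W" "len m w = Max (len m ` W)" by auto
    then show ?thesis using finW by (intro that[of w]) auto
  qed
  have neg: "w0 $ r $ j \<le> 0" for r j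
  proof -
    have "len m (\<sigma> r ** w0) \<le> len m w0" using w0 by (simp add: WJ_mult)
    then show ?thesis using row_neg[OF w0(1)] len_sref_neq[OF w0(1), of r] by fastforce
  qed
  have sq: "w0 ** w0 = mat 1"
  proof (rule row_pos_one)
    show "w0 ** w0 \<in> W" using w0 by (simp add: WJ_mult)
    show "\<forall>r j. 0 \<le> (w0 ** w0) $ r $ j" unfolding mult_nth
      using neg by (auto intro!: sum_nonneg mult_nonpos_nonpos)
  qed
  have "\<exists>r'. iv w0 ** \<sigma> r ** w0 = \<sigma> r'" for r
  proof -
    obtain q where q: "w0 $ r $ q \<noteq> 0" using W_row_nz[OF w0(1)] by blast
    have z: "w0 $ q $ j = 0" if "j \<noteq> r" for j
    proof -
      have "(\<Sum>k\<in>UNIV. w0 $ r $ k * w0 $ k $ j) = 0"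
        using sq that mult_nth[of w0 w0 r j] by (simp add: mat_def)
      then have "w0 $ r $ q * w0 $ q $ j = 0"
        using neg by (subst (asm) sum_nonneg_eq_0_iff) (auto intro: mult_nonpos_nonpos)
      then show ?thesis using q by simp
    qed
    define c where "c = w0 $ q $ r"
    have row: "al q v* w0 = c *\<^sub>R al r" unfolding vec_eq_iff c_def using z by (auto simp: al_nth)
    have "c \<noteq> 0" using W_row_nz[OF w0(1), of q] z unfolding c_def by metis
    have "al q = c *\<^sub>R (al r v* w0)"
      using arg_cong[OF row, of "\<lambda>v. v v* w0"] sq
      by (simp add: vector_matrix_mul_assoc scaleR_vector_matrix_assoc)
    then have "al r v* w0 = (1 / c) *\<^sub>R al q" using \<open>c \<noteq> 0\<close> by simp
    then show ?thesis using conj_sref_eq[OF w0(1)] by blast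
  qed
  then show ?thesis using w0 neg by blast
qed

text \<open>Left multiplication by \<open>\<sigma> r\<close> negates row \<open>r\<close> and
  exchanges \<open>XJ m {r}\<close> with its complement.\<close>

lemma card_X_single: "2 * card (XJ m {r}) = card W"
proof -
  have "bij_betw (\<lambda>w. \<sigma> r ** w) (XJ m {r}) (W - XJ m {r})"
  proof (rule bij_betw_byWitness[where f' = "\<lambda>w. \<sigma> r ** w"])
    show "(\<lambda>w. \<sigma> r ** w) ` XJ m {r} \<subseteq> W - XJ m {r}"
      using row_sign_excl by (auto simp: XJ_iff sref_row WJ_mult)
    show "(\<lambda>w. \<sigma> r ** w) ` (W - XJ m {r}) \<subseteq> XJ m {r}"
      using row_sign by (fastforce simp: XJ_iff sref_row WJ_mult)
  qed auto
  then have "card (XJ m {r}) = card (W - XJ m {r})" by (rule bij_betw_same_card)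
  moreover have "XJ m {r} \<subseteq> W" by (auto simp: XJ_iff)
  ultimately show ?thesis using card_Diff_subset[of "XJ m {r}" W] card_mono[OF finW, of "XJ m {r}"] fin_sub by simp
qed

lemma one_XJsharp [simp]: "mat 1 \<in> XJsharp m J"
  unfolding XJsharp_def conj_def by (auto simp: XJ_iff) (auto simp: mat_def)

lemma XJsharp_sub: "XJsharp m J \<subseteq> W" by (auto simp: XJsharp_def XJ_iff)

lemma mKL_diag: "mKL m K K \<noteq> 0"
proof -
  have "mat 1 \<in> XJ m K \<inter> XJsharp m K" using one_XJsharp[of K] by (auto simp: XJsharp_def)
  moreover have "finite (XJ m K \<inter> XJsharp m K)" using XJsharp_sub fin_sub by blast
  ultimately have "card (XJ m K \<inter> XJsharp m K) \<noteq> 0" by (metis card_0_eq empty_iff)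
  then show ?thesis by (simp add: mKL_def)
qed

end

locale finite_rank2 = finite_coxeter m + rank2 m s t for m :: "'s::finite \<Rightarrow> 's \<Rightarrow> nat" and s t
begin

text \<open>For the longest element \<open>w0\<close> the involution \<open>x \<mapsto> s x w0\<close> of \<open>XJsharp m {s}\<close> exchanges the elements
  inside and outside \<open>XJ m {s,t}\<close>.\<close>

lemma card_Xsharp: "card (XJsharp m {s}) = 2 * card (XJ m {s,t} \<inter> XJsharp m {s})"
proof -
  obtain w0 where w0: "w0 \<in> W" "\<And>r j. w0 $ r $ j \<le> 0" "\<And>r. \<exists>r'. iv w0 ** \<sigma> r ** w0 = \<sigma> r'"
    using longest by blast
  let ?A = "XJsharp m {s}"
  define f where "f x = \<sigma> s ** x ** w0" for x
  have A_iff: "x \<in> ?A \<longleftrightarrow> x \<in> W \<and> (\<forall>j. x $ s $ j \<ge> 0) \<and> (\<exists>r. iv x ** \<sigma> s ** x = \<sigma> r)" for x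
    unfolding XJsharp_def XJ_iff conj_def by auto
  have main: "f x \<in> ?A \<and> (f x \<in> XJ m {s,t} \<longleftrightarrow> x \<notin> XJ m {s,t})" if xA: "x \<in> ?A" for x
  proof -
    have x: "x \<in> W" "\<forall>j. x $ s $ j \<ge> 0" using xA unfolding A_iff by auto
    obtain r where r: "iv x ** \<sigma> s ** x = \<sigma> r" using xA unfolding A_iff by auto
    obtain k where k: "k \<noteq> 0" "al s v* x = k *\<^sub>R al r" using conj_sref_root[OF x(1) r] by blast
    have kp: "k > 0"
    proof -
      have "x $ s $ r = k" using arg_cong[OF k(2), of "\<lambda>v. v $ r"] by simp
      then show ?thesis using x(2) k(1) by (metis order_le_less)
    qed
    have y: "f x \<in> W" "\<sigma> s ** x \<in> W" unfolding f_def using x w0 by (simp_all add: WJ_mult)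
    have flip: "(\<forall>j. z $ p $ j \<ge> 0) \<Longrightarrow> (\<forall>j. (z ** w0) $ p $ j \<le> 0)"
       "(\<forall>j. z $ p $ j \<le> 0) \<Longrightarrow> (\<forall>j. (z ** w0) $ p $ j \<ge> 0)" for z :: "'s mat" and p
      unfolding mult_nth using w0(2)
      by (auto intro!: sum_nonneg sum_nonpos mult_nonpos_nonpos mult_nonneg_nonpos)
    have s1: "\<forall>j. f x $ s $ j \<ge> 0"
      unfolding f_def by (rule flip(2)) (use x(2) in \<open>simp add: sref_row\<close>)
    have "iv (f x) ** \<sigma> s ** f x = iv w0 ** (iv x ** \<sigma> s ** x) ** w0"
      unfolding f_def using x w0 by (simp add: W_inv_mult WJ_mult matrix_mul_assoc)
    then have s2: "\<exists>r'. iv (f x) ** \<sigma> s ** f x = \<sigma> r'" unfolding r using w0(3) by simp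
    \<comment> \<open>Passing from \<open>x\<close> to \<open>\<sigma> s ** x\<close> changes row
      \<open>t\<close> only in coordinate \<open>r\<close>, and does not decrease it there, because
      \<open>k > 0\<close> and \<open>cos \<theta> \<ge> 0\<close>.\<close>
    have tt: "al t v* (\<sigma> s ** x) = al t v* x + (2 * cos \<theta> * k) *\<^sub>R al r"
      by (simp add: vector_matrix_mul_assoc[symmetric] sref_act Bst vector_matrix_left_distrib
          scaleR_vector_matrix_assoc k(2))
    have tj: "(\<sigma> s ** x) $ t $ j = x $ t $ j + 2 * cos \<theta> * k * (if j = r then 1 else 0)" for j
      using arg_cong[OF tt, of "\<lambda>v. v $ j"] by (simp add: al_nth)
    have in_iff: "z \<in> XJ m {s,t} \<longleftrightarrow> (\<forall>j. z $ t $ j \<ge> 0)" if "z \<in> W" "\<forall>j. z $ s $ j \<ge> 0" for z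
      using that by (auto simp: XJ_iff)
    have "f x \<in> XJ m {s,t} \<longleftrightarrow> x \<notin> XJ m {s,t}"
    proof (cases "\<forall>j. x $ t $ j \<ge> 0")
      case True
      then have "\<forall>j. (\<sigma> s ** x) $ t $ j \<ge> 0" unfolding tj using cos_nonneg kp by auto
      then have "\<forall>j. f x $ t $ j \<le> 0" unfolding f_def by (rule flip)
      then show ?thesis using row_sign_excl[OF y(1)] in_iff[OF y(1) s1] in_iff[OF x] True by blast
    next
      case False
      then have neg: "\<forall>j. x $ t $ j \<le> 0" using row_sign[OF x(1)] by blast
      \<comment> \<open>A negative entry away from \<open>r\<close> is untouched by that change and
        decides the sign of the new row. It exists because \<open>x\<close> cannot map both
        \<open>al s\<close> and \<open>al t\<close> to multiples of \<open>al r\<close>.\<close>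
      have "\<exists>j. j \<noteq> r \<and> x $ t $ j < 0"
      proof (rule ccontr)
        assume "\<not> ?thesis"
        then have "\<forall>j. j \<noteq> r \<longrightarrow> x $ t $ j = 0" using neg by (meson order_le_less)
        then have "al t v* x = (x $ t $ r) *\<^sub>R al r" by (auto simp: vec_eq_iff al_nth)
        also have "\<dots> = (x $ t $ r / k) *\<^sub>R (al s v* x)" using k by simp
        finally have "al t v* x = ((x $ t $ r / k) *\<^sub>R al s) v* x" by (simp add: scaleR_vector_matrix_assoc)
        then have "al t = (x $ t $ r / k) *\<^sub>R al s" by (rule W_inj[OF x(1)])
        then have "(al t :: real^'s) $ t = ((x $ t $ r / k) *\<^sub>R al s) $ t" by simp
        then show False using st by (simp add: axis_def)
      qed
      then obtain j where "j \<noteq> r" "x $ t $ j < 0" by blast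
      then have "(\<sigma> s ** x) $ t $ j < 0" unfolding tj by simp
      then have "\<forall>j. (\<sigma> s ** x) $ t $ j \<le> 0" using row_sign[OF y(2), of t] by (meson not_less)
      then have "\<forall>j. f x $ t $ j \<ge> 0" unfolding f_def by (rule flip)
      then show ?thesis using in_iff[OF y(1) s1] in_iff[OF x] False by blast
    qed
    then show ?thesis using y s1 s2 unfolding A_iff by blast
  qed
  have inj: "inj_on f ?A"
  proof (rule inj_onI)
    fix x y assume "f x = f y"
    then have "\<sigma> s ** (f x ** iv w0) = \<sigma> s ** (f y ** iv w0)" by simp
    then show "x = y" unfolding f_def using w0 by (simp add: matrix_mul_assoc)
  qed
  have fA: "finite ?A" using XJsharp_sub fin_sub by blast
  let ?X = "XJ m {s,t} \<inter> ?A" and ?Y = "?A - XJ m {s,t}"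
  have "card ?X \<le> card ?Y"
    by (rule card_inj_on_le[of f]) (use inj main fA in \<open>auto simp: inj_on_def\<close>)
  moreover have "card ?Y \<le> card ?X"
    by (rule card_inj_on_le[of f]) (use inj main fA in \<open>auto simp: inj_on_def\<close>)
  moreover have "card ?A = card ?X + card ?Y"
    using card_Int_Diff[OF fA, of "XJ m {s,t}"] by (simp add: Int_commute)
  ultimately show ?thesis by simp
qed

end

section \<open>The normalizer of a rank two parabolic subgroup\<close>

context finite_rank2
begin

abbreviation "X \<equiv> Fix m {s, t}"
abbreviation "N \<equiv> normalizer m WL"

lemma X_iff: "v \<in> X \<longleftrightarrow> \<tau> v = 0"
proof
  assume v: "v \<in> X"
  have "\<sigma> s \<in> WL" "\<sigma> t \<in> WL" by (simp_all add: sref_WJ)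
  then have "v v* \<sigma> s = v" "v v* \<sigma> t = v" using v unfolding Fix_def by blast+
  then have "B v (al s) = 0" "B v (al t) = 0" unfolding sref_act by (simp_all add: axis_eq_0_iff)
  then show "\<tau> v = 0" unfolding \<tau>_def by (simp add: complex_eq_iff)
next
  assume "\<tau> v = 0"
  then have 0: "B v (al s) = 0" "B v (al t) = 0" using Re_\<tau>[of v] B_t[of v] by simp_all
  have "v v* w = v" if "w \<in> WL" for w using that
  proof (induction rule: WJ_induct)
    case (step w r)
    then show ?case using 0 by (auto simp: vector_matrix_mul_assoc[symmetric] sref_act)
  qed simp
  then show "v \<in> X" unfolding Fix_def by blast
qed

lemma X_diff_prj: "v - prj v \<in> X" unfolding X_iff \<tau>_diff by simp

text \<open>For \<open>u\<close> in \<open>P\<close>, the value \<open>B u v\<close> involves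
  \<open>v\<close> only through its products with the two simple roots, which are exactly the data
  recorded by \<open>\<tau> v\<close>.\<close>

lemma B_P: assumes "u \<in> P" shows "B u v = Re (\<tau> u * cnj (\<tau> v))"
proof -
  obtain a b where u: "u = a *\<^sub>R al s + b *\<^sub>R al t" using assms unfolding P_def by auto
  have "B u v = a * B v (al s) + b * B v (al t)" unfolding u by (simp add: Bform_linear B_sym)
  also have "\<dots> = Re (\<tau> u * cnj (\<tau> v))"
    unfolding u \<tau>_linear B_t Re_\<tau>[symmetric] by (simp add: \<epsilon>_def algebra_simps)
  finally show ?thesis .
qed

text \<open>If \<open>v\<close> is orthogonal to \<open>X\<close>, then \<open>v - prj v\<close> is
  orthogonal to \<open>P\<close> and to \<open>X\<close>. Every simple root is a sum of a vector of
  \<open>P\<close> and one of \<open>X\<close>, so nondegeneracy applies.\<close>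

lemma perp_iff: "(\<forall>x\<in>X. B v x = 0) \<longleftrightarrow> v \<in> P"
proof
  assume v: "\<forall>x\<in>X. B v x = 0"
  have "v - prj v = 0"
  proof (rule B_nondegenerate)
    fix r
    have 1: "B (v - prj v) (prj (al r)) = 0"
      using B_P[of "prj (al r)" "v - prj v"] by (simp add: B_sym \<tau>_diff)
    have 2: "B (v - prj v) (al r - prj (al r)) = 0"
      using v X_diff_prj[of "al r"] B_P[of "prj v" "al r - prj (al r)"]
      by (simp add: Bform_diff_left \<tau>_diff)
    show "B (v - prj v) (al r) = 0" using 1 2 by (simp add: Bform_diff_right)
  qed
  then show "v \<in> P" by (metis eq_iff_diff_eq_0 prj_P)
next
  assume "v \<in> P" then show "\<forall>x\<in>X. B v x = 0" using B_P X_iff by simp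
qed

text \<open>A generic point of the face of the fundamental chamber that is fixed by
  \<open>WL\<close>. Nondegeneracy of \<open>B\<close> allows its products with the simple roots to
  be prescribed.\<close>

lemma ex_dual: "\<exists>x\<in>X. \<forall>r. r \<notin> {s,t} \<longrightarrow> B x (al r) = 1"
proof -
  define G where "G v = (\<chi> r. B v (al r))" for v
  have lin: "linear G" unfolding G_def
    by (rule linearI) (simp_all add: vec_eq_iff Bform_linear)
  have "inj G" unfolding linear_injective_0[OF lin]
  proof (intro allI impI)
    fix v assume "G v = 0"
    then have "B v (al r) = 0" for r unfolding G_def vec_eq_iff by simp
    then show "v = 0" by (rule B_nondegenerate)
  qed
  then have "surj G" using linear_injective_imp_surjective[OF lin] by simp
  then obtain x where "G x = (\<chi> r. if r \<in> {s,t} then 0 else 1)" by (metis surjD)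
  then have x: "B x (al r) = (if r \<in> {s,t} then 0 else 1)" for r unfolding G_def by (simp add: vec_eq_iff)
  then have "\<tau> x = 0" unfolding \<tau>_def by (simp add: complex_eq_iff)
  then show ?thesis using x by (intro bexI[of _ x]) (simp_all add: X_iff)
qed

text \<open>The minimal coset representative \<open>d\<close> of \<open>w\<close> fixes
  \<open>X\<close> as well. A descent \<open>r\<close> of \<open>d\<close> would lie outside
  \<open>{s,t}\<close> and make \<open>al r v* d\<close> a negative root, whose product with the
  generic point of \<open>ex_dual\<close> is at most 0. By invariance of \<open>B\<close> that
  product is 1.\<close>

lemma Fix_stabilizer: assumes "w \<in> W" "\<forall>x\<in>X. x v* w = x" shows "w \<in> WL"
proof -
  obtain u d where u: "u \<in> WL" "d \<in> XJ m {s,t}" "w = u ** d" using decomp_ex[OF assms(1)] by blast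
  have uW: "u \<in> W" and dW: "d \<in> W" using u WJ_sub unfolding XJ_iff by auto
  have dX: "x v* d = x" if "x \<in> X" for x
  proof -
    have "x v* u = x" using that u(1) unfolding Fix_def by blast
    then show ?thesis using assms(2) that unfolding u(3) by (metis vector_matrix_mul_assoc)
  qed
  have "len m d = 0"
  proof (rule ccontr)
    assume "len m d \<noteq> 0"
    then obtain r where r: "len m (\<sigma> r ** d) < len m d" using len_descent[OF dW] by auto
    have rL: "r \<notin> {s,t}" using r u(2) unfolding XJ_def by auto
    have neg: "d $ r $ j \<le> 0" for j using row_neg[OF dW r] .
    obtain x where x: "x \<in> X" "\<forall>r. r \<notin> {s,t} \<longrightarrow> B x (al r) = 1" using ex_dual by blast
    have "B x (al s) = 0" "B x (al t) = 0" using x(1) Re_\<tau>[of x] B_t[of x] unfolding X_iff by simp_all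
    then have xn: "B x (al j) \<ge> 0" for j using x(2) by (cases "j \<in> {s,t}") auto
    have "linear (B x)" by (rule linearI) (simp_all add: Bform_linear)
    then have "B x (al r v* d) = (\<Sum>j\<in>UNIV. d $ r $ j * B x (al j))"
      by (subst al_expand) (simp add: linear_sum linear_scale)
    also have "\<dots> \<le> 0" using neg xn by (intro sum_nonpos) (simp add: mult_nonpos_nonneg)
    finally have "B x (al r v* d) \<le> 0" .
    moreover have "B x (al r v* d) = B x (al r)" using W_B[OF dW, of x "al r"] dX[OF x(1)] by simp
    ultimately show False using x(2) rL by simp
  qed
  then show ?thesis using len_zero[OF dW] u by simp
qed

lemma N_W: "g \<in> N \<Longrightarrow> g \<in> W" unfolding normalizer_def by simp

lemma N_conj: assumes "g \<in> N" "u \<in> WL" shows "g ** u ** iv g \<in> WL" "iv g ** u ** g \<in> WL"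
proof -
  have e: "(\<lambda>x. g ** x) ` WL = (\<lambda>x. x ** g) ` WL" using assms(1) unfolding normalizer_def by simp
  have "g ** u \<in> (\<lambda>x. x ** g) ` WL" using assms(2) e by blast
  then obtain u' where "u' \<in> WL" "g ** u = u' ** g" by blast
  then show "g ** u ** iv g \<in> WL" using N_W[OF assms(1)] by simp
  have "u ** g \<in> (\<lambda>x. g ** x) ` WL" using assms(2) e by blast
  then obtain u'' where u'': "u'' \<in> WL" "u ** g = g ** u''" by blast
  have "iv g ** u ** g = iv g ** (u ** g)" by (simp add: matrix_mul_assoc)
  then show "iv g ** u ** g \<in> WL" using N_W[OF assms(1)] u'' by simp
qed

lemma N_I: assumes "g \<in> W" "\<And>u. u \<in> WL \<Longrightarrow> g ** u ** iv g \<in> WL" "\<And>u. u \<in> WL \<Longrightarrow> iv g ** u ** g \<in> WL"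
  shows "g \<in> N"
proof -
  have "g ** u \<in> (\<lambda>x. x ** g) ` WL" if "u \<in> WL" for u
    using assms(2)[OF that] assms(1) by (intro image_eqI[of _ _ "g ** u ** iv g"]) simp_all
  moreover have "u ** g \<in> (\<lambda>x. g ** x) ` WL" if "u \<in> WL" for u
  proof (intro image_eqI[of _ _ "iv g ** u ** g"])
    show "u ** g = g ** (iv g ** u ** g)" using assms(1) by (simp add: matrix_mul_assoc)
  qed (rule assms(3)[OF that])
  ultimately show ?thesis unfolding normalizer_def using assms(1) by blast
qed

lemma N_mult: assumes "g \<in> N" "h \<in> N" shows "g ** h \<in> N"
proof (rule N_I)
  have W: "g \<in> W" "h \<in> W" using assms N_W by auto
  then show "g ** h \<in> W" by (rule WJ_mult)
  fix u assume u: "u \<in> WL"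
  have "g ** h ** u ** iv (g ** h) = g ** (h ** u ** iv h) ** iv g"
    using W by (simp add: W_inv_mult matrix_mul_assoc)
  then show "g ** h ** u ** iv (g ** h) \<in> WL" using N_conj assms u by metis
  have "iv (g ** h) ** u ** (g ** h) = iv h ** (iv g ** u ** g) ** h"
    using W by (simp add: W_inv_mult matrix_mul_assoc)
  then show "iv (g ** h) ** u ** (g ** h) \<in> WL" using N_conj assms u by metis
qed

lemma N_inv: assumes "g \<in> N" shows "iv g \<in> N"
  using N_W[OF assms] N_conj[OF assms] by (intro N_I) (simp_all add: WJ_inv)

lemma WL_N: assumes "w \<in> WL" shows "w \<in> N"
  using assms WJ_sub by (intro N_I) (simp_all add: WJ_mult WJ_inv)

lemma N_one [simp]: "mat 1 \<in> N" by (simp add: WL_N)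

lemma N_X: assumes "g \<in> N" "v \<in> X" shows "v v* g \<in> X"
proof -
  have "v v* g v* u = v v* g" if "u \<in> WL" for u
  proof -
    have "v v* (g ** u ** iv g) = v" using N_conj(1)[OF assms(1) that] assms(2) unfolding Fix_def by blast
    then have "v v* (g ** u ** iv g) v* g = v v* g" by simp
    then show ?thesis using N_W[OF assms(1)] by (simp add: vector_matrix_mul_assoc)
  qed
  then show ?thesis unfolding Fix_def by blast
qed

lemma N_P: assumes "g \<in> N" "v \<in> P" shows "v v* g \<in> P"
proof -
  have "B (v v* g) x = 0" if "x \<in> X" for x
    using W_B_inv[OF N_W[OF assms(1)], of v x] assms(2) N_X[OF N_inv[OF assms(1)] that] perp_iff by metis
  then show ?thesis using perp_iff by blast
qed

text \<open>An element \<open>g\<close> of the normalizer acts on the coordinate \<open>\<tau>\<close> by \<open>z \<mapsto> lam g * z\<close> if it preserves the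
  orientation of the plane (\<open>ori g\<close>), and by \<open>z \<mapsto> lam g * cnj z\<close> otherwise.\<close>

definition lam :: "'s mat \<Rightarrow> complex" where "lam g = \<tau> (al s v* g)"
definition ori :: "'s mat \<Rightarrow> bool" where "ori g \<longleftrightarrow> \<tau> (al t v* g) = lam g * \<epsilon>"
definition act :: "'s mat \<Rightarrow> complex \<Rightarrow> complex" where
  "act g z = (if ori g then lam g * z else lam g * cnj z)"

lemma \<epsilon>_neq: "cnj \<epsilon> \<noteq> \<epsilon>" unfolding \<epsilon>_def complex_eq_iff using sin_pos by auto

lemma lam_norm: assumes "g \<in> N" shows "lam g * cnj (lam g) = 1" "cnj (lam g) * lam g = 1"
proof -
  have "Re (lam g * cnj (lam g)) = B (al s v* g) (al s v* g)"
    unfolding lam_def using B_P N_P[OF assms P_s] by simp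
  also have "\<dots> = 1" by (rule root_norm) (rule N_W[OF assms])
  finally show "lam g * cnj (lam g) = 1" by (simp add: complex_eq_iff)
  then show "cnj (lam g) * lam g = 1" by (simp add: mult.commute)
qed

lemma lam_nz: "g \<in> N \<Longrightarrow> lam g \<noteq> 0" using lam_norm by force

text \<open>\<open>g\<close> preserves the Gram matrix of \<open>al s\<close> and
  \<open>al t\<close>. The quotient \<open>z\<close> of the image coordinates therefore has modulus
  1 and real part \<open>- cos \<theta>\<close>, which leaves only \<open>\<epsilon>\<close> and its
  conjugate.\<close>

lemma act_\<tau>: assumes "g \<in> N" shows "\<tau> (v v* g) = act g (\<tau> v)"
proof -
  define a where "a = lam g"
  define b where "b = \<tau> (al t v* g)"
  have gW: "g \<in> W" using assms N_W by blast
  have aa: "a * cnj a = 1" using lam_norm[OF assms] a_def by simp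
  have "Re (b * cnj b) = B (al t v* g) (al t v* g)"
    unfolding b_def using B_P N_P[OF assms P_t] by simp
  also have "\<dots> = 1" by (rule root_norm) (rule gW)
  finally have bb: "b * cnj b = 1" by (simp add: complex_eq_iff)
  have "Re (b * cnj a) = B (al t v* g) (al s v* g)"
    unfolding b_def a_def lam_def using B_P N_P[OF assms P_t] by simp
  also have "\<dots> = - cos \<theta>" using gW by (simp add: W_B Bst)
  finally have re: "Re (b * cnj a) = - cos \<theta>" .
  define z where "z = b * cnj a"
  have "z * cnj z = (b * cnj b) * (a * cnj a)" unfolding z_def by simp
  then have "z * cnj z = 1" using aa bb by simp
  then have "Re z * Re z + Im z * Im z = 1" by (simp add: complex_eq_iff)
  then have "cos \<theta> * cos \<theta> + Im z * Im z = 1" using re unfolding z_def[symmetric] by simp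
  then have "Im z * Im z = sin \<theta> * sin \<theta>" using cos_sin_sq1 by linarith
  then have "Im z = sin \<theta> \<or> Im z = - sin \<theta>" by (simp add: square_eq_iff)
  then have "z = \<epsilon> \<or> z = cnj \<epsilon>" using re unfolding z_def[symmetric] \<epsilon>_def by (auto simp: complex_eq_iff)
  moreover have "b = a * z" unfolding z_def using aa by (metis mult.commute mult.left_commute mult.right_neutral)
  ultimately have b: "b = (if ori g then a * \<epsilon> else a * cnj \<epsilon>)"
    unfolding ori_def b_def a_def by auto
  have "(v - prj v) v* g \<in> X" by (rule N_X[OF assms X_diff_prj])
  then have "\<tau> (v v* g) = \<tau> (prj v v* g)" unfolding X_iff vector_matrix_diff \<tau>_diff by simp
  moreover obtain p q where pq: "prj v = p *\<^sub>R al s + q *\<^sub>R al t" unfolding prj_def by blast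
  moreover have "\<tau> (prj v v* g) = p * a + q * b"
    unfolding pq vector_matrix_left_distrib scaleR_vector_matrix_assoc \<tau>_linear a_def b_def lam_def ..
  moreover have "\<tau> v = p + q * \<epsilon>" using \<tau>_prj[of v] unfolding pq \<tau>_linear by simp
  ultimately show ?thesis unfolding act_def b a_def[symmetric] by (simp add: algebra_simps)
qed

lemma ori_I: assumes "\<And>v. \<tau> (v v* g) = l * \<tau> v" shows "ori g" "lam g = l"
  unfolding ori_def lam_def assms by simp_all

lemma nori_I: assumes "\<And>v. \<tau> (v v* g) = l * cnj (\<tau> v)" "l \<noteq> 0" shows "\<not> ori g" "lam g = l"
  unfolding ori_def lam_def assms using \<epsilon>_neq assms(2) by simp_all

lemma act_mult: assumes "g \<in> N" "h \<in> N"
  shows "lam (g ** h) = act h (lam g)" "ori (g ** h) \<longleftrightarrow> (ori g \<longleftrightarrow> ori h)"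
proof -
  have *: "\<tau> (v v* (g ** h)) = act h (act g (\<tau> v))" for v
    using act_\<tau> assms by (simp add: vector_matrix_mul_assoc[symmetric])
  show "lam (g ** h) = act h (lam g)" using *[of "al s"] unfolding lam_def[of "g ** h"]
    by (simp add: act_def)
  have nz: "lam g \<noteq> 0" "lam h \<noteq> 0" using assms lam_nz by auto
  show "ori (g ** h) \<longleftrightarrow> (ori g \<longleftrightarrow> ori h)"
  proof (cases "ori g \<longleftrightarrow> ori h")
    case True
    then have "\<tau> (v v* (g ** h)) = act h (lam g) * \<tau> v" for v unfolding * by (auto simp: act_def)
    then show ?thesis using ori_I True by blast
  next
    case False
    then have "\<tau> (v v* (g ** h)) = act h (lam g) * cnj (\<tau> v)" for v unfolding * by (auto simp: act_def)
    moreover have "act h (lam g) \<noteq> 0" using nz by (simp add: act_def)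
    ultimately show ?thesis using nori_I False by blast
  qed
qed

text \<open>The factor by which the rotation \<open>\<sigma> t ** \<sigma> s\<close> multiplies the
  coordinate, a primitive \<open>n\<close>-th root of unity.\<close>

definition \<zeta> :: complex where "\<zeta> = cis (2 * \<theta>)"

lemma \<zeta>_n: "\<zeta> ^ n = 1"
proof -
  have "\<zeta> ^ n = cis (2 * pi)" unfolding \<zeta>_def Complex.DeMoivre using n\<theta> by (simp add: algebra_simps)
  then show ?thesis by simp
qed

lemma \<zeta>_norm: "\<zeta> * cnj \<zeta> = 1" unfolding \<zeta>_def by (simp add: cis_cnj cis_mult)

lemma root_norm1: "z ^ n = 1 \<Longrightarrow> z * cnj z = 1" for z :: complex
proof -
  assume "z ^ n = 1"
  then have "cmod z ^ n = 1" by (metis norm_one norm_power)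
  then have "cmod z = 1" using power_eq_imp_eq_base[of "cmod z" n 1] by simp
  then show ?thesis by (simp flip: complex_norm_square)
qed

lemma cnj_root: "z ^ n = 1 \<Longrightarrow> cnj z ^ n = 1" for z :: complex
  by (metis complex_cnj_one complex_cnj_power)

lemma \<sigma>_act: "\<not> ori (\<sigma> s)" "lam (\<sigma> s) = -1" "\<not> ori (\<sigma> t)" "lam (\<sigma> t) = - cnj \<zeta>"
  using nori_I[of "\<sigma> s" "-1"] nori_I[of "\<sigma> t" "- cnj \<zeta>"] \<tau>_sref_s \<tau>_sref_t
  by (simp_all add: \<zeta>_def cis_cnj)

lemma one_act: "ori (mat 1)" "lam (mat 1) = 1"
  using ori_I[of "mat 1" 1] by simp_all

text \<open>The sign normalizes reflections: \<open>\<sigma> s\<close> has \<open>lam\<close> equal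
  to -1, and after the change of sign all elements of \<open>WL\<close>, rotations and reflections,
  have an \<open>n\<close>-th root of unity as coordinate.\<close>

definition ulam :: "'s mat \<Rightarrow> complex" where "ulam w = (if ori w then lam w else - lam w)"

lemma \<sigma>_N [simp]: "\<sigma> s \<in> N" "\<sigma> t \<in> N" by (auto intro: WL_N sref_WJ)

lemma WL_ulam: "w \<in> WL \<Longrightarrow> ulam w ^ n = 1"
proof (induction rule: WJ_induct)
  case one show ?case by (simp add: ulam_def one_act)
next
  case (step w r)
  have wN: "w \<in> N" using step WL_N by blast
  have "r = s \<or> r = t" using step(2) by auto
  then have r: "\<sigma> r \<in> N" "\<not> ori (\<sigma> r)" "(- lam (\<sigma> r)) ^ n = 1"
    by (elim disjE; simp add: \<sigma>_act cnj_root[OF \<zeta>_n])+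
  have "ulam (w ** \<sigma> r) = (- lam (\<sigma> r)) * cnj (ulam w)"
    unfolding ulam_def act_mult[OF wN r(1)] using r by (auto simp: act_def)
  then have "ulam (w ** \<sigma> r) ^ n = (- lam (\<sigma> r)) ^ n * cnj (ulam w) ^ n" by (simp only: power_mult_distrib)
  then show ?case using r cnj_root[OF step(3)] by simp
qed

lemma WL_det: "w \<in> WL \<Longrightarrow> det w = (if ori w then 1 else -1)"
proof (induction rule: WJ_induct)
  case one show ?case by (simp add: one_act)
next
  case (step w r)
  have wN: "w \<in> N" using step WL_N by blast
  from step(2) have r: "\<sigma> r \<in> N" "\<not> ori (\<sigma> r)" using \<sigma>_act by auto
  show ?case unfolding det_mul det_sref act_mult[OF wN r(1)] using step r by auto
qed

lemma WL_unique: assumes "w \<in> WL" "w' \<in> WL" "ori w = ori w'" "lam w = lam w'" shows "w = w'"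
  using assms act_\<tau>[OF WL_N] by (intro WL_eqI) (auto simp: act_def)

text \<open>Alternating words of even length \<open>2 * k\<close> give the rotations and those of
  odd length \<open>2 * k + 1\<close> the reflections, with normalized coordinate running through
  the powers of \<open>\<zeta>\<close>.\<close>

lemma WL_ex: assumes "z ^ n = 1" shows "\<exists>w\<in>WL. ori w = b \<and> ulam w = z"
proof -
  have "z \<in> (\<lambda>k. cis (2 * pi * real k / real n)) ` {..<n}"
    using bij_betw_imp_surj_on[OF Complex.bij_betw_roots_unity[OF n_pos]] assms by blast
  then obtain k where "z = cis (2 * pi * real k / real n)" by blast
  then have z: "z = cis (real (2 * k) * \<theta>)" unfolding \<theta>_def by (simp add: mult.commute mult.left_commute)
  show ?thesis
  proof (cases b)
    case True
    have "\<tau> (v v* word_prod m (altw t s (2 * k))) = z * \<tau> v" for v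
      unfolding \<tau>_alt_ts z by simp
    from ori_I[OF this] have "ori (word_prod m (altw t s (2 * k)))" "ulam (word_prod m (altw t s (2 * k))) = z"
      by (simp_all add: ulam_def)
    then show ?thesis using True alt_WL by blast
  next
    case False
    have *: "\<tau> (v v* word_prod m (altw s t (Suc (2 * k)))) = - z * cnj (\<tau> v)" for v
      unfolding \<tau>_alt_st z by simp
    have "- z \<noteq> 0" unfolding z by simp
    from nori_I[OF * this] have "\<not> ori (word_prod m (altw s t (Suc (2 * k))))" "ulam (word_prod m (altw s t (Suc (2 * k)))) = z"
      by (simp_all add: ulam_def del: altw.simps)
    then show ?thesis using False alt_WL by blast
  qed
qed

lemma card_roots: "card {z::complex. z ^ n = 1} = n" "finite {z::complex. z ^ n = 1}"
  using card_roots_unity_eq[of n] finite_roots_unity[of n] n_ge_2 by auto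

lemma card_WL: "card WL = 2 * n"
proof -
  have "bij_betw (\<lambda>w. (ori w, ulam w)) WL (UNIV \<times> {z. z ^ n = 1})"
    unfolding bij_betw_def
  proof
    show "inj_on (\<lambda>w. (ori w, ulam w)) WL"
      by (rule inj_onI) (auto simp: ulam_def intro!: WL_unique split: if_splits)
    show "(\<lambda>w. (ori w, ulam w)) ` WL = UNIV \<times> {z. z ^ n = 1}"
    proof
      show "(\<lambda>w. (ori w, ulam w)) ` WL \<subseteq> UNIV \<times> {z. z ^ n = 1}" using WL_ulam by auto
      show "UNIV \<times> {z. z ^ n = 1} \<subseteq> (\<lambda>w. (ori w, ulam w)) ` WL"
      proof
        fix y :: "bool \<times> complex" assume "y \<in> UNIV \<times> {z. z ^ n = 1}"
        then have "snd y ^ n = 1" by auto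
        then obtain w where "w \<in> WL" "ori w = fst y \<and> ulam w = snd y" using WL_ex by blast
        then show "y \<in> (\<lambda>w. (ori w, ulam w)) ` WL" by (intro image_eqI[of _ _ w]) (auto simp: prod_eq_iff)
      qed
    qed
  qed
  then have "card WL = card ((UNIV::bool set) \<times> {z::complex. z ^ n = 1})" by (rule bij_betw_same_card)
  then show ?thesis by (simp add: card_cartesian_product card_roots)
qed

text \<open>Both claims come from comparing the actions of the two sides of
  \<open>g ** ?v = u ** g\<close>. On reflections \<open>g\<close> enters through the square of
  \<open>lam g\<close>, which is why \<open>mu\<close> governs everything later.\<close>

lemma lam_conj: assumes "g \<in> N" "u \<in> WL"
  shows "ori (iv g ** u ** g) = ori u"
    "lam (iv g ** u ** g) = (if ori u then (if ori g then lam u else cnj (lam u))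
       else lam g * lam g * (if ori g then lam u else cnj (lam u)))"
proof -
  let ?v = "iv g ** u ** g"
  have v: "?v \<in> N" "u \<in> N" using N_conj assms WL_N by blast+
  have e: "g ** ?v = u ** g" using N_W[OF assms(1)] by (simp add: matrix_mul_assoc)
  have o: "ori (g ** ?v) = ori (u ** g)" and l: "lam (g ** ?v) = lam (u ** g)" using e by simp_all
  show "ori ?v = ori u" using o assms v by (auto simp: act_mult)
  then have "(if ori u then lam ?v * lam g else lam ?v * cnj (lam g)) =
     (if ori g then lam g * lam u else lam g * cnj (lam u))"
    using l assms v by (simp add: act_mult act_def)
  then show "lam ?v = (if ori u then (if ori g then lam u else cnj (lam u))
       else lam g * lam g * (if ori g then lam u else cnj (lam u)))"
    using lam_norm[OF assms(1)] lam_nz[OF assms(1)]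
    by (auto split: if_splits) (metis mult.assoc mult.commute mult.right_neutral)+
qed

abbreviation "mu g \<equiv> lam g * lam g"

text \<open>\<open>mu g\<close> is the normalized coordinate of the conjugate of
  \<open>\<sigma> s\<close> by \<open>g\<close>, a reflection in \<open>WL\<close>. The number
  \<open>lam g\<close> itself need not be an \<open>n\<close>-th root of unity, as
  \<open>\<sigma> s\<close> shows for odd \<open>n\<close>.\<close>

lemma mu_root: assumes "g \<in> N" shows "mu g ^ n = 1"
proof -
  have s: "\<sigma> s \<in> WL" by (simp add: sref_WJ)
  have "ulam (iv g ** \<sigma> s ** g) = mu g"
    unfolding ulam_def lam_conj[OF assms s] using \<sigma>_act by simp
  then show ?thesis using WL_ulam N_conj(2)[OF assms s] by metis
qed

lemma cuspidal_iff: "cuspidal m {s,t} w \<longleftrightarrow> w \<in> WL \<and> ori w \<and> lam w \<noteq> 1"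
proof (cases "w \<in> WL")
  case True
  then have wN: "w \<in> N" by (rule WL_N)
  have c: "cuspidal m {s,t} w \<longleftrightarrow> (\<forall>v\<in>P. v v* w = v \<longrightarrow> v = 0)"
    unfolding cuspidal_def perp_iff using True by auto
  have fixP: "v v* w = v \<longleftrightarrow> act w (\<tau> v) = \<tau> v" if "v \<in> P" for v
  proof
    assume "act w (\<tau> v) = \<tau> v"
    then have "\<tau> (v v* w - v) = 0" using act_\<tau>[OF wN] by (simp add: \<tau>_diff)
    then show "v v* w = v" using \<tau>_P_inj[OF P_diff[OF N_P[OF wN that] that]] by simp
  qed (metis act_\<tau>[OF wN])
  have ex: "\<exists>v\<in>P. \<tau> v = z" for z
  proof -
    define v where "v = (Re z + cos \<theta> * Im z / sin \<theta>) *\<^sub>R al s + (Im z / sin \<theta>) *\<^sub>R al t"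
    have "v \<in> P" unfolding v_def P_def by blast
    moreover have "\<tau> v = z" unfolding v_def \<tau>_linear by (simp add: complex_eq_iff \<epsilon>_def)
    ultimately show ?thesis by blast
  qed
  have "cuspidal m {s,t} w \<longleftrightarrow> (\<forall>z. act w z = z \<longrightarrow> z = 0)"
    unfolding c using fixP ex \<tau>_P_inj by (metis \<tau>_0)
  also have "\<dots> \<longleftrightarrow> ori w \<and> lam w \<noteq> 1"
  proof
    assume h: "\<forall>z. act w z = z \<longrightarrow> z = 0"
    show "ori w \<and> lam w \<noteq> 1"
    proof (cases "ori w")
      case True then show ?thesis using h[rule_format, of 1] by (auto simp: act_def)
    next
      case False
      \<comment> \<open>A nonzero fixed point of the reflection with factor \<open>lam w\<close> of
        modulus 1 is \<open>lam w + 1\<close>. It degenerates when \<open>lam w = -1\<close>, and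
        then the imaginary axis is fixed.\<close>
      define z where "z = (if lam w = -1 then \<i> else lam w + 1)"
      have "act w z = z" using False lam_norm[OF wN] by (simp add: act_def z_def algebra_simps)
      moreover have "z \<noteq> 0" unfolding z_def by (auto simp: add_eq_0_iff2)
      ultimately show ?thesis using h by blast
    qed
  next
    assume h: "ori w \<and> lam w \<noteq> 1"
    then show "\<forall>z. act w z = z \<longrightarrow> z = 0" by (auto simp: act_def)
  qed
  finally show ?thesis using True by simp
qed (simp add: cuspidal_def)

end

section \<open>Traces and the elements \<open>eL\<close>\<close>

text \<open>The trace is that of the permutation module minus the constants. Its independence of the chosen basis
  comes from expanding the centred indicator functions of the points of \<open>Q\<close> in that basis.\<close>

lemma trace_mod_perm:
  fixes U K :: "('a \<Rightarrow> complex) set" and D :: "('a \<Rightarrow> complex) \<Rightarrow> 'q \<Rightarrow> complex"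
  assumes finQ: "finite Q" and q0: "q0 \<in> Q"
    and Ulin: "\<And>n a b. (\<forall>i<n. b i \<in> U) \<Longrightarrow> lincomb n a b \<in> U"
    and Dlin: "\<And>n a b q. q \<in> Q \<Longrightarrow> D (lincomb n a b) q = (\<Sum>i<n. a i * D (b i) q)"
    and K: "\<And>f. f \<in> U \<Longrightarrow> f \<in> K \<longleftrightarrow> (\<forall>q\<in>Q. D f q = 0)"
    and Dsum: "\<And>f. f \<in> U \<Longrightarrow> (\<Sum>q\<in>Q. D f q) = 0"
    and Dsurj: "\<And>h. (\<Sum>q\<in>Q. h q) = 0 \<Longrightarrow> \<exists>f\<in>U. \<forall>q\<in>Q. D f q = h q"
    and \<phi>U: "\<And>f. f \<in> U \<Longrightarrow> \<phi> f \<in> U"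
    and \<phi>D: "\<And>f q. f \<in> U \<Longrightarrow> q \<in> Q \<Longrightarrow> D (\<phi> f) q = D f (p q)"
    and pQ: "\<And>q. q \<in> Q \<Longrightarrow> p q \<in> Q"
  shows "trace_mod U K \<phi> = of_nat (card {q\<in>Q. p q = q}) - 1"
proof -
  define ok where "ok n b c \<longleftrightarrow> (\<forall>i<n. b i \<in> U)
    \<and> (\<forall>f\<in>U. \<exists>a. (\<lambda>x. f x - lincomb n a b x) \<in> K)
    \<and> (\<forall>a. lincomb n a b \<in> K \<longrightarrow> (\<forall>i<n. a i = 0))
    \<and> (\<forall>i<n. (\<lambda>x. \<phi> (b i) x - lincomb n (c i) b x) \<in> K)" for n b c
  have two: "(\<lambda>x. f x - g x) = lincomb 2 (\<lambda>i. if i = 0 then 1 else -1) (\<lambda>i. if i = 0 then f else g)"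
    for f g :: "'a \<Rightarrow> complex"
    by (simp add: lincomb_def numeral_2_eq_2 fun_eq_iff)
  have Udiff: "(\<lambda>x. f x - g x) \<in> U" if "f \<in> U" "g \<in> U" for f g
    unfolding two by (rule Ulin) (use that in auto)
  have Ddiff: "D (\<lambda>x. f x - g x) q = D f q - D g q" if "q \<in> Q" for f g q
    unfolding two Dlin[OF that] by (simp add: numeral_2_eq_2)
  have Kd: "(\<lambda>x. f x - g x) \<in> K \<longleftrightarrow> (\<forall>q\<in>Q. D f q = D g q)" if "f \<in> U" "g \<in> U" for f g
    using K[OF Udiff[OF that]] Ddiff by auto
  have cQ: "card Q \<noteq> 0" using finQ q0 by auto
  have val: "(\<Sum>i<n. c i i) = of_nat (card {q\<in>Q. p q = q}) - 1" if "ok n b c" for n b c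
  proof -
    have bU: "\<And>i. i < n \<Longrightarrow> b i \<in> U"
      and sp: "\<And>f. f \<in> U \<Longrightarrow> \<exists>a. (\<lambda>x. f x - lincomb n a b x) \<in> K"
      and ind: "\<And>a i. lincomb n a b \<in> K \<Longrightarrow> i < n \<Longrightarrow> a i = 0"
      and cc: "\<And>i. i < n \<Longrightarrow> (\<lambda>x. \<phi> (b i) x - lincomb n (c i) b x) \<in> K"
      using that unfolding ok_def by blast+
    have lU: "lincomb n a b \<in> U" for a by (rule Ulin) (use bU in auto)
    define h :: "'q \<Rightarrow> 'q \<Rightarrow> complex" where "h q x = (if x = q then 1 else 0) - 1 / of_nat (card Q)" for q x
    have "\<exists>a. \<forall>x\<in>Q. h q x = (\<Sum>i<n. a i * D (b i) x)" if "q \<in> Q" for q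
    proof -
      have "(\<Sum>x\<in>Q. h q x) = 0" unfolding h_def using finQ that cQ by (simp add: sum_subtractf)
      then obtain f where f: "f \<in> U" "\<forall>x\<in>Q. D f x = h q x" using Dsurj by blast
      obtain a where "(\<lambda>x. f x - lincomb n a b x) \<in> K" using sp f by blast
      then show ?thesis using Kd[OF f(1) lU] f(2) Dlin by auto
    qed
    then obtain A where A: "\<And>q x. q \<in> Q \<Longrightarrow> x \<in> Q \<Longrightarrow> h q x = (\<Sum>i<n. A q i * D (b i) x)" by metis
    have hsum: "(\<Sum>q\<in>Q. g q * h q x) = g x" if "x \<in> Q" "(\<Sum>q\<in>Q. g q) = 0" for g x
    proof -
      have "(\<Sum>q\<in>Q. g q * h q x) = (\<Sum>q\<in>Q. (if x = q then g q else 0)) - (\<Sum>q\<in>Q. g q) / of_nat (card Q)"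
        unfolding sum_divide_distrib sum_subtractf[symmetric]
        by (rule sum.cong) (auto simp: h_def right_diff_distrib)
      then show ?thesis using that finQ by simp
    qed
    \<comment> \<open>The coefficients \<open>A\<close> form the basis dual to \<open>b\<close>:
      expanding \<open>D (b j)\<close> in centred indicators and these in \<open>b\<close> returns
      \<open>b j\<close> modulo \<open>K\<close>, and independence compares coefficients.\<close>
    have dual: "(\<Sum>q\<in>Q. D (b j) q * A q i) = (if i = j then 1 else 0)" if "i < n" "j < n" for i j
    proof -
      let ?a = "\<lambda>i. (\<Sum>q\<in>Q. D (b j) q * A q i) - (if i = j then 1 else 0)"
      have "D (lincomb n ?a b) x = 0" if x: "x \<in> Q" for x
      proof -
        have "D (lincomb n ?a b) x = (\<Sum>i<n. (\<Sum>q\<in>Q. D (b j) q * A q i) * D (b i) x) - D (b j) x"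
          unfolding Dlin[OF x] using \<open>j < n\<close> by (simp add: left_diff_distrib sum_subtractf if_distrib[of "\<lambda>z. z * _"] cong: if_cong)
        also have "(\<Sum>i<n. (\<Sum>q\<in>Q. D (b j) q * A q i) * D (b i) x) = (\<Sum>q\<in>Q. D (b j) q * (\<Sum>i<n. A q i * D (b i) x))"
          unfolding sum_distrib_right sum_distrib_left by (subst sum.swap) (simp add: mult.assoc)
        also have "\<dots> = (\<Sum>q\<in>Q. D (b j) q * h q x)" using A x by simp
        also have "\<dots> = D (b j) x" using hsum[OF x] Dsum bU \<open>j < n\<close> by blast
        finally show ?thesis by simp
      qed
      then have "lincomb n ?a b \<in> K" using K[OF lU] by blast
      from ind[OF this \<open>i < n\<close>] show ?thesis by simp
    qed
    have cD: "D (b j) (p q) = (\<Sum>i<n. c j i * D (b i) q)" if "j < n" "q \<in> Q" for j q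
      using cc[OF that(1)] Kd[OF \<phi>U[OF bU[OF that(1)]] lU] \<phi>D[OF bU[OF that(1)] that(2)] Dlin[OF that(2)] that(2) by metis
    \<comment> \<open>Duality trades the sum over the basis for a sum over \<open>Q\<close>, in
      which the basis disappears and only the diagonal values \<open>h q (p q)\<close>
      remain.\<close>
    have "(\<Sum>j<n. c j j) = (\<Sum>j<n. \<Sum>i<n. c j i * (if j = i then 1 else 0))"
      by (simp add: if_distrib cong: if_cong)
    also have "\<dots> = (\<Sum>j<n. \<Sum>i<n. c j i * (\<Sum>q\<in>Q. D (b i) q * A q j))"
      by (intro sum.cong refl) (simp add: dual)
    also have "\<dots> = (\<Sum>j<n. \<Sum>q\<in>Q. A q j * (\<Sum>i<n. c j i * D (b i) q))"
      unfolding sum_distrib_left by (intro sum.cong refl, subst sum.swap) (simp add: mult_ac)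
    also have "\<dots> = (\<Sum>j<n. \<Sum>q\<in>Q. A q j * D (b j) (p q))"
      by (intro sum.cong refl) (simp add: cD)
    also have "\<dots> = (\<Sum>q\<in>Q. h q (p q))"
      by (subst sum.swap) (intro sum.cong refl, simp add: A pQ)
    also have "\<dots> = (\<Sum>q\<in>Q. if p q = q then 1 else 0) - 1" using cQ by (simp add: h_def sum_subtractf)
    also have "(\<Sum>q\<in>Q. if p q = q then 1 else 0) = (of_nat (card {q\<in>Q. p q = q}) :: complex)"
      using finQ by (simp add: sum.If_cases Int_def)
    finally show ?thesis .
  qed
  have "\<exists>n b c. ok n b c"
  proof -
    obtain e where e: "bij_betw e {0..<card (Q - {q0})} (Q - {q0})"
      using ex_bij_betw_nat_finite finQ by blast
    define n where "n = card (Q - {q0})"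
    have e: "bij_betw e {..<n} (Q - {q0})" using e unfolding n_def by (simp add: atLeast0LessThan)
    have eQ: "e i \<in> Q" "e i \<noteq> q0" if "i < n" for i using e that unfolding bij_betw_def by auto
    have einj: "e i = e k \<longleftrightarrow> i = k" if "i < n" "k < n" for i k
      using e that unfolding bij_betw_def inj_on_def by auto
    \<comment> \<open>The basis whose images are the indicator of a point minus the indicator of
      \<open>q0\<close>. Coordinates are then read off at the points other than \<open>q0\<close>,
      and the value at \<open>q0\<close> follows from the vanishing sum.\<close>
    have "\<exists>f\<in>U. \<forall>q\<in>Q. D f q = (if q = e i then 1 else 0) - (if q = q0 then 1 else 0)" if "i < n" for i
      using finQ q0 eQ that by (intro Dsurj) (simp add: sum_subtractf)
    then obtain b where b: "\<And>i. i < n \<Longrightarrow> b i \<in> U"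
      "\<And>i q. i < n \<Longrightarrow> q \<in> Q \<Longrightarrow> D (b i) q = (if q = e i then 1 else 0) - (if q = q0 then 1 else 0)" by metis
    have lU: "lincomb n a b \<in> U" for a by (rule Ulin) (use b in auto)
    have De: "D (lincomb n a b) (e k) = a k" if "k < n" for a k
    proof -
      have "D (lincomb n a b) (e k) = (\<Sum>i<n. if i = k then a i else 0)"
        unfolding Dlin[OF eQ(1)[OF that]] using that eQ einj by (intro sum.cong) (auto simp: b)
      then show ?thesis using that by simp
    qed
    have ext: "\<forall>q\<in>Q. D f q = D g q" if "f \<in> U" "g \<in> U" "\<forall>k<n. D f (e k) = D g (e k)" for f g
    proof -
      have 1: "D f q = D g q" if "q \<in> Q - {q0}" for q
      proof -
        have "q \<in> e ` {..<n}" using e that unfolding bij_betw_def by simp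
        then show ?thesis using \<open>\<forall>k<n. D f (e k) = D g (e k)\<close> by auto
      qed
      have "D f q0 + (\<Sum>q\<in>Q-{q0}. D f q) = D g q0 + (\<Sum>q\<in>Q-{q0}. D g q)"
        using Dsum[OF that(1)] Dsum[OF that(2)] sum.remove[OF finQ q0] by metis
      moreover have "(\<Sum>q\<in>Q-{q0}. D f q) = (\<Sum>q\<in>Q-{q0}. D g q)" by (rule sum.cong) (use 1 in auto)
      ultimately show ?thesis using 1 by auto
    qed
    have sp: "\<exists>a. (\<lambda>x. f x - lincomb n a b x) \<in> K" if "f \<in> U" for f
      using Kd[OF that lU] ext[OF that lU] De by (intro exI[of _ "\<lambda>k. D f (e k)"]) auto
    have "\<forall>i. \<exists>ci. i < n \<longrightarrow> (\<lambda>x. \<phi> (b i) x - lincomb n ci b x) \<in> K" using sp \<phi>U b(1) by blast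
    then obtain c where "\<forall>i<n. (\<lambda>x. \<phi> (b i) x - lincomb n (c i) b x) \<in> K" by metis
    moreover have "\<forall>a. lincomb n a b \<in> K \<longrightarrow> (\<forall>i<n. a i = 0)" using K[OF lU] De eQ by metis
    ultimately show ?thesis unfolding ok_def using b(1) sp by blast
  qed
  then obtain n b c where okk: "ok n b c" by blast
  show ?thesis unfolding trace_mod_def
  proof (rule the_equality)
    show "\<exists>n b c. (\<forall>i<n. b i \<in> U) \<and> (\<forall>f\<in>U. \<exists>a. (\<lambda>x. f x - lincomb n a b x) \<in> K)
      \<and> (\<forall>a. lincomb n a b \<in> K \<longrightarrow> (\<forall>i<n. a i = 0))
      \<and> (\<forall>i<n. (\<lambda>x. \<phi> (b i) x - lincomb n (c i) b x) \<in> K)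
      \<and> of_nat (card {q\<in>Q. p q = q}) - 1 = (\<Sum>i<n. c i i)"
      by (rule exI[of _ n], rule exI[of _ b], rule exI[of _ c])
        (use okk[unfolded ok_def] val[OF okk] in simp)
  next
    fix tr assume "\<exists>n b c. (\<forall>i<n. b i \<in> U) \<and> (\<forall>f\<in>U. \<exists>a. (\<lambda>x. f x - lincomb n a b x) \<in> K)
      \<and> (\<forall>a. lincomb n a b \<in> K \<longrightarrow> (\<forall>i<n. a i = 0))
      \<and> (\<forall>i<n. (\<lambda>x. \<phi> (b i) x - lincomb n (c i) b x) \<in> K) \<and> tr = (\<Sum>i<n. c i i)"
    then obtain n b c where "ok n b c" "tr = (\<Sum>i<n. c i i)" unfolding ok_def by (elim exE conjE) blast
    then show "tr = of_nat (card {q\<in>Q. p q = q}) - 1" using val by simp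
  qed
qed

text \<open>Forward substitution by cardinality. Stage \<open>k\<close> changes \<open>e\<close>
  only on sets of size \<open>k\<close>, which the equations for smaller sets do not see.\<close>

lemma triangular_ex:
  fixes M :: "'s::finite set \<Rightarrow> 's set \<Rightarrow> complex"
  assumes tri: "\<And>K L. \<not> L \<subseteq> K \<Longrightarrow> M K L = 0" and diag: "\<And>K. M K K \<noteq> 0"
  shows "\<exists>e. \<forall>K. x K = (\<Sum>L\<in>UNIV. M K L * e L)"
proof -
  have "\<exists>e. \<forall>K. card K < k \<longrightarrow> x K = (\<Sum>L\<in>UNIV. M K L * e L)" for k
  proof (induction k)
    case (Suc k)
    then obtain e where e: "\<And>K. card K < k \<Longrightarrow> x K = (\<Sum>L\<in>UNIV. M K L * e L)" by blast
    define e' where "e' K = (if card K = k then (x K - (\<Sum>L\<in>UNIV-{K}. M K L * e L)) / M K K else e K)" for K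
    have same: "M K L * e' L = M K L * e L" if "card K \<le> k" "L \<noteq> K" for K L
    proof (cases "L \<subseteq> K")
      case True
      then have "card L < card K" using that by (intro psubset_card_mono) auto
      then have "card L < k" using that by simp
      then show ?thesis by (simp add: e'_def)
    qed (simp add: tri)
    have "x K = (\<Sum>L\<in>UNIV. M K L * e' L)" if K: "card K < Suc k" for K
    proof -
      have "(\<Sum>L\<in>UNIV. M K L * e' L) = M K K * e' K + (\<Sum>L\<in>UNIV-{K}. M K L * e' L)"
        by (rule sum.remove) auto
      also have "(\<Sum>L\<in>UNIV-{K}. M K L * e' L) = (\<Sum>L\<in>UNIV-{K}. M K L * e L)"
        by (rule sum.cong) (use same K in auto)
      also have "M K K * e' K + \<dots> = x K"
      proof (cases "card K = k")
        case True then show ?thesis using diag[of K] by (simp add: e'_def)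
      next
        case False
        then have "x K = (\<Sum>L\<in>UNIV. M K L * e L)" using e K by simp
        also have "\<dots> = M K K * e K + (\<Sum>L\<in>UNIV-{K}. M K L * e L)" by (rule sum.remove) auto
        finally show ?thesis using False by (simp add: e'_def)
      qed
      finally show ?thesis by simp
    qed
    then show ?case by blast
  qed simp
  from this[of "Suc (CARD('s))"] show ?thesis
    by (metis card_mono finite_UNIV less_Suc_eq_le top_greatest finite)
qed

lemma triangular_unique:
  fixes M :: "'s::finite set \<Rightarrow> 's set \<Rightarrow> complex"
  assumes tri: "\<And>K L. \<not> L \<subseteq> K \<Longrightarrow> M K L = 0" and diag: "\<And>K. M K K \<noteq> 0"
    and e: "\<forall>K. (\<Sum>L\<in>UNIV. M K L * e L) = (\<Sum>L\<in>UNIV. M K L * e' L)"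
  shows "e K = e' K"
proof (induction "card K" arbitrary: K rule: less_induct)
  case less
  have "M K L * e L = M K L * e' L" if "L \<noteq> K" for L
  proof (cases "L \<subseteq> K")
    case True
    then have "card L < card K" using that by (intro psubset_card_mono) auto
    then show ?thesis using less by simp
  qed (simp add: tri)
  then have "(\<Sum>L\<in>UNIV-{K}. M K L * e L) = (\<Sum>L\<in>UNIV-{K}. M K L * e' L)" by (intro sum.cong) auto
  then have "M K K * e K = M K K * e' K"
    using e[rule_format, of K] sum.remove[of UNIV K "\<lambda>L. M K L * e L"] sum.remove[of UNIV K "\<lambda>L. M K L * e' L"]
    by simp
  then show ?case using diag by simp
qed

context finite_coxeter
begin

text \<open>The \<open>THE\<close> in the definition of \<open>eL\<close> denotes something because
  \<open>mKL\<close> is triangular for inclusion with nonzero diagonal. Later arguments access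
  \<open>eL\<close> only through this equation.\<close>

lemma eL_eq: "xJ m K z = (\<Sum>L\<in>Pow K. of_nat (mKL m K L) * eL m L z)"
proof -
  let ?M = "\<lambda>K L. of_nat (mKL m K L) :: complex"
  let ?P = "\<lambda>e. \<forall>K. xJ m K = (\<lambda>z. \<Sum>L\<in>(UNIV::'s set set). ?M K L * e L z)"
  have tri: "\<not> L \<subseteq> K \<Longrightarrow> ?M K L = 0" for K L by (simp add: mKL_def)
  have diag: "?M K K \<noteq> 0" for K using mKL_diag by simp
  have "\<forall>z. \<exists>e. \<forall>K. xJ m K z = (\<Sum>L\<in>UNIV. ?M K L * e L)"
    by (intro allI triangular_ex) (fact tri, fact diag)
  then obtain e where "\<forall>z K. xJ m K z = (\<Sum>L\<in>UNIV. ?M K L * e z L)" by metis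
  then have ex: "?P (\<lambda>L z. e z L)" by (simp add: fun_eq_iff)
  have un: "e1 = e2" if "?P e1" "?P e2" for e1 e2
  proof (intro ext)
    fix L z
    have "\<forall>K. (\<Sum>L\<in>UNIV. ?M K L * e1 L z) = (\<Sum>L\<in>UNIV. ?M K L * e2 L z)"
      using that by (metis (no_types, lifting))
    then show "e1 L z = e2 L z"
      by (intro triangular_unique[of ?M "\<lambda>L. e1 L z" "\<lambda>L. e2 L z"]) (erule tri, rule diag, assumption)
  qed
  have "?P (eL m)" unfolding eL_def by (rule theI[of ?P "\<lambda>L z. e z L"], rule ex, erule un, rule ex)
  then have "xJ m K z = (\<Sum>L\<in>UNIV. ?M K L * eL m L z)" by metis
  also have "\<dots> = (\<Sum>L\<in>Pow K. ?M K L * eL m L z)"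
    by (rule sum.mono_neutral_right) (auto simp: mKL_def)
  finally show ?thesis .
qed

lemma xJ_W: "z \<in> W \<Longrightarrow> xJ m J z = (if \<forall>r\<in>J. \<forall>j. iv z $ r $ j \<ge> 0 then 1 else 0)"
proof -
  assume z: "z \<in> W"
  have "z \<in> iv ` XJ m J \<longleftrightarrow> iv z \<in> XJ m J"
  proof
    assume "z \<in> iv ` XJ m J" then show "iv z \<in> XJ m J" by (auto simp: XJ_iff)
  next
    assume "iv z \<in> XJ m J" then show "z \<in> iv ` XJ m J" using z by (intro image_eqI[of _ _ "iv z"]) simp_all
  qed
  then show ?thesis unfolding xJ_def using z by (simp add: XJ_iff WJ_inv)
qed

lemma conv_W: assumes "z \<in> W" shows "conv m f g z = (\<Sum>y\<in>W. f (z ** iv y) * g y)"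
proof -
  have "bij_betw (\<lambda>y. (z ** iv y, y)) W {(x,y). x \<in> W \<and> y \<in> W \<and> x ** y = z}"
    by (rule bij_betw_byWitness[where f' = snd]) (use assms in \<open>auto intro: WJ_mult WJ_inv\<close>)
  from sum.reindex_bij_betw[OF this, of "\<lambda>p. f (fst p) * g (snd p)"]
  show ?thesis unfolding conv_def by simp
qed

lemma conv_notW: assumes "z \<notin> W" shows "conv m f g z = 0"
proof -
  have "{(x,y). x \<in> W \<and> y \<in> W \<and> x ** y = z} = {}" using assms WJ_mult by auto
  then show ?thesis unfolding conv_def by (simp only: sum.empty)
qed

lemma XJ_empty: "XJ m {} = W" "XJsharp m {} = W"
  unfolding XJsharp_def by (auto simp: XJ_iff)

end

section \<open>The character \<open>PhiT\<close>\<close>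

context finite_rank2
begin

abbreviation "R \<equiv> {z::complex. z ^ n = 1}"
abbreviation "mLL \<equiv> of_nat (mKL m {s,t} {s,t}) :: complex"

lemma swap_simple: "finite_rank2 m t s"
  by unfold_locales (use st in auto)

lemma card_Xsharp_t: "card (XJsharp m {t}) = 2 * card (XJ m {s,t} \<inter> XJsharp m {t})"
  using finite_rank2.card_Xsharp[OF swap_simple] by (simp add: insert_commute)

text \<open>Let \<open>ps\<close> and \<open>pt\<close> be the indicators of the two sign
  conditions. The four equations for the subsets of \<open>{s,t}\<close> are solved from the bottom,
  with \<open>card_Xsharp\<close> halving the two middle coefficients. The result is
  \<open>ps * pt - (ps + pt) / 2 + 1/2 - 1/(2n)\<close>, which only depends on whether
  \<open>ps\<close> and \<open>pt\<close> agree.\<close>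

lemma eL_formula: assumes z: "z \<in> W"
  shows "mLL * eL m {s,t} z =
    (if (\<forall>j. iv z $ s $ j \<ge> 0) \<longleftrightarrow> (\<forall>j. iv z $ t $ j \<ge> 0) then 1/2 else 0) - 1 / (2 * of_nat n)"
proof -
  have sub: "XJ m J \<subseteq> W" "XJsharp m J \<subseteq> XJ m J" for J by (auto simp: XJ_iff XJsharp_def)
  have k1: "mKL m {} {} = card W" "mKL m {r} {} = card (XJ m {r})"
    "mKL m {r} {r} = card (XJsharp m {r})" "mKL m {s,t} {} = card (XJ m {s,t})"
    "mKL m {s,t} {s} = card (XJ m {s,t} \<inter> XJsharp m {s})"
    "mKL m {s,t} {t} = card (XJ m {s,t} \<inter> XJsharp m {t})" for r
    using sub[of "{r}"] sub[of "{s,t}"] unfolding mKL_def XJ_empty by (simp_all add: Int_absorb1 Int_absorb2)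
  define w :: complex where "w = of_nat (card W)"
  have cW: "card W \<noteq> 0" using finW one_WJ[of UNIV] by (metis card_0_eq empty_iff)
  then have w: "w \<noteq> 0" by (simp add: w_def)
  have E0: "w * eL m {} z = 1"
    using eL_eq[of "{}" z] xJ_W[OF z, of "{}"] by (simp add: k1 w_def)
  have Er: "(if \<forall>j. iv z $ r $ j \<ge> 0 then 1 else 0) = 1/2 + of_nat (card (XJsharp m {r})) * eL m {r} z" for r
  proof -
    have "xJ m {r} z = of_nat (card (XJ m {r})) * eL m {} z + of_nat (card (XJsharp m {r})) * eL m {r} z"
      using eL_eq[of "{r}" z] by (simp add: Pow_insert k1)
    moreover have "w = 2 * of_nat (card (XJ m {r}))" unfolding w_def using card_X_single[of r] by (metis of_nat_mult of_nat_numeral)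
    then have "of_nat (card (XJ m {r})) * eL m {} z = 1/2" using E0 by (simp add: field_simps)
    ultimately show ?thesis using xJ_W[OF z, of "{r}"] by simp
  qed
  have "w = of_nat (2 * n) * of_nat (card (XJ m {s,t}))"
    unfolding w_def card_decomp[of "{s,t}"] card_WL by simp
  then have EL: "of_nat (card (XJ m {s,t})) * eL m {} z = 1 / (2 * of_nat n)" using E0 n_pos by (simp add: field_simps)
  have S1: "of_nat (card (XJ m {s,t} \<inter> XJsharp m {s})) * eL m {s} z = 1/2 * (of_nat (card (XJsharp m {s})) * eL m {s} z)"
    unfolding card_Xsharp by simp
  have S2: "of_nat (card (XJ m {s,t} \<inter> XJsharp m {t})) * eL m {t} z = 1/2 * (of_nat (card (XJsharp m {t})) * eL m {t} z)"
    unfolding card_Xsharp_t by simp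
  have P: "Pow {s,t} = {{},{s},{t},{s,t}}" by (auto simp: Pow_insert)
  have "xJ m {s,t} z = of_nat (card (XJ m {s,t})) * eL m {} z
      + (of_nat (card (XJ m {s,t} \<inter> XJsharp m {s})) * eL m {s} z
      + (of_nat (card (XJ m {s,t} \<inter> XJsharp m {t})) * eL m {t} z
      + mLL * eL m {s,t} z))"
    unfolding eL_eq[of "{s,t}" z] P using st by (simp add: k1 doubleton_eq_iff)
  then have T: "mLL * eL m {s,t} z = xJ m {s,t} z - 1 / (2 * of_nat n)
      - 1/2 * (of_nat (card (XJsharp m {s})) * eL m {s} z) - 1/2 * (of_nat (card (XJsharp m {t})) * eL m {t} z)"
    unfolding EL S1 S2 by (simp add: algebra_simps)
  have aux: "c = a - b" if "a = b + c" for a b c :: complex using that by simp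
  define ps where "ps \<longleftrightarrow> (\<forall>j. iv z $ s $ j \<ge> 0)"
  define pt where "pt \<longleftrightarrow> (\<forall>j. iv z $ t $ j \<ge> 0)"
  have es: "of_nat (card (XJsharp m {s})) * eL m {s} z = (if ps then 1 else 0) - 1/2"
    unfolding ps_def by (rule aux) (rule Er)
  have et: "of_nat (card (XJsharp m {t})) * eL m {t} z = (if pt then 1 else 0) - 1/2"
    unfolding pt_def by (rule aux) (rule Er)
  have x: "xJ m {s,t} z = (if ps \<and> pt then 1 else 0)" unfolding xJ_W[OF z] ps_def pt_def by simp
  show ?thesis unfolding T es et x ps_def[symmetric] pt_def[symmetric]
    by (cases ps; cases pt) simp_all
qed

text \<open>\<open>lab z\<close> is the squared coordinate of the line through \<open>(al s + al t) v* z\<close>, the bisector of a chamber,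
  divided by its value at the identity. Complex conjugation multiplies that value by \<open>\<zeta>\<close>.\<close>

definition lab :: "'s mat \<Rightarrow> complex" where "lab z = (if ori z then mu z else mu z * \<zeta>)"
definition lab_act :: "'s mat \<Rightarrow> complex \<Rightarrow> complex" where
  "lab_act g x = (if ori g then mu g * x else mu g * \<zeta> * cnj x)"

lemma lab_mult: assumes "z \<in> N" "g \<in> N" shows "lab (z ** g) = lab_act g (lab z)"
  using \<zeta>_norm unfolding lab_def lab_act_def act_mult[OF assms] act_def
  by (auto simp: algebra_simps)

lemma lab_one [simp]: "lab (mat 1) = 1" by (simp add: lab_def one_act)

lemma lab_act_one: "g \<in> N \<Longrightarrow> lab_act g 1 = lab g" using lab_mult[of "mat 1" g] by simp

lemma lab_R: assumes "z \<in> N" shows "lab z \<in> R"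
  using mu_root[OF assms] \<zeta>_n by (simp add: lab_def power_mult_distrib)

lemma lab_inv_iff: assumes "x \<in> N" "y \<in> N" shows "lab (x ** iv y) = 1 \<longleftrightarrow> lab x = lab y"
proof
  assume "lab (x ** iv y) = 1"
  then have "lab (x ** iv y ** y) = lab_act y 1" using lab_mult[OF N_mult[OF assms(1) N_inv[OF assms(2)]] assms(2)] by simp
  then show "lab x = lab y" using N_W[OF assms(2)] lab_act_one[OF assms(2)] by simp
next
  assume "lab x = lab y"
  then have "lab (x ** iv y) = lab (y ** iv y)" using lab_mult assms N_inv by metis
  then show "lab (x ** iv y) = 1" using N_W[OF assms(2)] by simp
qed

text \<open>The \<open>n\<close>-th roots of unity are spaced by the angle
  \<open>2 * \<theta>\<close>, so 1 is the only one at an angle below \<open>\<theta>\<close> from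
  the positive real axis.\<close>

lemma root_Re: assumes "z \<in> R" shows "Re z > cos \<theta> \<longleftrightarrow> z = 1"
proof
  assume g: "Re z > cos \<theta>"
  have "z \<in> (\<lambda>k. cis (2 * pi * real k / real n)) ` {..<n}"
    using bij_betw_imp_surj_on[OF Complex.bij_betw_roots_unity[OF n_pos]] assms by blast
  then obtain k where k: "k < n" "z = cis (2 * pi * real k / real n)" by blast
  then have z: "z = cis (2 * real k * \<theta>)" unfolding \<theta>_def by (simp add: mult.commute mult.left_commute)
  have "k = 0"
  proof (rule ccontr)
    assume "k \<noteq> 0"
    then have k1: "1 \<le> real k" "real k + 1 \<le> real n" using k by simp_all
    define \<phi> where "\<phi> = 2 * real k * \<theta>"
    have l: "\<theta> \<le> \<phi>" using k1 \<theta>_pos by (simp add: \<phi>_def)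
    have "(real k + 1) * \<theta> \<le> pi" using k1 \<theta>_pos n\<theta> mult_right_mono[of "real k + 1" "real n" \<theta>] by simp
    then have u: "\<phi> \<le> 2 * pi - \<theta>" unfolding \<phi>_def using \<theta>_pos by (simp add: algebra_simps)
    have "cos \<phi> \<le> cos \<theta>"
    proof (cases "\<phi> \<le> pi")
      case True then show ?thesis using l \<theta>_pos by (intro cos_monotone_0_pi_le) auto
    next
      case False
      have "cos \<phi> = cos (2 * pi - \<phi>)" by (simp add: cos_diff)
      also have "\<dots> \<le> cos \<theta>" using False u \<theta>_pos by (intro cos_monotone_0_pi_le) auto
      finally show ?thesis .
    qed
    then show False using g by (simp add: z \<phi>_def)
  qed
  then show "z = 1" by (simp add: z)
qed (use cos_lt1 in simp)

lemma N_row: assumes "w \<in> N" "r \<in> {s,t}" shows "al r v* w = (w $ r $ s) *\<^sub>R al s + (w $ r $ t) *\<^sub>R al t"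
  and "j \<notin> {s,t} \<Longrightarrow> w $ r $ j = 0"
proof -
  have "al r v* w \<in> P" using assms N_P by auto
  then obtain a b where ab: "al r v* w = a *\<^sub>R al s + b *\<^sub>R al t" unfolding P_def by auto
  have *: "w $ r $ j = a * (if j = s then 1 else 0) + b * (if j = t then 1 else 0)" for j
    using arg_cong[OF ab, of "\<lambda>v. v $ j"] by (simp add: al_nth)
  then show "al r v* w = (w $ r $ s) *\<^sub>R al s + (w $ r $ t) *\<^sub>R al t" using st by (simp add: ab)
  show "j \<notin> {s,t} \<Longrightarrow> w $ r $ j = 0" using * by simp
qed

text \<open>\<open>1 + \<epsilon>\<close> is the coordinate of \<open>al s + al t\<close>, which has
  the same positive product \<open>1 - cos \<theta>\<close> with both simple roots. Its product with
  a root of the plane therefore has the sign of that root.\<close>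

lemma pos_iff: assumes "w \<in> N" "r \<in> {s,t}"
  shows "(\<forall>j. w $ r $ j \<ge> 0) \<longleftrightarrow> Re (\<tau> (al r v* w) * cnj (1 + \<epsilon>)) > 0"
    "Re (\<tau> (al r v* w) * cnj (1 + \<epsilon>)) \<noteq> 0"
proof -
  define a where "a = w $ r $ s"
  define b where "b = w $ r $ t"
  have W: "w \<in> W" using assms N_W by blast
  have row: "al r v* w = a *\<^sub>R al s + b *\<^sub>R al t" using N_row(1)[OF assms] by (simp add: a_def b_def)
  have "Re (\<tau> (al r v* w) * cnj (1 + \<epsilon>)) = (1 - cos \<theta>) * (a + b)"
    unfolding row \<tau>_linear \<tau>_s \<tau>_t using cos_sin_sq1 by (simp add: \<epsilon>_def algebra_simps)
  moreover have c: "1 - cos \<theta> > 0" using cos_lt1 by simp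
  ultimately have e: "Re (\<tau> (al r v* w) * cnj (1 + \<epsilon>)) > 0 \<longleftrightarrow> a + b > 0"
     "Re (\<tau> (al r v* w) * cnj (1 + \<epsilon>)) = 0 \<longleftrightarrow> a + b = 0" by (simp_all add: zero_less_mult_iff)
  have ab: "a \<noteq> 0 \<or> b \<noteq> 0"
  proof (rule ccontr)
    assume "\<not> ?thesis"
    then have "al r v* w = 0" using row by simp
    then have "\<forall>j. w $ r $ j = 0" by (metis al_mult_nth zero_index)
    then show False using W_row_nz[OF W] by blast
  qed
  have "((\<forall>j. w $ r $ j \<ge> 0) \<longleftrightarrow> a + b > 0) \<and> a + b \<noteq> 0"
    using row_sign[OF W, of r]
  proof
    assume h: "\<forall>j. w $ r $ j \<ge> 0"
    then have "a \<ge> 0" "b \<ge> 0" unfolding a_def b_def by auto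
    then have "a + b > 0" using ab by auto
    then show ?thesis using h by auto
  next
    assume h: "\<forall>j. w $ r $ j \<le> 0"
    then have "a \<le> 0" "b \<le> 0" unfolding a_def b_def by auto
    then have "a + b < 0" using ab by auto
    moreover have "\<not> (\<forall>j. w $ r $ j \<ge> 0)" using row_sign_excl[OF W] h by blast
    ultimately show ?thesis by auto
  qed
  then show "(\<forall>j. w $ r $ j \<ge> 0) \<longleftrightarrow> Re (\<tau> (al r v* w) * cnj (1 + \<epsilon>)) > 0"
    "Re (\<tau> (al r v* w) * cnj (1 + \<epsilon>)) \<noteq> 0" using e by auto
qed

text \<open>The two rows have equal signs when the product of their pairings with
  \<open>1 + \<epsilon>\<close> is positive. This product equals
  \<open>(1 - cos \<theta>) * (Re (lab w) - cos \<theta>)\<close>, and \<open>root_Re\<close>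
  decides its sign.\<close>

lemma lab_eq_one_iff: assumes w: "w \<in> N"
  shows "((\<forall>j. w $ s $ j \<ge> 0) \<longleftrightarrow> (\<forall>j. w $ t $ j \<ge> 0)) \<longleftrightarrow> lab w = 1"
proof -
  define x where "x = Re (lam w)"
  define y where "y = Im (lam w)"
  define c where "c = cos \<theta>"
  define d where "d = sin \<theta>"
  have xy: "x * x + y * y = 1" using lam_norm(1)[OF w] by (simp add: x_def y_def complex_eq_iff)
  have cd: "c * c + d * d = 1" using cos_sin_sq1 by (simp add: c_def d_def)
  let ?A = "Re (\<tau> (al s v* w) * cnj (1 + \<epsilon>))" and ?B = "Re (\<tau> (al t v* w) * cnj (1 + \<epsilon>))"
  have A: "?A = (1 - c) * x + d * y"
    by (simp add: lam_def[symmetric] \<epsilon>_def x_def y_def c_def d_def algebra_simps)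
  have \<zeta>c: "Re \<zeta> = c * c - d * d" "Im \<zeta> = 2 * d * c"
    unfolding \<zeta>_def c_def d_def by (simp_all add: cos_double sin_double power2_eq_square)
  have AB: "?A * ?B = (1 - c) * (Re (lab w) - c)"
  proof (cases "ori w")
    case True
    have "?B = x * (1 - c) - d * y"
      unfolding act_\<tau>[OF w] using True cd
      by (simp add: act_def \<epsilon>_def x_def[symmetric] y_def[symmetric] c_def[symmetric] d_def[symmetric]) algebra
    moreover have "Re (lab w) = x * x - y * y" using True by (simp add: lab_def x_def y_def)
    ultimately show ?thesis unfolding A using xy cd by algebra
  next
    case False
    have "?B = x * (2 * c * c - c - 1) + d * y * (1 - 2 * c)"
      unfolding act_\<tau>[OF w] using False cd
      by (simp add: act_def \<epsilon>_def x_def[symmetric] y_def[symmetric] c_def[symmetric] d_def[symmetric]) algebra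
    moreover have "Re (lab w) = (x * x - y * y) * (c * c - d * d) - 2 * x * y * (2 * d * c)"
      using False by (simp add: lab_def x_def[symmetric] y_def[symmetric] \<zeta>c)
    ultimately show ?thesis unfolding A using xy cd by algebra
  qed
  have c1: "1 - c > 0" using cos_lt1 c_def by simp
  have "((\<forall>j. w $ s $ j \<ge> 0) \<longleftrightarrow> (\<forall>j. w $ t $ j \<ge> 0)) \<longleftrightarrow> (?A > 0 \<longleftrightarrow> ?B > 0)"
    using pos_iff(1)[OF w] by simp
  also have "\<dots> \<longleftrightarrow> ?A * ?B > 0" using pos_iff(2)[OF w, of s] pos_iff(2)[OF w, of t]
    by (auto simp: zero_less_mult_iff)
  also have "\<dots> \<longleftrightarrow> Re (lab w) > c" unfolding AB using c1 by (simp add: zero_less_mult_iff)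
  also have "\<dots> \<longleftrightarrow> lab w = 1" using root_Re[OF lab_R[OF w]] c_def by simp
  finally show ?thesis .
qed

lemma mLL_nz: "mLL \<noteq> 0" using mKL_diag by simp

lemma eL_N: assumes "z \<in> N"
  shows "eL m {s,t} z = ((if lab z = 1 then 1/2 else 0) - 1 / (2 * of_nat n)) / mLL"
proof -
  have "lab (iv z) = 1 \<longleftrightarrow> lab z = 1" using lab_inv_iff[of "mat 1" z] assms by auto
  then have "mLL * eL m {s,t} z = (if lab z = 1 then 1/2 else 0) - 1 / (2 * of_nat n)"
    unfolding eL_formula[OF N_W[OF assms]] lab_eq_one_iff[OF N_inv[OF assms]] by simp
  then show ?thesis using mLL_nz by (simp add: eq_divide_eq mult.commute)
qed

text \<open>By \<open>sign_mult\<close> the representative \<open>d\<close> alters neither of the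
  two signs in \<open>eL_formula\<close>.\<close>

lemma eL_left: assumes "d \<in> XJ m {s,t}" "x \<in> N" shows "eL m {s,t} (iv d ** x) = eL m {s,t} x"
proof -
  have W: "d \<in> W" "x \<in> W" "iv d ** x \<in> W" using assms N_W by (auto simp: XJ_iff WJ_mult WJ_inv)
  have i: "iv (iv d ** x) = iv x ** d" using W by (simp add: W_inv_mult WJ_inv)
  have "(\<forall>j. (iv x ** d) $ r $ j \<ge> 0) \<longleftrightarrow> (\<forall>j. iv x $ r $ j \<ge> 0)" if "r \<in> {s,t}" for r
    using N_row(2)[OF N_inv[OF assms(2)] that] W assms by (intro sign_mult) (auto simp: WJ_inv)
  then have "mLL * eL m {s,t} (iv d ** x) = mLL * eL m {s,t} x"
    unfolding eL_formula[OF W(3)] eL_formula[OF W(2)] i by simp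
  then show ?thesis using mLL_nz by simp
qed

section \<open>Labels of arbitrary group elements and the right ideal generated by
  \<open>eL\<close>\<close>

definition WL_part :: "'s mat \<Rightarrow> 's mat" where
  "WL_part z = iv (SOME u. u \<in> WL \<and> (\<exists>d\<in>XJ m {s,t}. iv z = u ** d))"

lemma WL_part: assumes "z \<in> W" shows "WL_part z \<in> WL" "\<exists>d\<in>XJ m {s,t}. z = iv d ** WL_part z"
proof -
  define u where "u = (SOME u. u \<in> WL \<and> (\<exists>d\<in>XJ m {s,t}. iv z = u ** d))"
  have "\<exists>u. u \<in> WL \<and> (\<exists>d\<in>XJ m {s,t}. iv z = u ** d)"
    using decomp_ex[of "iv z" "{s,t}"] assms WJ_inv by blast
  then have u: "u \<in> WL \<and> (\<exists>d\<in>XJ m {s,t}. iv z = u ** d)" unfolding u_def by (rule someI_ex)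
  then show "WL_part z \<in> WL" unfolding WL_part_def u_def[symmetric] by (simp add: WJ_inv)
  from u obtain d where d: "d \<in> XJ m {s,t}" "iv z = u ** d" by blast
  then have "z = iv d ** iv u" using W_inv_mult[of u d] W_inv_inv[OF assms] u WJ_sub by (auto simp: XJ_iff)
  then show "\<exists>d\<in>XJ m {s,t}. z = iv d ** WL_part z" unfolding WL_part_def u_def[symmetric] using d by blast
qed

definition coset_lab :: "'s mat \<Rightarrow> complex" where "coset_lab z = lab (WL_part z)"

text \<open>For \<open>y\<close> outside \<open>WL\<close> the chosen decomposition of
  \<open>iv d ** y\<close> uses another representative \<open>d'\<close>. The two second factors
  differ by an \<open>x\<close> in \<open>N\<close> with \<open>x ** d = d'\<close>; its rows
  \<open>s\<close> and \<open>t\<close> are nonnegative, so its label is 1.\<close>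

lemma coset_lab_N: assumes "d \<in> XJ m {s,t}" "y \<in> N" shows "coset_lab (iv d ** y) = lab y"
proof -
  have W: "d \<in> W" "y \<in> W" "iv d ** y \<in> W" using assms N_W by (auto simp: XJ_iff WJ_mult WJ_inv)
  define u where "u = WL_part (iv d ** y)"
  obtain d' where d': "d' \<in> XJ m {s,t}" "iv d ** y = iv d' ** u" using WL_part(2)[OF W(3)] u_def by auto
  have u: "u \<in> N" using WL_part(1)[OF W(3)] u_def WL_N by simp
  have d'W: "d' \<in> W" using d' by (simp add: XJ_iff)
  define x where "x = u ** iv y"
  have x: "x \<in> N" unfolding x_def using u assms N_mult N_inv by blast
  have "d' ** (iv d ** y) = u" using d'(2) d'W by simp
  then have "x ** d = d' ** (iv d ** y) ** iv y ** d" by (simp add: x_def)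
  also have "\<dots> = d'" using W by (simp add: matrix_mul_assoc)
  finally have xd: "x ** d = d'" .
  have "\<forall>j. x $ r $ j \<ge> 0" if "r \<in> {s,t}" for r
  proof -
    have "(\<forall>j. (x ** d) $ r $ j \<ge> 0) \<longleftrightarrow> (\<forall>j. x $ r $ j \<ge> 0)"
      using N_row(2)[OF x that] N_W[OF x] assms by (intro sign_mult) auto
    then show ?thesis using d'(1) that unfolding xd XJ_iff by blast
  qed
  then have "lab x = 1" using lab_eq_one_iff[OF x] by simp
  then have "lab u = lab y" unfolding x_def using lab_inv_iff[OF u assms(2)] by simp
  then show ?thesis by (simp add: coset_lab_def u_def)
qed

lemma one_X: "mat 1 \<in> XJ m {s,t}" using one_XJsharp[of "{s,t}"] by (simp add: XJsharp_def)

lemma coset_lab_of_N: "y \<in> N \<Longrightarrow> coset_lab y = lab y" using coset_lab_N[OF one_X, of y] by simp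

lemma coset_lab_R: "z \<in> W \<Longrightarrow> coset_lab z \<in> R" unfolding coset_lab_def using lab_R WL_N WL_part(1) by blast

definition lab_lift :: "(complex \<Rightarrow> complex) \<Rightarrow> 's mat \<Rightarrow> complex" where
  "lab_lift h z = (if z \<in> W then h (coset_lab z) else 0)"

lemma lab_lift_cong: "(\<And>x. x \<in> R \<Longrightarrow> h x = h' x) \<Longrightarrow> lab_lift h = lab_lift h'"
  unfolding lab_lift_def using coset_lab_R by fastforce

text \<open>The value of \<open>eL\<close> at \<open>z ** iv y\<close> depends only on whether
  \<open>y\<close> and the \<open>WL\<close>-part of \<open>z\<close> have equal labels, so
  convolution sees \<open>a\<close> only through its sums over the fibres of
  \<open>lab\<close>.\<close>

lemma conv_eL_lab_lift: assumes "\<forall>z. z \<notin> WL \<longrightarrow> a z = 0"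
  shows "conv m (eL m {s,t}) a =
    lab_lift (\<lambda>x. ((\<Sum>y\<in>{y\<in>WL. lab y = x}. a y) / 2 - (\<Sum>y\<in>WL. a y) / (2 * of_nat n)) / mLL)"
proof
  fix z
  show "conv m (eL m {s,t}) a z =
    lab_lift (\<lambda>x. ((\<Sum>y\<in>{y\<in>WL. lab y = x}. a y) / 2 - (\<Sum>y\<in>WL. a y) / (2 * of_nat n)) / mLL) z"
  proof (cases "z \<in> W")
    case True
    define u where "u = WL_part z"
    obtain d where d: "d \<in> XJ m {s,t}" "z = iv d ** u" using WL_part(2)[OF True] u_def by auto
    have u: "u \<in> N" using WL_part(1)[OF True] u_def WL_N by simp
    have WLW: "WL \<subseteq> W" using WJ_sub by blast
    have "conv m (eL m {s,t}) a z = (\<Sum>y\<in>WL. eL m {s,t} (z ** iv y) * a y)"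
      unfolding conv_W[OF True] using assms WLW finW by (intro sum.mono_neutral_right) auto
    also have "\<dots> = (\<Sum>y\<in>WL. ((if lab y = lab u then a y else 0) / 2 - a y / (2 * of_nat n)) / mLL)"
    proof (rule sum.cong)
      fix y assume y: "y \<in> WL"
      have "z ** iv y = iv d ** (u ** iv y)" unfolding d(2) by (simp add: matrix_mul_assoc)
      moreover have "u ** iv y \<in> N" using u y WL_N N_mult N_inv by blast
      ultimately have "eL m {s,t} (z ** iv y) = ((if lab u = lab y then 1/2 else 0) - 1 / (2 * of_nat n)) / mLL"
        using eL_left[OF d(1)] eL_N lab_inv_iff[OF u WL_N[OF y]] by simp
      then show "eL m {s,t} (z ** iv y) * a y = ((if lab y = lab u then a y else 0) / 2 - a y / (2 * of_nat n)) / mLL"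
        by (auto simp: left_diff_distrib)
    qed simp
    also have "\<dots> = ((\<Sum>y\<in>WL. if lab y = lab u then a y else 0) / 2 - (\<Sum>y\<in>WL. a y) / (2 * of_nat n)) / mLL"
      by (simp add: sum_subtractf flip: sum_divide_distrib)
    also have "(\<Sum>y\<in>WL. if lab y = lab u then a y else 0) = (\<Sum>y\<in>{y\<in>WL. lab y = lab u}. a y)"
      by (rule sum.inter_filter[symmetric]) (rule fin_sub[OF WLW])
    finally show ?thesis using True by (simp add: lab_lift_def coset_lab_def u_def)
  qed (simp add: conv_notW lab_lift_def)
qed

text \<open>Rotations supply the even powers of \<open>\<zeta>\<close>; reflections, through the
  extra factor in \<open>lab\<close>, the odd ones.\<close>

lemma lab_surj: assumes "x \<in> R" shows "\<exists>w\<in>WL. lab w = x"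
proof -
  have "x \<in> (\<lambda>k. cis (2 * pi * real k / real n)) ` {..<n}"
    using bij_betw_imp_surj_on[OF Complex.bij_betw_roots_unity[OF n_pos]] assms by blast
  then obtain k where "x = cis (2 * pi * real k / real n)" by blast
  then have "x = cis (real k * (2 * \<theta>))" unfolding \<theta>_def by (simp add: mult_ac)
  then have x: "x = \<zeta> ^ k" unfolding \<zeta>_def by (simp add: Complex.DeMoivre)
  have r: "(\<zeta> ^ j) ^ n = 1" for j using \<zeta>_n by (metis power_mult mult.commute power_one)
  show ?thesis
  proof (cases "even k")
    case True
    then obtain j where j: "k = j + j" by (metis evenE mult_2)
    obtain w where w: "w \<in> WL" "ori w = True" "ulam w = \<zeta> ^ j" using WL_ex[OF r] by blast
    then have "lab w = \<zeta> ^ j * \<zeta> ^ j" by (simp add: lab_def ulam_def)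
    then show ?thesis using w x j by (auto simp: power_add)
  next
    case False
    then obtain j where j: "k = j + j + 1" by (metis oddE mult_2)
    obtain w where w: "w \<in> WL" "ori w = False" "ulam w = \<zeta> ^ j" using WL_ex[OF r] by blast
    then have "lam w = - (\<zeta> ^ j)" by (simp add: ulam_def) (metis minus_minus)
    then have "lab w = \<zeta> ^ j * \<zeta> ^ j * \<zeta>" using w by (simp add: lab_def)
    then show ?thesis using w x j by (auto simp: power_add mult_ac)
  qed
qed

lemma eL_ideal_eq: "{conv m (eL m {s,t}) a | a. \<forall>z. z \<notin> WL \<longrightarrow> a z = 0} = {lab_lift h | h. (\<Sum>x\<in>R. h x) = 0}"
proof (intro set_eqI iffI)
  fix f assume "f \<in> {conv m (eL m {s,t}) a | a. \<forall>z. z \<notin> WL \<longrightarrow> a z = 0}"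
  then obtain a where a: "\<forall>z. z \<notin> WL \<longrightarrow> a z = 0" "f = conv m (eL m {s,t}) a" by blast
  let ?h = "\<lambda>x. ((\<Sum>y\<in>{y\<in>WL. lab y = x}. a y) / 2 - (\<Sum>y\<in>WL. a y) / (2 * of_nat n)) / mLL"
  have fWL: "finite WL" using WJ_sub by (intro fin_sub) blast
  have "(\<Sum>x\<in>R. \<Sum>y\<in>{y\<in>WL. lab y = x}. a y) = (\<Sum>y\<in>WL. a y)"
    by (rule sum.group) (use fWL card_roots lab_R WL_N in auto)
  then have "(\<Sum>x\<in>R. ?h x) = 0"
    using card_roots by (simp flip: sum_divide_distrib add: sum_subtractf)
  then show "f \<in> {lab_lift h | h. (\<Sum>x\<in>R. h x) = 0}" using conv_eL_lab_lift[OF a(1)] a(2) by blast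
next
  fix f assume "f \<in> {lab_lift h | h. (\<Sum>x\<in>R. h x) = 0}"
  then obtain h where h: "(\<Sum>x\<in>R. h x) = 0" "f = lab_lift h" by blast
  obtain sec where sec: "\<And>x. x \<in> R \<Longrightarrow> sec x \<in> WL \<and> lab (sec x) = x" using lab_surj by metis
  \<comment> \<open>Supported on one element of each fibre of \<open>lab\<close>; the factor
    \<open>2 * mLL\<close> cancels the denominators in \<open>conv_eL_lab_lift\<close>, and the term
    with the total sum of \<open>a\<close> vanishes because \<open>h\<close> has sum zero.\<close>
  define a where "a y = (if y \<in> WL \<and> y = sec (lab y) then 2 * mLL * h (lab y) else 0)" for y
  have a0: "\<forall>z. z \<notin> WL \<longrightarrow> a z = 0" by (simp add: a_def)
  have fWL: "finite WL" using WJ_sub by (intro fin_sub) blast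
  have ax: "(\<Sum>y\<in>{y\<in>WL. lab y = x}. a y) = 2 * mLL * h x" if "x \<in> R" for x
  proof -
    have "(\<Sum>y\<in>{y\<in>WL. lab y = x}. a y) = (\<Sum>y\<in>{sec x}. a y)"
      by (rule sum.mono_neutral_right) (use fWL sec[OF that] in \<open>auto simp: a_def\<close>)
    then show ?thesis using sec[OF that] by (simp add: a_def)
  qed
  have "(\<Sum>y\<in>WL. a y) = (\<Sum>x\<in>R. \<Sum>y\<in>{y\<in>WL. lab y = x}. a y)"
    by (rule sum.group[symmetric]) (use fWL card_roots lab_R WL_N in auto)
  also have "\<dots> = (\<Sum>x\<in>R. 2 * mLL * h x)" by (rule sum.cong) (simp_all add: ax)
  also have "\<dots> = 0" using h by (simp flip: sum_distrib_left)
  finally have as: "(\<Sum>y\<in>WL. a y) = 0" .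
  have "conv m (eL m {s,t}) a = lab_lift h"
    unfolding conv_eL_lab_lift[OF a0] as by (rule lab_lift_cong) (use ax mLL_nz in simp)
  then show "f \<in> {conv m (eL m {s,t}) a | a. \<forall>z. z \<notin> WL \<longrightarrow> a z = 0}"
    unfolding h(2) using a0 by (intro CollectI exI[of _ a]) simp
qed

lemma lab_act_R: assumes "g \<in> N" "x \<in> R" shows "lab_act g x \<in> R"
  using lab_surj[OF assms(2)] lab_mult[OF WL_N assms(1)] lab_R N_mult WL_N assms(1) by metis

lemma lab_act_inv: assumes "g \<in> N" "x \<in> R" shows "lab_act g (lab_act (iv g) x) = x" "lab_act (iv g) (lab_act g x) = x"
proof -
  obtain w where w: "w \<in> WL" "lab w = x" using lab_surj[OF assms(2)] by blast
  have "lab_act g (lab_act (iv g) x) = lab (w ** iv g ** g)" "lab_act (iv g) (lab_act g x) = lab (w ** g ** iv g)"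
    unfolding w(2)[symmetric] using w assms WL_N N_inv N_mult by (simp_all add: lab_mult)
  then show "lab_act g (lab_act (iv g) x) = x" "lab_act (iv g) (lab_act g x) = x" using w N_W[OF assms(1)] by simp_all
qed

lemma conv_lab_lift_delta: assumes "g \<in> N" shows "conv m (lab_lift h) (delta g) = lab_lift (\<lambda>x. h (lab_act (iv g) x))"
proof
  fix z
  show "conv m (lab_lift h) (delta g) z = lab_lift (\<lambda>x. h (lab_act (iv g) x)) z"
  proof (cases "z \<in> W")
    case True
    have gW: "g \<in> W" "z ** iv g \<in> W" using assms N_W True by (auto intro: WJ_mult WJ_inv)
    have "conv m (lab_lift h) (delta g) z = (\<Sum>y\<in>W. if y = g then lab_lift h (z ** iv y) else 0)"
      unfolding conv_W[OF True] delta_def by (rule sum.cong) auto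
    also have "\<dots> = lab_lift h (z ** iv g)" using gW finW by simp
    also have "\<dots> = h (coset_lab (z ** iv g))" using gW by (simp add: lab_lift_def)
    also have "coset_lab (z ** iv g) = lab_act (iv g) (coset_lab z)"
    proof -
      obtain d where d: "d \<in> XJ m {s,t}" "z = iv d ** WL_part z" using WL_part(2)[OF True] by auto
      have u: "WL_part z \<in> N" using WL_part(1)[OF True] WL_N by simp
      have "z ** iv g = iv d ** (WL_part z ** iv g)" using d(2) by (simp add: matrix_mul_assoc)
      then have "coset_lab (z ** iv g) = lab (WL_part z ** iv g)" using coset_lab_N[OF d(1)] N_mult[OF u N_inv[OF assms]] by simp
      then show ?thesis using lab_mult[OF u N_inv[OF assms]] by (simp add: coset_lab_def)
    qed
    finally show ?thesis using True by (simp add: lab_lift_def[of _ z])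
  qed (simp add: conv_notW lab_lift_def)
qed

theorem PhiT_eq: assumes g: "g \<in> N"
  shows "PhiT m {s,t} g = of_nat (card {x\<in>R. lab_act g x = x}) - 1"
proof -
  obtain sec where sec: "\<And>x. x \<in> R \<Longrightarrow> sec x \<in> WL \<and> lab (sec x) = x" using lab_surj by metis
  have FFsec: "lab_lift h (sec x) = h x" if "x \<in> R" for h x
    using sec[OF that] WJ_sub WL_N coset_lab_of_N by (auto simp: lab_lift_def)
  have "trace_mod {lab_lift h | h. (\<Sum>x\<in>R. h x) = 0} {\<lambda>_. 0} (\<lambda>f. conv m f (delta g)) =
     of_nat (card {x\<in>R. lab_act (iv g) x = x}) - 1"
  \<comment> \<open>The points are the labels, and \<open>D\<close> evaluates a function at a chosen
    representative of each. Right multiplication by \<open>g\<close> permutes labels by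
    \<open>iv g\<close>, which has the same fixed points as \<open>g\<close>.\<close>
  proof (rule trace_mod_perm[where D = "\<lambda>f x. f (sec x)" and ?q0.0 = 1])
    fix k :: nat and a :: "nat \<Rightarrow> complex" and b assume "\<forall>i<k. b i \<in> {lab_lift h | h. (\<Sum>x\<in>R. h x) = 0}"
    then have "\<forall>i. \<exists>h. i < k \<longrightarrow> b i = lab_lift h \<and> (\<Sum>x\<in>R. h x) = 0" by blast
    then obtain h where h: "\<And>i. i < k \<Longrightarrow> b i = lab_lift (h i) \<and> (\<Sum>x\<in>R. h i x) = 0" by metis
    have "lincomb k a b = lab_lift (\<lambda>x. \<Sum>i<k. a i * h i x)"
      unfolding lincomb_def lab_lift_def fun_eq_iff by (auto simp: h lab_lift_def)
    moreover have "(\<Sum>x\<in>R. \<Sum>i<k. a i * h i x) = (\<Sum>i<k. a i * (\<Sum>x\<in>R. h i x))"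
      by (subst sum.swap) (simp add: sum_distrib_left)
    then have "(\<Sum>x\<in>R. \<Sum>i<k. a i * h i x) = 0" using h by simp
    ultimately show "lincomb k a b \<in> {lab_lift h | h. (\<Sum>x\<in>R. h x) = 0}" by blast
  next
    fix f assume "f \<in> {lab_lift h | h. (\<Sum>x\<in>R. h x) = 0}"
    then obtain h where h: "f = lab_lift h" "(\<Sum>x\<in>R. h x) = 0" by blast
    show "(f \<in> {\<lambda>_. 0}) = (\<forall>x\<in>R. f (sec x) = 0)"
    proof
      assume "\<forall>x\<in>R. f (sec x) = 0"
      then have "\<forall>x\<in>R. h x = 0" unfolding h(1) by (auto simp: FFsec)
      then have "lab_lift h = lab_lift (\<lambda>_. 0)" by (intro lab_lift_cong) auto
      then show "f \<in> {\<lambda>_. 0}" unfolding h(1) by (auto simp: lab_lift_def fun_eq_iff)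
    qed simp
    show "(\<Sum>x\<in>R. f (sec x)) = 0" unfolding h(1) using h(2) by (simp add: FFsec)
    have "bij_betw (lab_act (iv g)) R R"
      by (rule bij_betw_byWitness[where f' = "lab_act g"]) (use lab_act_inv[OF g] lab_act_R[OF g] lab_act_R[OF N_inv[OF g]] in auto)
    then have "(\<Sum>x\<in>R. h (lab_act (iv g) x)) = 0" using h(2) sum.reindex_bij_betw by metis
    then show "conv m f (delta g) \<in> {lab_lift h | h. (\<Sum>x\<in>R. h x) = 0}" unfolding h(1) conv_lab_lift_delta[OF g] by blast
    fix x assume x: "x \<in> R"
    show "conv m f (delta g) (sec x) = f (sec (lab_act (iv g) x))"
      unfolding h(1) conv_lab_lift_delta[OF g] using x lab_act_R[OF N_inv[OF g] x] by (simp only: FFsec)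
  next
    fix h :: "complex \<Rightarrow> complex" assume "(\<Sum>x\<in>R. h x) = 0"
    then show "\<exists>f\<in>{lab_lift h | h. (\<Sum>x\<in>R. h x) = 0}. \<forall>x\<in>R. f (sec x) = h x"
      by (intro bexI[of _ "lab_lift h"]) (auto simp: FFsec)
  qed (use card_roots lab_act_R[OF N_inv[OF g]] in \<open>auto simp: lincomb_def\<close>)
  moreover have "{x\<in>R. lab_act (iv g) x = x} = {x\<in>R. lab_act g x = x}"
    using lab_act_inv[OF g] by (metis (lifting))
  ultimately show ?thesis unfolding PhiT_def eL_ideal_eq by simp
qed

end

section \<open>The character \<open>PsiT\<close>\<close>

lemma lin_span_base: "f \<in> B \<Longrightarrow> f \<in> lin_span B"
proof -
  assume "f \<in> B"
  moreover have "f = lincomb 1 (\<lambda>_. 1) (\<lambda>_. f)" by (simp add: lincomb_def)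
  ultimately show ?thesis unfolding lin_span_def by (intro CollectI exI[of _ 1] exI[of _ "\<lambda>_. 1"] exI[of _ "\<lambda>_. f"]) auto
qed

lemma lin_span_scale: assumes "f \<in> lin_span B" shows "(\<lambda>x. c * f x) \<in> lin_span B"
proof -
  obtain n a b where f: "f = lincomb n a b" "\<forall>i<n. b i \<in> B" using assms unfolding lin_span_def by blast
  then have "(\<lambda>x. c * f x) = lincomb n (\<lambda>i. c * a i) b" by (simp add: lincomb_def sum_distrib_left mult.assoc)
  then show ?thesis unfolding lin_span_def using f(2) by blast
qed

lemma lin_span_add: assumes "f \<in> lin_span B" "g \<in> lin_span B" shows "(\<lambda>x. f x + g x) \<in> lin_span B"
proof -
  obtain n a b where f: "f = lincomb n a b" "\<forall>i<n. b i \<in> B" using assms(1) unfolding lin_span_def by blast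
  obtain n' a' b' where g: "g = lincomb n' a' b'" "\<forall>i<n'. b' i \<in> B" using assms(2) unfolding lin_span_def by blast
  define a'' where "a'' i = (if i < n then a i else a' (i - n))" for i
  define b'' where "b'' i = (if i < n then b i else b' (i - n))" for i
  have "(\<Sum>i<n + n'. a'' i * b'' i x) = f x + g x" for x
  proof -
    have "(\<Sum>i<k. a'' (n + i) * b'' (n + i) x) = (\<Sum>i<k. a' i * b' i x)" for k by (simp add: a''_def b''_def)
    moreover have "(\<Sum>i<n. a'' i * b'' i x) = f x" by (simp add: a''_def b''_def f lincomb_def)
    moreover have "(\<Sum>i<n + k. a'' i * b'' i x) = (\<Sum>i<n. a'' i * b'' i x) + (\<Sum>i<k. a'' (n + i) * b'' (n + i) x)" for k
      by (induction k) (simp_all add: add.assoc)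
    ultimately show ?thesis by (simp add: g lincomb_def)
  qed
  then have "(\<lambda>x. f x + g x) = lincomb (n + n') a'' b''" by (simp add: lincomb_def)
  moreover have "\<forall>i<n + n'. b'' i \<in> B" using f(2) g(2) by (auto simp: b''_def)
  ultimately show ?thesis unfolding lin_span_def by blast
qed

lemma lin_span_lincomb: "(\<forall>i<n. b i \<in> lin_span B) \<Longrightarrow> lincomb n a b \<in> lin_span B"
proof (induction n)
  case 0
  have "lincomb 0 a b = lincomb 0 a (\<lambda>_. undefined)" by (simp add: lincomb_def)
  then show ?case unfolding lin_span_def by blast
next
  case (Suc n)
  have "lincomb (Suc n) a b = (\<lambda>x. lincomb n a b x + a n * b n x)" by (simp add: lincomb_def)
  then show ?case using Suc by (auto intro!: lin_span_add lin_span_scale)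
qed

lemma lin_span_sum: assumes "finite A" "\<And>t. t \<in> A \<Longrightarrow> f t \<in> lin_span B"
  shows "(\<lambda>x. \<Sum>t\<in>A. c t * f t x) \<in> lin_span B"
  using assms
proof (induction A rule: finite_induct)
  case empty
  then show ?case using lin_span_lincomb[of 0 _ B] by (simp add: lincomb_def)
next
  case (insert t A)
  then have "(\<lambda>x. c t * f t x + (\<Sum>t\<in>A. c t * f t x)) \<in> lin_span B"
    by (intro lin_span_add lin_span_scale) auto
  then show ?case using insert by simp
qed

lemma fa_mult_mono_left: "fa_mult (mono u) r w = (if take (length u) w = u then r (drop (length u) w) else 0)"
proof -
  have "fa_mult (mono u) r w = (\<Sum>k\<le>length w. if k = length u then (if take k w = u then r (drop k w) else 0) else 0)"
    unfolding fa_mult_def mono_def by (rule sum.cong) auto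
  also have "\<dots> = (if take (length u) w = u then r (drop (length u) w) else 0)"
  proof (cases "length u \<le> length w")
    case False
    then have "take (length u) w \<noteq> u" by auto
    then show ?thesis using False by simp
  qed simp
  finally show ?thesis .
qed

lemma fa_mult_mono_right: "fa_mult f (mono v) w =
   (if drop (length w - length v) w = v then f (take (length w - length v) w) else 0)"
proof -
  have "fa_mult f (mono v) w = (\<Sum>k\<le>length w. if k = length w - length v then (if drop k w = v then f (take k w) else 0) else 0)"
    unfolding fa_mult_def mono_def by (rule sum.cong) auto
  then show ?thesis by simp
qed

text \<open>Used for degrees: with \<open>u\<close> or \<open>v\<close> nonempty, a product
  contributes to words of length two only through values of \<open>r\<close> at shorter
  words.\<close>

lemma fa_mult_sandwich: "fa_mult (fa_mult (mono u) r) (mono v) w = 0 \<or>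
   (\<exists>w'. w = u @ w' @ v \<and> fa_mult (fa_mult (mono u) r) (mono v) w = r w')"
proof (cases "drop (length w - length v) w = v \<and> take (length u) (take (length w - length v) w) = u")
  case True
  define w1 where "w1 = take (length w - length v) w"
  have "w = w1 @ v" using True append_take_drop_id[of "length w - length v" w] unfolding w1_def by simp
  moreover have "w1 = u @ drop (length u) w1" using True append_take_drop_id[of "length u" w1] unfolding w1_def by simp
  ultimately have "w = u @ drop (length u) w1 @ v" by (metis append_assoc)
  moreover have "fa_mult (fa_mult (mono u) r) (mono v) w = r (drop (length u) w1)"
    unfolding fa_mult_mono_left fa_mult_mono_right w1_def using True by simp
  ultimately show ?thesis by blast
next
  case False
  then show ?thesis unfolding fa_mult_mono_left fa_mult_mono_right by auto
qed

lemma fa_mult_nil: "fa_mult (fa_mult (mono []) r) (mono []) = r"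
  by (rule ext) (simp add: fa_mult_mono_left fa_mult_mono_right)

text \<open>The coefficients are the cross product of the two triples. If it vanishes, the first two
  pairs are already dependent.\<close>

lemma real_dep3: fixes a0 a1 a2 b0 b1 b2 :: real
  shows "\<exists>c0 c1 c2. (c0 \<noteq> 0 \<or> c1 \<noteq> 0 \<or> c2 \<noteq> 0) \<and> c0 * a0 + c1 * a1 + c2 * a2 = 0 \<and> c0 * b0 + c1 * b1 + c2 * b2 = 0"
proof (cases "a1 * b2 - a2 * b1 \<noteq> 0 \<or> a2 * b0 - a0 * b2 \<noteq> 0 \<or> a0 * b1 - a1 * b0 \<noteq> 0")
  case True
  then show ?thesis
    by (intro exI[of _ "a1 * b2 - a2 * b1"] exI[of _ "a2 * b0 - a0 * b2"] exI[of _ "a0 * b1 - a1 * b0"])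
      (auto simp: algebra_simps)
next
  case False
  then have e: "a0 * b1 = a1 * b0" by simp
  show ?thesis
  proof (cases "a0 = 0")
    case True
    show ?thesis
    proof (cases "b0 = 0")
      case True then show ?thesis using \<open>a0 = 0\<close> by (intro exI[of _ 1] exI[of _ 0]) auto
    next
      case False
      then have "b1 * a0 + - b0 * a1 + 0 * a2 = 0 \<and> b1 * b0 + - b0 * b1 + 0 * b2 = 0" using e by (simp add: mult.commute)
      then show ?thesis using False by (intro exI[of _ b1] exI[of _ "-b0"] exI[of _ 0]) simp
    qed
  next
    case False
    have "a1 * a0 + - a0 * a1 + 0 * a2 = 0 \<and> a1 * b0 + - a0 * b1 + 0 * b2 = 0" using e by (simp add: mult.commute)
    then show ?thesis using False by (intro exI[of _ a1] exI[of _ "-a0"] exI[of _ 0]) simp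
  qed
qed

context finite_coxeter
begin

lemma refl_root: assumes "x \<in> refls m"
  shows "x \<in> W" "det x = -1" "\<exists>\<beta>. B \<beta> \<beta> = 1 \<and> (\<forall>v. v v* x = v - (2 * B v \<beta>) *\<^sub>R \<beta>)"
proof -
  obtain r w where w: "w \<in> W" "x = iv w ** \<sigma> r ** w" using assms unfolding refls_def conj_def by auto
  then show "x \<in> W" by (auto intro!: WJ_mult WJ_inv)
  have "det (iv w) * det w = 1" using W_inv(2)[OF w(1)] det_mul[of "iv w" w] by simp
  then show "det x = -1" unfolding w(2) det_mul det_sref by simp
  show "\<exists>\<beta>. B \<beta> \<beta> = 1 \<and> (\<forall>v. v v* x = v - (2 * B v \<beta>) *\<^sub>R \<beta>)"
    using conj_act[OF w(1)] root_norm[OF w(1)] w(2) by blast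
qed

lemma Hyp_root: assumes "B \<beta> \<beta> = 1" "\<forall>v. v v* x = v - (2 * B v \<beta>) *\<^sub>R \<beta>"
  shows "v \<in> Hyp x \<longleftrightarrow> B v \<beta> = 0"
proof -
  have "\<beta> \<noteq> 0" using assms(1) by auto
  then show ?thesis unfolding Hyp_def using assms(2) by simp
qed

text \<open>The hyperplane determines the functional \<open>B _ \<beta>\<close> up to a factor,
  hence by nondegeneracy the root up to a factor. Normalized roots then agree up to sign and define
  the same reflection.\<close>

lemma Hyp_inj: assumes "x \<in> refls m" "y \<in> refls m" "Hyp x = Hyp y" shows "x = y"
proof -
  obtain \<beta> where \<beta>: "B \<beta> \<beta> = 1" "\<forall>v. v v* x = v - (2 * B v \<beta>) *\<^sub>R \<beta>" using refl_root[OF assms(1)] by blast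
  obtain \<gamma> where \<gamma>: "B \<gamma> \<gamma> = 1" "\<forall>v. v v* y = v - (2 * B v \<gamma>) *\<^sub>R \<gamma>" using refl_root[OF assms(2)] by blast
  define e where "e = B \<beta> \<gamma>"
  have "B v \<gamma> = B v \<beta> * e" for v
  proof -
    have "v - B v \<beta> *\<^sub>R \<beta> \<in> Hyp x" unfolding Hyp_root[OF \<beta>] by (simp add: Bform_linear \<beta>)
    then have "B (v - B v \<beta> *\<^sub>R \<beta>) \<gamma> = 0" unfolding assms(3) Hyp_root[OF \<gamma>] .
    then show ?thesis by (simp add: Bform_linear e_def)
  qed
  then have "B (\<gamma> - e *\<^sub>R \<beta>) (al r) = 0" for r by (simp add: Bform_linear B_sym[of _ "al r"] mult.commute)
  then have g: "\<gamma> = e *\<^sub>R \<beta>" using B_nondegenerate[of "\<gamma> - e *\<^sub>R \<beta>"] by simp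
  then have ee: "e * e = 1" using \<gamma>(1) \<beta>(1) by (simp add: Bform_linear)
  show ?thesis
  proof (rule matrix_eqI_rows)
    fix v
    have "(2 * B v (e *\<^sub>R \<beta>)) *\<^sub>R (e *\<^sub>R \<beta>) = (2 * B v \<beta> * (e * e)) *\<^sub>R \<beta>" by (simp add: Bform_linear mult_ac)
    then have "(2 * B v \<gamma>) *\<^sub>R \<gamma> = (2 * B v \<beta>) *\<^sub>R \<beta>" unfolding g ee by simp
    then show "v v* x = v v* y" unfolding \<beta>(2)[rule_format] \<gamma>(2)[rule_format] by simp
  qed
qed

text \<open>The dependence in \<open>hyp_dep\<close> is stated with normals for the standard inner
  product, whereas roots are normals for \<open>B\<close>; this translates one into the
  other.\<close>

definition nvec :: "real^'s \<Rightarrow> real^'s" where "nvec \<beta> = (\<chi> r. B (al r) \<beta>)"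

lemma nvec_inner: "nvec \<beta> \<bullet> v = B v \<beta>"
proof -
  have "linear (\<lambda>v. B v \<beta>)" by (rule linearI) (simp_all add: Bform_linear)
  then have "B (\<Sum>r\<in>UNIV. (v $ r) *\<^sub>R al r) \<beta> = (\<Sum>r\<in>UNIV. v $ r * B (al r) \<beta>)"
    using linear_sum[of "\<lambda>v. B v \<beta>" "\<lambda>r. (v $ r) *\<^sub>R al r" UNIV] by (simp add: Bform_scale_left)
  then have "B v \<beta> = (\<Sum>r\<in>UNIV. v $ r * B (al r) \<beta>)"
    using arg_cong[OF al_expand[of v], of "\<lambda>v. B v \<beta>"] by (rule trans[rotated])
  then show ?thesis by (simp add: nvec_def inner_vec_def mult.commute)
qed

lemma hyp_dep_parallel:
  fixes f f' :: "real^'s"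
  assumes "f \<noteq> 0" "f' \<noteq> 0" "c *\<^sub>R f + c' *\<^sub>R f' = 0" "c \<noteq> 0 \<or> c' \<noteq> 0"
  shows "{v. f \<bullet> v = 0} = {v. f' \<bullet> v = 0}"
proof -
  have "c \<noteq> 0 \<and> c' \<noteq> 0" using assms by auto
  moreover have "c * (f \<bullet> v) + c' * (f' \<bullet> v) = 0" for v
    using arg_cong[OF assms(3), of "\<lambda>x. x \<bullet> v"] by (simp add: inner_add_left)
  ultimately show ?thesis by (metis (mono_tags, lifting) add.left_neutral add.right_neutral mult_eq_0_iff)
qed

end

context finite_rank2
begin

definition TL :: "'s mat set" where "TL = {x \<in> refls m. X \<subseteq> Hyp x}"

lemma conj_refls: "w \<in> W \<Longrightarrow> iv w ** \<sigma> r ** w \<in> refls m"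
  unfolding refls_def conj_def by blast

text \<open>A reflection fixing \<open>X\<close> lies in \<open>WL\<close> by
  \<open>Fix_stabilizer\<close> and reverses the plane because its determinant is -1. Conversely,
  each reversing element of \<open>WL\<close> is conjugate in \<open>WL\<close> to
  \<open>\<sigma> s\<close> or \<open>\<sigma> t\<close>.\<close>

lemma TL_eq: "TL = {w \<in> WL. \<not> ori w}"
proof (intro set_eqI iffI)
  fix x assume x: "x \<in> TL"
  then have "x \<in> refls m" "\<forall>v\<in>X. v v* x = v" unfolding TL_def Hyp_def by auto
  then have "x \<in> WL" "det x = -1" using Fix_stabilizer refl_root by auto
  then show "x \<in> {w \<in> WL. \<not> ori w}" using WL_det by (auto split: if_splits)
next
  fix w assume "w \<in> {w \<in> WL. \<not> ori w}"
  then have w: "w \<in> WL" "\<not> ori w" by auto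
  have "- lam w \<in> R" using WL_ulam[OF w(1)] w(2) by (simp add: ulam_def)
  \<comment> \<open>With this label, conjugation by \<open>g\<close> gives the coordinate of
    \<open>w\<close> to \<open>\<sigma> s\<close> if \<open>g\<close> is a rotation and to
    \<open>\<sigma> t\<close> if it is a reflection; the factor \<open>\<zeta>\<close> in
    \<open>lab\<close> matches the coordinate of \<open>\<sigma> t\<close>.\<close>
  then obtain g where g: "g \<in> WL" "lab g = - lam w" using lab_surj by blast
  have gN: "g \<in> N" and gW: "g \<in> W" using g WL_N WJ_sub by auto
  have st: "\<sigma> s \<in> WL" "\<sigma> t \<in> WL" by (simp_all add: sref_WJ)
  have "\<exists>r. w = iv g ** \<sigma> r ** g"
  proof (cases "ori g")
    case True
    have "w = iv g ** \<sigma> s ** g"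
      by (rule WL_unique) (use True w g N_conj(2)[OF gN] st \<sigma>_act in \<open>auto simp: lam_conj[OF gN] lab_def\<close>)
    then show ?thesis by blast
  next
    case False
    have "w = iv g ** \<sigma> t ** g"
      by (rule WL_unique) (use False w g N_conj(2)[OF gN] st \<sigma>_act in \<open>auto simp: lam_conj[OF gN] lab_def\<close>)
    then show ?thesis by blast
  qed
  then have "w \<in> refls m" using conj_refls[OF gW] by auto
  moreover have "X \<subseteq> Hyp w" using w(1) unfolding Fix_def Hyp_def by auto
  ultimately show "w \<in> TL" unfolding TL_def by simp
qed

lemma finite_TL: "finite TL" using TL_eq WJ_sub by (intro fin_sub) auto

lemma sref_s_TL: "\<sigma> s \<in> TL" unfolding TL_eq using \<sigma>_act by (simp add: sref_WJ)

lemma TL_Hyp_Int: assumes "a \<in> TL" "b \<in> TL" "a \<noteq> b" shows "Hyp a \<inter> Hyp b = X"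
proof
  show "X \<subseteq> Hyp a \<inter> Hyp b" using assms unfolding TL_def by auto
  show "Hyp a \<inter> Hyp b \<subseteq> X"
  proof
    fix v assume "v \<in> Hyp a \<inter> Hyp b"
    then have "v v* a = v" "v v* b = v" unfolding Hyp_def by auto
    then have "\<tau> v = lam a * cnj (\<tau> v)" "\<tau> v = lam b * cnj (\<tau> v)"
      using assms act_\<tau>[OF WL_N, of a v] act_\<tau>[OF WL_N, of b v] by (auto simp: TL_eq act_def)
    moreover have "lam a \<noteq> lam b" using assms WL_unique unfolding TL_eq by blast
    ultimately have "\<tau> v = 0" by (metis complex_cnj_zero_iff mult_cancel_right)
    then show "v \<in> X" by (simp add: X_iff)
  qed
qed

text \<open>A reflection is not cuspidal, so it fixes a nonzero vector of \<open>P\<close>, which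
  lies outside \<open>X\<close>. This excludes repeated letters in the generators of
  \<open>AX_lift\<close>.\<close>

lemma TL_Hyp_neq: assumes "a \<in> TL" shows "Hyp a \<noteq> X"
proof
  assume h: "Hyp a = X"
  have "\<not> cuspidal m {s,t} a" using assms unfolding TL_eq cuspidal_iff by simp
  moreover have "a \<in> WL" using assms TL_eq by auto
  ultimately obtain v where v: "v \<in> P" "v v* a = v" "v \<noteq> 0" unfolding cuspidal_def perp_iff by auto
  then have "v \<in> X" using h unfolding Hyp_def by auto
  then show False using v \<tau>_P_inj X_iff by blast
qed

lemma P_span: "P = span {al s, al t}"
proof
  show "P \<subseteq> span {al s, al t}" unfolding P_def
  proof safe
    fix a b show "a *\<^sub>R al s + b *\<^sub>R al t \<in> span {al s, al t}"
      by (intro span_add span_scale span_base) auto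
  qed
  have "subspace P" unfolding subspace_def using P_add P_scale P_scale[of "al s" 0] by auto
  then show "span {al s, al t} \<subseteq> P" by (intro span_minimal) auto
qed

lemma subspace_X: "subspace X"
  unfolding subspace_def by (auto simp: X_iff \<tau>_linear)

lemma indep_st: "independent {al s, al t :: real^'s}"
  by (rule independent_mono[OF independent_Basis]) (auto simp: axis_in_Basis_iff)

lemma dim_X: "dim X + 2 = CARD('s)"
proof -
  have c2: "card {al s, al t :: real^'s} = 2" using st by (simp add: axis_eq_axis)
  have dP: "dim P = 2" unfolding P_span dim_span using dim_eq_card_independent[OF indep_st] c2 by simp
  have "v \<in> {x + y |x y. x \<in> P \<and> y \<in> X}" for v
    using X_diff_prj[of v] by (intro CollectI exI[of _ "prj v"] exI[of _ "v - prj v"]) simp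
  then have sums: "{x + y |x y. x \<in> P \<and> y \<in> X} = UNIV" by blast
  have int: "P \<inter> X = {0}" using \<tau>_P_inj X_iff P_scale[of "al s" 0] by auto
  have "subspace P" unfolding P_span by (rule subspace_span)
  from dim_sums_Int[OF this subspace_X] show ?thesis unfolding sums int by (simp add: dP dim_UNIV)
qed

lemma codim_X: "codim X = 2" using dim_X unfolding codim_def by simp

definition AX_gens :: "('s mat list \<Rightarrow> complex) set" where
  "AX_gens = {mono [a, b] | a b. a \<in> TL \<and> b \<in> TL \<and> a \<noteq> b}"

lemma AX_eq: "AX_lift m {s,t} = lin_span AX_gens"
proof -
  have "set ts \<subseteq> refls m \<and> length ts = 2 \<and> {v. \<forall>t\<in>set ts. v \<in> Hyp t} = X \<longleftrightarrow>
      (\<exists>a b. ts = [a, b] \<and> a \<in> TL \<and> b \<in> TL \<and> a \<noteq> b)" for ts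
  proof
    assume h: "set ts \<subseteq> refls m \<and> length ts = 2 \<and> {v. \<forall>t\<in>set ts. v \<in> Hyp t} = X"
    then obtain a b where ts: "ts = [a, b]" by (auto simp: numeral_2_eq_2 length_Suc_conv)
    then have i: "Hyp a \<inter> Hyp b = X" using h by auto
    then have "a \<in> TL" "b \<in> TL" using h ts unfolding TL_def by auto
    moreover have "a \<noteq> b" using i TL_Hyp_neq[OF \<open>a \<in> TL\<close>] by auto
    ultimately show "\<exists>a b. ts = [a, b] \<and> a \<in> TL \<and> b \<in> TL \<and> a \<noteq> b" using ts by blast
  next
    assume "\<exists>a b. ts = [a, b] \<and> a \<in> TL \<and> b \<in> TL \<and> a \<noteq> b"
    then obtain a b where ab: "ts = [a, b]" "a \<in> TL" "b \<in> TL" "a \<noteq> b" by blast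
    then have "Hyp a \<inter> Hyp b = X" using TL_Hyp_Int by blast
    then show "set ts \<subseteq> refls m \<and> length ts = 2 \<and> {v. \<forall>t\<in>set ts. v \<in> Hyp t} = X"
      using ab unfolding TL_def by auto
  qed
  then have "{mono ts | ts. set ts \<subseteq> refls m \<and> length ts = 2 \<and> {v. \<forall>t\<in>set ts. v \<in> Hyp t} = X} = AX_gens"
    unfolding AX_gens_def by auto
  then show ?thesis unfolding AX_lift_def codim_X by simp
qed

text \<open>The boundary map of the Orlik-Solomon algebra in degree two, \<open>[x, y] \<mapsto> y - x\<close>, restricted to the
  reflections of \<open>WL\<close>.\<close>

definition bd :: "('s mat list \<Rightarrow> complex) \<Rightarrow> 's mat \<Rightarrow> complex" where
  "bd f u = (\<Sum>x\<in>TL. f [x, u] - f [u, x])"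

lemma bd_lincomb: "bd (lincomb k a b) u = (\<Sum>i<k. a i * bd (b i) u)"
  unfolding bd_def lincomb_def sum_subtractf[symmetric] sum_distrib_left
  by (subst sum.swap) (simp add: right_diff_distrib)

lemma bd_mono: "u \<in> TL \<Longrightarrow> bd (mono [a, b]) u =
    (if a \<in> TL \<and> u = b then 1 else 0) - (if b \<in> TL \<and> u = a then 1 else 0)"
proof -
  have 1: "(\<Sum>x\<in>TL. mono [a,b] [x,u]) = (\<Sum>x\<in>TL. if x = a then (if u = b then 1 else 0) else 0)"
    by (rule sum.cong) (auto simp: mono_def)
  have 2: "(\<Sum>x\<in>TL. mono [a,b] [u,x]) = (\<Sum>x\<in>TL. if x = b then (if u = a then 1 else 0) else 0)"
    by (rule sum.cong) (auto simp: mono_def)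
  show ?thesis unfolding bd_def sum_subtractf 1 2 using finite_TL by simp
qed

lemma hyp_dep3: assumes "hyp_dep [a, b, c]" "set [a, b, c] \<subseteq> refls m"
  shows "a \<in> TL \<Longrightarrow> b \<in> TL \<Longrightarrow> a \<noteq> b \<Longrightarrow> c \<in> TL"
    and "a \<in> TL \<Longrightarrow> c \<in> TL \<Longrightarrow> a \<noteq> c \<Longrightarrow> b \<in> TL"
    and "b \<in> TL \<Longrightarrow> c \<in> TL \<Longrightarrow> b \<noteq> c \<Longrightarrow> a \<in> TL"
proof -
  obtain f k where f: "\<And>i. i < 3 \<Longrightarrow> f i \<noteq> 0 \<and> {v. f i \<bullet> v = 0} = Hyp ([a,b,c] ! i)"
    and k: "\<exists>i<3. k i \<noteq> 0" and sm: "(\<Sum>i<3. k i *\<^sub>R f i) = 0"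
    using assms(1) unfolding hyp_dep_def by (auto simp: numeral_3_eq_3)
  have e0: "k 0 *\<^sub>R f 0 + k 1 *\<^sub>R f 1 + k 2 *\<^sub>R f 2 = 0" using sm by (simp add: numeral_3_eq_3 numeral_2_eq_2)
  have kk: "k 0 \<noteq> 0 \<or> k 1 \<noteq> 0 \<or> k 2 \<noteq> 0" using k by (auto simp: numeral_3_eq_3 less_Suc_eq numeral_2_eq_2)
  have H: "f 0 \<noteq> 0" "f 1 \<noteq> 0" "f 2 \<noteq> 0"
    "{v. f 0 \<bullet> v = 0} = Hyp a" "{v. f 1 \<bullet> v = 0} = Hyp b" "{v. f 2 \<bullet> v = 0} = Hyp c"
    using f[of 0] f[of 1] f[of 2] by (auto simp: numeral_2_eq_2)
  have main: "z \<in> TL" if "kx *\<^sub>R fx + ky *\<^sub>R fy + kz *\<^sub>R fz = 0" "kx \<noteq> 0 \<or> ky \<noteq> 0 \<or> kz \<noteq> 0"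
    "fx \<noteq> 0" "fy \<noteq> 0" "fz \<noteq> 0"
    "{v. fx \<bullet> v = 0} = Hyp x" "{v. fy \<bullet> v = 0} = Hyp y" "{v. fz \<bullet> v = 0} = Hyp z"
    "x \<in> TL" "y \<in> TL" "x \<noteq> y" "z \<in> refls m" for kx ky kz :: real and fx fy fz x y z
  proof -
    have kz: "kz \<noteq> 0"
    proof
      assume "kz = 0"
      then have "Hyp x = Hyp y" using that hyp_dep_parallel[of fx fy kx ky] by simp
      then show False using Hyp_inj that unfolding TL_def by auto
    qed
    have "v \<in> Hyp z" if v: "v \<in> X" for v
    proof -
      have "v \<in> Hyp x" "v \<in> Hyp y" using v \<open>x \<in> TL\<close> \<open>y \<in> TL\<close> unfolding TL_def by auto
      then have "fx \<bullet> v = 0" "fy \<bullet> v = 0" using \<open>{v. fx \<bullet> v = 0} = Hyp x\<close> \<open>{v. fy \<bullet> v = 0} = Hyp y\<close> by auto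
      then have "kz * (fz \<bullet> v) = 0"
        using arg_cong[OF \<open>kx *\<^sub>R fx + ky *\<^sub>R fy + kz *\<^sub>R fz = 0\<close>, of "\<lambda>x. x \<bullet> v"] by (simp add: inner_add_left)
      then show ?thesis using kz \<open>{v. fz \<bullet> v = 0} = Hyp z\<close> by auto
    qed
    then show ?thesis using \<open>z \<in> refls m\<close> unfolding TL_def by auto
  qed
  show "a \<in> TL \<Longrightarrow> b \<in> TL \<Longrightarrow> a \<noteq> b \<Longrightarrow> c \<in> TL"
    by (rule main[OF e0 kk H]) (use assms in auto)
  have e1: "k 0 *\<^sub>R f 0 + k 2 *\<^sub>R f 2 + k 1 *\<^sub>R f 1 = 0" using e0 by (simp add: algebra_simps)
  show "a \<in> TL \<Longrightarrow> c \<in> TL \<Longrightarrow> a \<noteq> c \<Longrightarrow> b \<in> TL"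
    by (rule main[OF e1 _ H(1,3,2,4,6,5)]) (use assms kk in auto)
  have e2: "k 1 *\<^sub>R f 1 + k 2 *\<^sub>R f 2 + k 0 *\<^sub>R f 0 = 0" using e0 by (simp add: algebra_simps)
  show "b \<in> TL \<Longrightarrow> c \<in> TL \<Longrightarrow> b \<noteq> c \<Longrightarrow> a \<in> TL"
    by (rule main[OF e2 _ H(2,3,1,5,6,4)]) (use assms kk in auto)
qed

lemma hyp_dep2: assumes "hyp_dep [a, b]" "set [a, b] \<subseteq> refls m" shows "a = b"
proof -
  obtain f k where f: "\<And>i. i < 2 \<Longrightarrow> f i \<noteq> 0 \<and> {v. f i \<bullet> v = 0} = Hyp ([a,b] ! i)"
    and k: "\<exists>i<2. k i \<noteq> 0" and sm: "(\<Sum>i<2. k i *\<^sub>R f i) = 0"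
    using assms(1) unfolding hyp_dep_def by (auto simp: numeral_2_eq_2)
  have e0: "k 0 *\<^sub>R f 0 + k 1 *\<^sub>R f 1 = 0" using sm by (simp add: numeral_2_eq_2)
  have kk: "k 0 \<noteq> 0 \<or> k 1 \<noteq> 0" using k by (auto simp: less_Suc_eq numeral_2_eq_2)
  have "Hyp a = Hyp b" using hyp_dep_parallel[OF _ _ e0 kk] f[of 0] f[of 1] by simp
  then show ?thesis using Hyp_inj assms(2) by auto
qed

lemma hyp_dep1: "\<not> hyp_dep [a]" unfolding hyp_dep_def by auto

text \<open>Only lists of up to three reflections need care: a single one is independent, a
  dependent pair consists of equal reflections and gives the zero relation, and for triples the
  terms cancel by \<open>hyp_dep3\<close>.\<close>

lemma os_rel_bd: assumes "r \<in> os_rels m"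
  shows "length w < 2 \<Longrightarrow> r w = 0" "u \<in> TL \<Longrightarrow> bd r u = 0"
proof -
  have "(\<forall>w. length w < 2 \<longrightarrow> r w = 0) \<and> (\<forall>u\<in>TL. bd r u = 0)"
    using assms unfolding os_rels_def
  proof
    assume "r \<in> {\<lambda>v. mono [a, b] v + mono [b, a] v | a b. a \<in> refls m \<and> b \<in> refls m}"
    then obtain a b where r: "r = (\<lambda>v. mono [a, b] v + mono [b, a] v)" by blast
    have "bd r u = bd (mono [a,b]) u + bd (mono [b,a]) u" for u
      unfolding r bd_def by (simp add: sum.distrib sum_subtractf)
    then have "\<forall>u\<in>TL. bd r u = 0" by (auto simp: bd_mono)
    moreover have "r w = 0" if "length w < 2" for w
    proof -
      have "w \<noteq> [a, b]" "w \<noteq> [b, a]" using that by auto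
      then show ?thesis unfolding r mono_def by simp
    qed
    ultimately show ?thesis by blast
  next
    assume "r \<in> {\<lambda>v. \<Sum>i<length ts. (-1) ^ (i + 1) * mono (remove_nth i ts) v | ts. set ts \<subseteq> refls m \<and> hyp_dep ts}"
    then obtain ts where r: "r = (\<lambda>v. \<Sum>i<length ts. (-1) ^ (i + 1) * mono (remove_nth i ts) v)"
      and ts: "set ts \<subseteq> refls m" "hyp_dep ts" by blast
    \<comment> \<open>Each term omits one letter of \<open>ts\<close>, so the relation lives on
      words one letter shorter.\<close>
    have big: "r w = 0" if "length w + 1 \<noteq> length ts" for w
    proof -
      have "mono (remove_nth i ts) w = 0" if "i < length ts" for i
        using that \<open>length w + 1 \<noteq> length ts\<close> by (auto simp: mono_def remove_nth_def)
      then show ?thesis unfolding r by simp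
    qed
    consider "length ts = 0" | "length ts = 1" | "length ts = 2" | "length ts = 3" | "length ts > 3" by linarith
    then show ?thesis
    proof cases
      case 1 then have "r = (\<lambda>_. 0)" unfolding r by simp
      then show ?thesis by (simp add: bd_def)
    next
      case 2 then obtain a where "ts = [a]" by (auto simp: length_Suc_conv)
      then show ?thesis using ts hyp_dep1 by auto
    next
      case 3 then obtain a b where ab: "ts = [a, b]" by (auto simp: length_Suc_conv numeral_2_eq_2)
      then have "a = b" using hyp_dep2 ts by auto
      then have "r = (\<lambda>_. 0)" unfolding r ab by (simp add: remove_nth_def)
      then show ?thesis by (simp add: bd_def)
    next
      case 4 then obtain a b c where abc: "ts = [a, b, c]" by (auto simp: length_Suc_conv numeral_3_eq_3)
      have r3: "r = (\<lambda>v. mono [a,c] v - mono [b,c] v - mono [a,b] v)"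
        unfolding r abc by (simp add: remove_nth_def fun_eq_iff)
      have "bd r u = bd (mono [a,c]) u - bd (mono [b,c]) u - bd (mono [a,b]) u" for u
        unfolding r3 bd_def by (simp add: sum_subtractf)
      then have "\<forall>u\<in>TL. bd r u = 0"
        using hyp_dep3[of a b c] ts abc by (auto simp: bd_mono)
      moreover have "length w < 2 \<Longrightarrow> r w = 0" for w using big[of w] 4 by auto
      ultimately show ?thesis by blast
    next
      case 5
      then have "length w \<le> 2 \<Longrightarrow> r w = 0" for w using big[of w] by auto
      then show ?thesis by (simp add: bd_def)
    qed
  qed
  then show "length w < 2 \<Longrightarrow> r w = 0" "u \<in> TL \<Longrightarrow> bd r u = 0" by blast+
qed

text \<open>\<open>bd\<close> reads only words of length two. There a relation multiplied by a
  nonempty monomial vanishes, because relations are zero on words of fewer than two letters.\<close>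

lemma bd_os_ideal: assumes "f \<in> os_ideal m" "u \<in> TL" shows "bd f u = 0"
proof -
  obtain k a b where f: "f = lincomb k a b" and b: "\<forall>i<k. b i \<in> {fa_mult (fa_mult (mono u) r) (mono v) | u r v.
      set u \<subseteq> refls m \<and> set v \<subseteq> refls m \<and> r \<in> os_rels m}"
    using assms(1) unfolding os_ideal_def lin_span_def by blast
  have "bd (b i) u = 0" if i: "i < k" for i
  proof -
    obtain y r z where yz: "b i = fa_mult (fa_mult (mono y) r) (mono z)" "r \<in> os_rels m" using b i by blast
    show ?thesis
    proof (cases "y = [] \<and> z = []")
      case True then show ?thesis using yz os_rel_bd(2)[OF yz(2) assms(2)] by (simp add: fa_mult_nil)
    next
      case False
      have "b i w = 0" if "length w = 2" for w
        using fa_mult_sandwich[of y r z w]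
      proof
        assume "\<exists>w'. w = y @ w' @ z \<and> fa_mult (fa_mult (mono y) r) (mono z) w = r w'"
        then obtain w' where w': "w = y @ w' @ z" "b i w = r w'" using yz by auto
        then have "length w' < 2" using False that by (auto simp: neq_Nil_conv)
        then show ?thesis using os_rel_bd(1)[OF yz(2)] w' by simp
      qed (simp add: yz)
      then show ?thesis by (simp add: bd_def)
    qed
  qed
  then show ?thesis unfolding f bd_lincomb by simp
qed

lemma TL_normal: assumes "a \<in> TL" shows "\<exists>\<beta>\<in>P. nvec \<beta> \<noteq> 0 \<and> {v. nvec \<beta> \<bullet> v = 0} = Hyp a"
proof -
  have a: "a \<in> refls m" "X \<subseteq> Hyp a" using assms unfolding TL_def by auto
  obtain \<beta> where \<beta>: "B \<beta> \<beta> = 1" "\<forall>v. v v* a = v - (2 * B v \<beta>) *\<^sub>R \<beta>" using refl_root[OF a(1)] by blast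
  have "\<forall>x\<in>X. B \<beta> x = 0" using a(2) Hyp_root[OF \<beta>] B_sym[of \<beta>] by auto
  then have "\<beta> \<in> P" using perp_iff by blast
  moreover have "nvec \<beta> \<noteq> 0" using nvec_inner[of \<beta> \<beta>] \<beta>(1) by auto
  moreover have "{v. nvec \<beta> \<bullet> v = 0} = Hyp a" using Hyp_root[OF \<beta>] by (auto simp: nvec_inner)
  ultimately show ?thesis by blast
qed

text \<open>The three normals come from vectors of the plane \<open>P\<close>.\<close>

lemma TL_hyp_dep: assumes "a \<in> TL" "b \<in> TL" "c \<in> TL" shows "hyp_dep [a, b, c]"
proof -
  obtain \<alpha> where \<alpha>: "\<alpha> \<in> P" "nvec \<alpha> \<noteq> 0" "{v. nvec \<alpha> \<bullet> v = 0} = Hyp a" using TL_normal[OF assms(1)] by blast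
  obtain \<beta> where \<beta>: "\<beta> \<in> P" "nvec \<beta> \<noteq> 0" "{v. nvec \<beta> \<bullet> v = 0} = Hyp b" using TL_normal[OF assms(2)] by blast
  obtain \<gamma> where \<gamma>: "\<gamma> \<in> P" "nvec \<gamma> \<noteq> 0" "{v. nvec \<gamma> \<bullet> v = 0} = Hyp c" using TL_normal[OF assms(3)] by blast
  obtain a0 b0 where 0: "\<alpha> = a0 *\<^sub>R al s + b0 *\<^sub>R al t" using \<alpha>(1) unfolding P_def by auto
  obtain a1 b1 where 1: "\<beta> = a1 *\<^sub>R al s + b1 *\<^sub>R al t" using \<beta>(1) unfolding P_def by auto
  obtain a2 b2 where 2: "\<gamma> = a2 *\<^sub>R al s + b2 *\<^sub>R al t" using \<gamma>(1) unfolding P_def by auto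
  obtain c0 c1 c2 where cc: "c0 \<noteq> 0 \<or> c1 \<noteq> 0 \<or> c2 \<noteq> 0" "c0 * a0 + c1 * a1 + c2 * a2 = 0" "c0 * b0 + c1 * b1 + c2 * b2 = 0"
    using real_dep3[of a0 a1 a2 b0 b1 b2] by (elim exE conjE)
  have "c0 *\<^sub>R \<alpha> + c1 *\<^sub>R \<beta> + c2 *\<^sub>R \<gamma> = (c0 * a0 + c1 * a1 + c2 * a2) *\<^sub>R al s + (c0 * b0 + c1 * b1 + c2 * b2) *\<^sub>R al t"
    unfolding 0 1 2 by (simp add: algebra_simps)
  then have z: "c0 *\<^sub>R \<alpha> + c1 *\<^sub>R \<beta> + c2 *\<^sub>R \<gamma> = 0" using cc by simp
  have "c0 *\<^sub>R nvec \<alpha> + c1 *\<^sub>R nvec \<beta> + c2 *\<^sub>R nvec \<gamma> = nvec (c0 *\<^sub>R \<alpha> + c1 *\<^sub>R \<beta> + c2 *\<^sub>R \<gamma>)"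
    by (simp add: nvec_def vec_eq_iff Bform_linear)
  then have nz: "c0 *\<^sub>R nvec \<alpha> + c1 *\<^sub>R nvec \<beta> + c2 *\<^sub>R nvec \<gamma> = 0" unfolding z by (simp add: nvec_def vec_eq_iff)
  define F where "F i = nvec ([\<alpha>, \<beta>, \<gamma>] ! i)" for i
  define C where "C i = [c0, c1, c2] ! i" for i
  show ?thesis unfolding hyp_dep_def
  proof (intro exI[of _ F] exI[of _ C] conjI allI impI)
    fix i assume "i < length [a, b, c]"
    then consider "i = 0" | "i = 1" | "i = 2" by fastforce
    then show "F i \<noteq> 0" "{v. F i \<bullet> v = 0} = Hyp ([a, b, c] ! i)"
      using \<alpha> \<beta> \<gamma> by (cases; simp add: F_def)+
  next
    show "\<exists>i<length [a, b, c]. C i \<noteq> 0" using cc(1)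
      unfolding C_def by (auto intro: exI[of _ 0] exI[of _ 1] exI[of _ 2])
    show "(\<Sum>i<length [a, b, c]. C i *\<^sub>R F i) = 0" using nz by (simp add: C_def F_def add.assoc)
  qed
qed

lemma os_rel_ideal: assumes "a \<in> TL" "b \<in> TL" "c \<in> TL"
  shows "(\<lambda>v. mono [b,c] v - mono [a,c] v + mono [a,b] v) \<in> os_ideal m"
proof -
  let ?r = "\<lambda>v. \<Sum>i<length [a,b,c]. (-1) ^ (i + 1) * mono (remove_nth i [a,b,c]) v"
  have "?r \<in> os_rels m"
  proof -
    have "set [a,b,c] \<subseteq> refls m \<and> hyp_dep [a,b,c]" using TL_hyp_dep[OF assms] assms unfolding TL_def by auto
    then show ?thesis unfolding os_rels_def by blast
  qed
  then have "fa_mult (fa_mult (mono []) ?r) (mono []) \<in> os_ideal m"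
    unfolding os_ideal_def by (intro lin_span_base CollectI exI[of _ "[]"] exI[of _ ?r]) auto
  then have "?r \<in> os_ideal m" by (simp only: fa_mult_nil)
  then have "(\<lambda>v. (-1) * ?r v) \<in> os_ideal m" unfolding os_ideal_def by (rule lin_span_scale)
  moreover have "(\<lambda>v. (-1) * ?r v) = (\<lambda>v. mono [b,c] v - mono [a,c] v + mono [a,b] v)"
    by (simp add: fun_eq_iff remove_nth_def)
  ultimately show ?thesis by simp
qed

text \<open>The three-term relation with \<open>\<sigma> s\<close> as first letter rewrites
  \<open>[x, y]\<close> as \<open>[\<sigma> s, y]\<close> minus \<open>[\<sigma> s, x]\<close>.
  Together with \<open>bd_os_ideal\<close>, the kernel of \<open>bd\<close> on these spans is the
  intersection with the ideal.\<close>

lemma AX_reduce: assumes "f \<in> lin_span AX_gens"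
  shows "(\<lambda>v. f v - (\<Sum>u\<in>TL. bd f u * mono [\<sigma> s, u] v)) \<in> os_ideal m"
proof -
  obtain k a b where f: "f = lincomb k a b" and b: "\<forall>i<k. b i \<in> AX_gens"
    using assms unfolding lin_span_def by blast
  have "(\<lambda>v. b i v - (\<Sum>u\<in>TL. bd (b i) u * mono [\<sigma> s, u] v)) \<in> os_ideal m" if i: "i < k" for i
  proof -
    obtain x y where xy: "b i = mono [x, y]" "x \<in> TL" "y \<in> TL" using b i unfolding AX_gens_def by blast
    have "(\<Sum>u\<in>TL. bd (b i) u * mono [\<sigma> s, u] v) =
        (\<Sum>u\<in>TL. (if u = y then mono [\<sigma> s, u] v else 0)) - (\<Sum>u\<in>TL. (if u = x then mono [\<sigma> s, u] v else 0))" for v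
      unfolding sum_subtractf[symmetric] by (rule sum.cong) (auto simp: xy bd_mono)
    then have "(\<lambda>v. b i v - (\<Sum>u\<in>TL. bd (b i) u * mono [\<sigma> s, u] v)) =
       (\<lambda>v. mono [x,y] v - mono [\<sigma> s, y] v + mono [\<sigma> s, x] v)"
      using xy finite_TL by (simp add: diff_diff_eq2 diff_add_eq)
    then show ?thesis using os_rel_ideal[OF sref_s_TL xy(2,3)] by simp
  qed
  then have "lincomb k a (\<lambda>i v. b i v - (\<Sum>u\<in>TL. bd (b i) u * mono [\<sigma> s, u] v)) \<in> os_ideal m"
    unfolding os_ideal_def by (intro lin_span_lincomb) auto
  moreover have "lincomb k a (\<lambda>i v. b i v - (\<Sum>u\<in>TL. bd (b i) u * mono [\<sigma> s, u] v)) =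
     (\<lambda>v. f v - (\<Sum>u\<in>TL. bd f u * mono [\<sigma> s, u] v))"
  proof
    fix v
    have "(\<Sum>u\<in>TL. bd f u * mono [\<sigma> s, u] v) = (\<Sum>u\<in>TL. \<Sum>i<k. a i * (bd (b i) u * mono [\<sigma> s, u] v))"
      unfolding f bd_lincomb by (simp add: sum_distrib_right mult.assoc)
    also have "\<dots> = (\<Sum>i<k. a i * (\<Sum>u\<in>TL. bd (b i) u * mono [\<sigma> s, u] v))"
      by (subst sum.swap) (simp add: sum_distrib_left)
    finally show "lincomb k a (\<lambda>i v. b i v - (\<Sum>u\<in>TL. bd (b i) u * mono [\<sigma> s, u] v)) v =
       f v - (\<Sum>u\<in>TL. bd f u * mono [\<sigma> s, u] v)"
      by (simp add: f lincomb_def right_diff_distrib sum_subtractf)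
  qed
  ultimately show ?thesis by simp
qed

lemma TL_conj: assumes "g \<in> N" "a \<in> TL" shows "iv g ** a ** g \<in> TL" "g ** a ** iv g \<in> TL"
proof -
  have 1: "iv g ** a ** g \<in> TL" if "g \<in> N" for g
    using assms that N_conj lam_conj unfolding TL_eq by auto
  show "iv g ** a ** g \<in> TL" using 1[OF assms(1)] .
  show "g ** a ** iv g \<in> TL" using 1[OF N_inv[OF assms(1)]] N_W[OF assms(1)] by simp
qed

lemma os_act_mono: assumes "g \<in> W" shows "os_act (mono [a, b]) g = mono [iv g ** a ** g, iv g ** b ** g]"
proof
  have e: "g ** x ** iv g = y \<longleftrightarrow> x = iv g ** y ** g" for x y :: "'s mat"
  proof
    assume "g ** x ** iv g = y"
    then have "iv g ** y ** g = iv g ** (g ** x ** iv g) ** g" by simp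
    then show "x = iv g ** y ** g" using assms by (simp add: matrix_mul_assoc)
  next
    assume "x = iv g ** y ** g"
    then show "g ** x ** iv g = y" using assms by (simp add: matrix_mul_assoc)
  qed
  fix v
  have "map (\<lambda>t. g ** t ** iv g) v = [a, b] \<longleftrightarrow> v = [iv g ** a ** g, iv g ** b ** g]"
    by (auto simp: map_eq_Cons_conv e)
  then show "os_act (mono [a, b]) g v = mono [iv g ** a ** g, iv g ** b ** g] v"
    by (simp add: os_act_def mono_def)
qed

lemma PsiT_TL: assumes g: "g \<in> N"
  shows "PsiT m {s,t} g = of_nat (card {u\<in>TL. g ** u ** iv g = u}) - 1"
  unfolding PsiT_def AX_eq
proof (rule trace_mod_perm[where D = bd and ?q0.0 = "\<sigma> s"])
  have gW: "g \<in> W" using N_W[OF g] .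
  show "finite TL" by (rule finite_TL)
  show "\<sigma> s \<in> TL" by (rule sref_s_TL)
  fix k :: nat and a :: "nat \<Rightarrow> complex" and b :: "nat \<Rightarrow> 's mat list \<Rightarrow> complex"
  show "\<forall>i<k. b i \<in> lin_span AX_gens \<Longrightarrow> lincomb k a b \<in> lin_span AX_gens" by (rule lin_span_lincomb)
  show "bd (lincomb k a b) u = (\<Sum>i<k. a i * bd (b i) u)" for u by (rule bd_lincomb)
next
  fix f assume f: "f \<in> lin_span AX_gens"
  show "f \<in> os_ideal m \<longleftrightarrow> (\<forall>u\<in>TL. bd f u = 0)"
    using bd_os_ideal AX_reduce[OF f] by auto
  have "(\<Sum>u\<in>TL. \<Sum>x\<in>TL. f [x, u]) = (\<Sum>u\<in>TL. \<Sum>x\<in>TL. f [u, x])" by (rule sum.swap)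
  then show "(\<Sum>u\<in>TL. bd f u) = 0" by (simp add: bd_def sum_subtractf)
  obtain k a b where fl: "f = lincomb k a b" and b: "\<forall>i<k. b i \<in> AX_gens"
    using f unfolding lin_span_def by blast
  have "os_act f g = lincomb k a (\<lambda>i. os_act (b i) g)" unfolding fl lincomb_def os_act_def by simp
  moreover have "os_act (b i) g \<in> lin_span AX_gens" if i: "i < k" for i
  proof -
    obtain x y where xy: "b i = mono [x, y]" "x \<in> TL" "y \<in> TL" "x \<noteq> y" using b i unfolding AX_gens_def by blast
    have gW: "g \<in> W" using N_W[OF g] .
    have "iv g ** x ** g \<noteq> iv g ** y ** g"
    proof
      assume "iv g ** x ** g = iv g ** y ** g"
      then have "g ** (iv g ** x ** g) ** iv g = g ** (iv g ** y ** g) ** iv g" by simp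
      then show False using gW xy(4) by (simp add: matrix_mul_assoc)
    qed
    then have "os_act (b i) g \<in> AX_gens" unfolding xy(1) os_act_mono[OF gW] AX_gens_def using TL_conj(1)[OF g] xy by blast
    then show ?thesis by (rule lin_span_base)
  qed
  ultimately show "os_act f g \<in> lin_span AX_gens" by (simp add: lin_span_lincomb)
  fix u assume "u \<in> TL"
  have gW: "g \<in> W" using N_W[OF g] .
  have bij: "bij_betw (\<lambda>x. g ** x ** iv g) TL TL"
    by (rule bij_betw_byWitness[where f' = "\<lambda>x. iv g ** x ** g"])
      (use gW TL_conj[OF g] in \<open>auto simp: matrix_mul_assoc\<close>)
  show "bd (os_act f g) u = bd f (g ** u ** iv g)"
    unfolding bd_def os_act_def
    using sum.reindex_bij_betw[OF bij, of "\<lambda>x. f [x, g ** u ** iv g] - f [g ** u ** iv g, x]"] by simp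
next
  fix h :: "'s mat \<Rightarrow> complex" assume h: "(\<Sum>u\<in>TL. h u) = 0"
  \<comment> \<open>Each term contributes \<open>h u\<close> at \<open>u\<close> and
    \<open>- h u\<close> at \<open>\<sigma> s\<close>, so the value at \<open>\<sigma> s\<close> is
    correct because \<open>h\<close> has sum zero.\<close>
  let ?f = "\<lambda>v. \<Sum>u\<in>TL - {\<sigma> s}. h u * mono [\<sigma> s, u] v"
  have "?f \<in> lin_span AX_gens" using finite_TL sref_s_TL by (intro lin_span_sum) (auto intro!: lin_span_base simp: AX_gens_def)
  moreover have "bd ?f u = h u" if u: "u \<in> TL" for u
  proof -
    have "bd ?f u = (\<Sum>x\<in>TL. \<Sum>y\<in>TL - {\<sigma> s}. h y * (mono [\<sigma> s, y] [x, u] - mono [\<sigma> s, y] [u, x]))"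
      unfolding bd_def by (simp add: sum_subtractf right_diff_distrib)
    also have "\<dots> = (\<Sum>y\<in>TL - {\<sigma> s}. h y * bd (mono [\<sigma> s, y]) u)"
      unfolding bd_def sum_distrib_left by (rule sum.swap)
    also have "\<dots> = (\<Sum>y\<in>TL - {\<sigma> s}. (if y = u then h y else 0) - (if u = \<sigma> s then h y else 0))"
      by (rule sum.cong) (auto simp: bd_mono[OF u] sref_s_TL)
    also have "\<dots> = h u"
    proof (cases "u = \<sigma> s")
      case True
      have "h (\<sigma> s) + (\<Sum>y\<in>TL - {\<sigma> s}. h y) = 0" using h sum.remove[OF finite_TL sref_s_TL, of h] by simp
      then have "- (\<Sum>y\<in>TL - {\<sigma> s}. h y) = h (\<sigma> s)" by (simp add: add_eq_0_iff)
      moreover have "(\<Sum>y\<in>TL - {\<sigma> s}. (if y = u then h y else 0)) = 0" using True by (intro sum.neutral) auto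
      ultimately show ?thesis using True by (simp add: sum_subtractf sum_negf)
    next
      case False then show ?thesis using u finite_TL by simp
    qed
    finally show ?thesis .
  qed
  ultimately show "\<exists>f\<in>lin_span AX_gens. \<forall>u\<in>TL. bd f u = h u" by blast
qed (use TL_conj[OF g] in auto)

lemma conj_fix_iff: assumes "g \<in> W" shows "g ** u ** iv g = u \<longleftrightarrow> iv g ** u ** g = u"
proof
  assume "g ** u ** iv g = u"
  then have "iv g ** (g ** u ** iv g) ** g = iv g ** u ** g" by simp
  then show "iv g ** u ** g = u" using assms by (simp add: matrix_mul_assoc)
next
  assume "iv g ** u ** g = u"
  then have "g ** (iv g ** u ** g) ** iv g = g ** u ** iv g" by simp
  then show "g ** u ** iv g = u" using assms by (simp add: matrix_mul_assoc)
qed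

text \<open>The map sending \<open>u\<close> to \<open>- lam u\<close> identifies \<open>TL\<close>
  with the \<open>n\<close>-th roots of unity, and \<open>lam_conj\<close> describes conjugation in
  this coordinate.\<close>

theorem PsiT_eq: assumes g: "g \<in> N"
  shows "PsiT m {s,t} g = of_nat (card {x\<in>R. (if ori g then mu g * x else mu g * cnj x) = x}) - 1"
proof -
  have fix_iff: "g ** u ** iv g = u \<longleftrightarrow> (if ori g then mu g * - lam u else mu g * cnj (- lam u)) = - lam u"
    if "u \<in> TL" for u
  proof -
    have u: "u \<in> WL" "\<not> ori u" using that TL_eq by auto
    have "g ** u ** iv g = u \<longleftrightarrow> lam (iv g ** u ** g) = lam u"
      unfolding conj_fix_iff[OF N_W[OF g]]
      using WL_unique[OF N_conj(2)[OF g u(1)] u(1) lam_conj(1)[OF g u(1)]] by auto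
    then show ?thesis unfolding lam_conj[OF g u(1)] using u by auto
  qed
  have "bij_betw (\<lambda>u. - lam u) {u\<in>TL. g ** u ** iv g = u} {x\<in>R. (if ori g then mu g * x else mu g * cnj x) = x}"
    unfolding bij_betw_def
  proof
    show "inj_on (\<lambda>u. - lam u) {u\<in>TL. g ** u ** iv g = u}"
      by (rule inj_onI) (auto simp: TL_eq intro: WL_unique)
    show "(\<lambda>u. - lam u) ` {u\<in>TL. g ** u ** iv g = u} = {x\<in>R. (if ori g then mu g * x else mu g * cnj x) = x}"
    proof (intro set_eqI iffI)
      fix x assume "x \<in> (\<lambda>u. - lam u) ` {u\<in>TL. g ** u ** iv g = u}"
      then obtain u where u: "u \<in> TL" "g ** u ** iv g = u" "x = - lam u" by blast
      have "x \<in> R" using u WL_ulam[of u] by (simp add: TL_eq ulam_def)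
      then show "x \<in> {x\<in>R. (if ori g then mu g * x else mu g * cnj x) = x}"
        using fix_iff[OF u(1)] u by simp
    next
      fix x assume x: "x \<in> {x\<in>R. (if ori g then mu g * x else mu g * cnj x) = x}"
      then obtain u where u: "u \<in> WL" "ori u = False" "ulam u = x" using WL_ex[of x False] by blast
      then have u': "u \<in> TL" "- lam u = x" by (auto simp: TL_eq ulam_def)
      have "g ** u ** iv g = u" unfolding fix_iff[OF u'(1)] u'(2) using x by simp
      then show "x \<in> (\<lambda>u. - lam u) ` {u\<in>TL. g ** u ** iv g = u}" using u' by (intro image_eqI[of _ _ u]) auto
    qed
  qed
  then have "card {u\<in>TL. g ** u ** iv g = u} = card {x\<in>R. (if ori g then mu g * x else mu g * cnj x) = x}"
    by (rule bij_betw_same_card)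
  then show ?thesis unfolding PsiT_TL[OF g] by simp
qed

end

section \<open>Determinants\<close>

lemma det_rows_id:
  fixes A :: "real^'n^'n"
  assumes "\<And>i j. i \<notin> J \<Longrightarrow> A $ i $ j = (if i = j then 1 else 0)"
  shows "det A = (\<Sum>p | p permutes J. of_int (sign p) * (\<Prod>i\<in>J. A $ i $ p i))"
proof -
  have z: "(\<Prod>i\<in>UNIV. A $ i $ p i) = 0" if "p permutes UNIV" "\<not> p permutes J" for p
  proof -
    have "\<exists>i. i \<notin> J \<and> p i \<noteq> i" using that unfolding permutes_def by blast
    then obtain i where "i \<notin> J" "p i \<noteq> i" by blast
    then have "A $ i $ p i = 0" using assms by simp
    then show ?thesis by (auto intro: prod_zero)
  qed
  have "det A = (\<Sum>p | p permutes J. of_int (sign p) * (\<Prod>i\<in>UNIV. A $ i $ p i))"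
    unfolding det_def
    by (rule sum.mono_neutral_right) (auto simp: z intro: permutes_subset)
  also have "\<dots> = (\<Sum>p | p permutes J. of_int (sign p) * (\<Prod>i\<in>J. A $ i $ p i))"
  proof (rule sum.cong, simp)
    fix p assume "p \<in> {p. p permutes J}"
    then have "A $ i $ p i = 1" if "i \<notin> J" for i using assms that by (simp add: permutes_not_in)
    then have "(\<Prod>i\<in>UNIV. A $ i $ p i) = (\<Prod>i\<in>J. A $ i $ p i)"
      by (intro prod.mono_neutral_right) auto
    then show "of_int (sign p) * (\<Prod>i\<in>UNIV. A $ i $ p i) = of_int (sign p) * (\<Prod>i\<in>J. A $ i $ p i)" by simp
  qed
  finally show ?thesis .
qed

text \<open>Bridges \<open>det\<close>, which permutes the index type, and \<open>det_on\<close>,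
  which permutes an initial segment of the natural numbers.\<close>

lemma sum_permutes_transport:
  fixes c :: "nat \<Rightarrow> nat \<Rightarrow> real"
  assumes h: "bij_betw h J {..<k}" and fin: "finite J"
  shows "(\<Sum>p | p permutes J. of_int (sign p) * (\<Prod>i\<in>J. c (h i) (h (p i)))) =
    (\<Sum>p | p permutes {..<k}. of_int (sign p) * (\<Prod>i<k. c i (p i)))"
proof -
  let ?g = "inv_into J h"
  have g: "bij_betw ?g {..<k} J" by (rule bij_betw_inv_into[OF h])
  have inj: "inj_on h J" using h unfolding bij_betw_def by simp
  have gh: "?g (h x) = x" if "x \<in> J" for x using inj that by simp
  have hg: "h (?g y) = y" if "y \<in> {..<k}" for y using h that by (simp add: bij_betw_inv_into_right)
  have bij: "bij_betw (map_permutation J h) {p. p permutes J} {p. p permutes {..<k}}"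
  proof (rule bij_betw_byWitness[where f' = "map_permutation {..<k} ?g"])
    show "\<forall>p\<in>{p. p permutes J}. map_permutation {..<k} ?g (map_permutation J h p) = p"
      using map_permutation_compose_inv[OF h] gh by auto
    show "\<forall>p\<in>{p. p permutes {..<k}}. map_permutation J h (map_permutation {..<k} ?g p) = p"
      using map_permutation_compose_inv[OF g] hg by auto
    show "map_permutation J h ` {p. p permutes J} \<subseteq> {p. p permutes {..<k}}"
      using map_permutation_permutes[OF h] by auto
    show "map_permutation {..<k} ?g ` {p. p permutes {..<k}} \<subseteq> {p. p permutes J}"
      using map_permutation_permutes[OF g] by auto
  qed
  have "(\<Sum>p | p permutes {..<k}. of_int (sign p) * (\<Prod>i<k. c i (p i))) =
     (\<Sum>p | p permutes J. of_int (sign (map_permutation J h p)) * (\<Prod>i<k. c i (map_permutation J h p i)))"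
    by (rule sum.reindex_bij_betw[OF bij, symmetric])
  also have "\<dots> = (\<Sum>p | p permutes J. of_int (sign p) * (\<Prod>i\<in>J. c (h i) (h (p i))))"
  proof (rule sum.cong, simp)
    fix p assume "p \<in> {p. p permutes J}"
    then have p: "p permutes J" by simp
    have "(\<Prod>i<k. c i (map_permutation J h p i)) = (\<Prod>i\<in>J. c (h i) (map_permutation J h p (h i)))"
      by (rule prod.reindex_bij_betw[OF h, symmetric])
    also have "\<dots> = (\<Prod>i\<in>J. c (h i) (h (p i)))"
      by (rule prod.cong) (simp_all add: map_permutation_apply[OF inj])
    finally show "of_int (sign (map_permutation J h p)) * (\<Prod>i<k. c i (map_permutation J h p i)) =
      of_int (sign p) * (\<Prod>i\<in>J. c (h i) (h (p i)))"
      using sign_map_permutation[OF inj p fin] by simp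
  qed
  finally show ?thesis by simp
qed

lemma permutes_pair: "a \<noteq> b \<Longrightarrow> {p. p permutes {a, b}} = {id, Transposition.transpose a b}"
proof (intro set_eqI iffI)
  fix p assume ab: "a \<noteq> b" and "p \<in> {p. p permutes {a, b}}"
  then have p: "p permutes {a, b}" by simp
  have inj: "inj p" by (rule permutes_inj[OF p])
  have pa: "p a \<in> {a, b}" "p b \<in> {a, b}" using permutes_in_image[OF p] by auto
  show "p \<in> {id, Transposition.transpose a b}"
  proof (cases "p a = a")
    case True
    then have "p b = b" using pa inj ab by (metis injD insertE singletonD)
    then have "p = id" using True permutes_not_in[OF p] by (metis (no_types) eq_id_iff insertE singletonD)
    then show ?thesis by simp
  next
    case False
    then have "p a = b" using pa by auto
    moreover then have "p b = a" using pa inj ab by (metis injD insertE singletonD)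
    ultimately have "p = Transposition.transpose a b"
      using permutes_not_in[OF p] by (auto simp: fun_eq_iff Transposition.transpose_def)
    then show ?thesis by simp
  qed
qed (auto simp: permutes_id permutes_swap_id)

context finite_rank2
begin

definition plane_sgn :: "'s mat \<Rightarrow> real" where "plane_sgn g = (if ori g then 1 else -1)"

text \<open>\<open>Im (cnj a * b)\<close> is the oriented area spanned by \<open>a\<close> and
  \<open>b\<close>. For the images of the two simple roots it is the determinant times
  \<open>sin \<theta>\<close>, and \<open>act\<close> shows that it is \<open>sin \<theta>\<close>
  up to the sign of the orientation.\<close>

lemma plane_det: assumes "g \<in> N" shows "g $ s $ s * g $ t $ t - g $ s $ t * g $ t $ s = plane_sgn g"
proof -
  let ?D = "g $ s $ s * g $ t $ t - g $ s $ t * g $ t $ s"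
  have 1: "lam g = g $ s $ s + g $ s $ t * \<epsilon>"
    unfolding lam_def using N_row(1)[OF assms, of s] by (simp add: \<tau>_linear)
  have 2: "act g \<epsilon> = g $ t $ s + g $ t $ t * \<epsilon>"
    using act_\<tau>[OF assms, of "al t"] N_row(1)[OF assms, of t] by (simp add: \<tau>_linear)
  have "Im (cnj (lam g) * act g \<epsilon>) = ?D * sin \<theta>"
    unfolding 1 2 by (simp add: \<epsilon>_def algebra_simps)
  moreover have "cnj (lam g) * act g \<epsilon> = (if ori g then \<epsilon> else cnj \<epsilon>)"
    using lam_norm[OF assms] by (simp add: act_def flip: mult.assoc)
  ultimately have "?D * sin \<theta> = Im (if ori g then \<epsilon> else cnj \<epsilon>)" by simp
  also have "\<dots> = plane_sgn g * sin \<theta>" by (simp add: plane_sgn_def \<epsilon>_def)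
  finally have "?D * sin \<theta> = plane_sgn g * sin \<theta>" .
  then show ?thesis by simp
qed

lemma basis_card:
  fixes k :: nat and b :: "nat \<Rightarrow> real^'s"
  assumes b: "\<And>i. i < k \<Longrightarrow> b i \<in> X" and sp: "\<And>v. v \<in> X \<Longrightarrow> \<exists>a. v = (\<Sum>i<k. a i *\<^sub>R b i)"
    and ind: "\<And>a i. (\<Sum>i<k. a i *\<^sub>R b i) = 0 \<Longrightarrow> i < k \<Longrightarrow> a i = 0"
  shows "k = card (UNIV - {s,t})"
proof -
  have inj: "inj_on b {..<k}"
  proof (rule inj_onI, rule ccontr)
    fix i j assume ij: "i \<in> {..<k}" "j \<in> {..<k}" "b i = b j" "i \<noteq> j"
    let ?a = "\<lambda>l. (if l = i then 1 else 0) - (if l = j then 1 else 0) :: real"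
    have "(\<Sum>l<k. ?a l *\<^sub>R b l) = (\<Sum>l<k. (if l = i then b l else 0)) - (\<Sum>l<k. (if l = j then b l else 0))"
      unfolding sum_subtractf[symmetric] by (rule sum.cong) auto
    also have "\<dots> = 0" using ij by simp
    finally show False using ind[of ?a i] ij by simp
  qed
  have "independent (b ` {..<k})"
  proof
    assume "dependent (b ` {..<k})"
    then obtain u where u: "\<exists>v\<in>b ` {..<k}. u v \<noteq> 0" "(\<Sum>v\<in>b ` {..<k}. u v *\<^sub>R v) = 0"
      unfolding dependent_finite[OF finite_imageI[OF finite_lessThan]] by blast
    then have "(\<Sum>i<k. u (b i) *\<^sub>R b i) = 0" by (simp add: sum.reindex[OF inj])
    from ind[OF this] u(1) show False by auto
  qed
  moreover have "b ` {..<k} \<subseteq> X" using b by auto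
  moreover have "X \<subseteq> span (b ` {..<k})"
  proof
    fix v assume "v \<in> X"
    then obtain a where v: "v = (\<Sum>i<k. a i *\<^sub>R b i)" using sp by blast
    show "v \<in> span (b ` {..<k})" unfolding v by (intro span_sum span_scale span_base) auto
  qed
  ultimately have "dim X = card (b ` {..<k})" by (intro dim_unique) auto
  then have "dim X = k" by (simp add: card_image[OF inj])
  moreover have "card (UNIV - {s,t}) = CARD('s) - 2" using st by (subst card_Diff_subset) auto
  ultimately show ?thesis using dim_X by simp
qed

text \<open>In a basis made of the two simple roots and a basis of the fixed space, \<open>g\<close> is block diagonal.\<close>

lemma det_X:
  fixes k :: nat and b :: "nat \<Rightarrow> real^'s"
  assumes g: "g \<in> N" and b: "\<And>i. i < k \<Longrightarrow> b i \<in> X" and sp: "\<And>v. v \<in> X \<Longrightarrow> \<exists>a. v = (\<Sum>i<k. a i *\<^sub>R b i)"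
    and ind: "\<And>a i. (\<Sum>i<k. a i *\<^sub>R b i) = 0 \<Longrightarrow> i < k \<Longrightarrow> a i = 0"
    and c: "\<And>i. i < k \<Longrightarrow> b i v* g = (\<Sum>j<k. c i j *\<^sub>R b j)"
  shows "det g = plane_sgn g * (\<Sum>p | p permutes {..<k}. of_int (sign p) * (\<Prod>i<k. c i (p i)))"
proof -
  let ?J = "UNIV - {s,t}"
  have "k = card ?J" by (rule basis_card[of k b]) (erule b, erule sp, erule (1) ind)
  then have "card ?J = card {..<k}" by simp
  then obtain h where h: "bij_betw h ?J {..<k}" using finite_same_card_bij[of ?J "{..<k}"] by auto
  have hk: "h r < k" if "r \<notin> {s,t}" for r using h that unfolding bij_betw_def by auto
  \<comment> \<open>\<open>M\<close> has the adapted basis as rows. \<open>C1\<close> carries the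
    block of the plane and \<open>C2\<close> the block of \<open>X\<close>, each with identity rows
    elsewhere, so that \<open>det_rows_id\<close> computes both determinants.\<close>
  define M :: "'s mat" where "M = (\<chi> r. if r \<in> {s,t} then al r else b (h r))"
  define C1 :: "'s mat" where "C1 = (\<chi> i j. if i \<in> {s,t} then g $ i $ j else if i = j then 1 else 0)"
  define C2 :: "'s mat" where "C2 = (\<chi> i j. if i \<in> {s,t} then (if i = j then 1 else 0)
      else if j \<in> {s,t} then 0 else c (h i) (h j))"
  have row: "al r v* A = A $ r" for r and A :: "'s mat" by (simp add: vec_eq_iff)
  have vM: "x v* M = (\<Sum>r\<in>UNIV. (x $ r) *\<^sub>R M $ r)" for x
  proof -
    have "(x v* M) $ j = (\<Sum>r\<in>UNIV. (x $ r) *\<^sub>R M $ r) $ j" for j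
      by (simp add: vector_matrix_mult_def mult.commute)
    then show ?thesis by (simp add: vec_eq_iff)
  qed
  have split: "(\<Sum>r\<in>UNIV. f r) = f s + f t + (\<Sum>r\<in>?J. f r)" for f :: "'s \<Rightarrow> real^'s"
  proof -
    have "(\<Sum>r\<in>UNIV. f r) = (\<Sum>r\<in>?J. f r) + (\<Sum>r\<in>{s,t}. f r)" by (rule sum.subset_diff) auto
    then show ?thesis using st by (simp add: add.commute)
  qed
  have vM2: "x v* M = (x $ s) *\<^sub>R al s + (x $ t) *\<^sub>R al t + (\<Sum>r\<in>?J. (x $ r) *\<^sub>R b (h r))" for x
  proof -
    have "(\<Sum>r\<in>?J. (x $ r) *\<^sub>R M $ r) = (\<Sum>r\<in>?J. (x $ r) *\<^sub>R b (h r))"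
      by (rule sum.cong) (auto simp: M_def)
    then show ?thesis unfolding vM split by (simp add: M_def)
  qed
  have "M ** g = C1 ** C2 ** M"
  proof -
    have "al i v* (M ** g) = al i v* (C1 ** C2 ** M)" for i
    proof (cases "i \<in> {s,t}")
      case True
      have "al i v* (M ** g) = al i v* g"
        unfolding vector_matrix_mul_assoc[symmetric] row[of i M] using True by (simp add: M_def)
      also have "\<dots> = (g $ i $ s) *\<^sub>R al s + (g $ i $ t) *\<^sub>R al t" by (rule N_row(1)[OF g True])
      also have "\<dots> = (al i v* C1) v* C2 v* M"
      proof -
        have "al i v* C1 = al i v* g" unfolding row using True by (simp add: C1_def vec_eq_iff)
        then have 1: "al i v* C1 = (g $ i $ s) *\<^sub>R al s + (g $ i $ t) *\<^sub>R al t" using N_row(1)[OF g True] by simp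
        have 2: "al r v* C2 = al r" "al r v* M = al r" if "r \<in> {s,t}" for r
          unfolding row using that by (auto simp: C2_def M_def vec_eq_iff al_nth)
        show ?thesis unfolding 1 vector_matrix_left_distrib scaleR_vector_matrix_assoc by (simp add: 2)
      qed
      finally show ?thesis by (simp add: vector_matrix_mul_assoc)
    next
      case False
      have "al i v* (M ** g) = b (h i) v* g"
        unfolding vector_matrix_mul_assoc[symmetric] row[of i M] using False by (simp add: M_def)
      also have "\<dots> = (\<Sum>j<k. c (h i) j *\<^sub>R b j)" by (rule c[OF hk[OF False]])
      also have "\<dots> = (\<Sum>r\<in>?J. c (h i) (h r) *\<^sub>R b (h r))" by (rule sum.reindex_bij_betw[OF h, symmetric])
      also have "\<dots> = (al i v* C2) v* M"
        unfolding vM2 row[of i C2] using False by (simp add: C2_def)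
      also have "al i v* C2 = (al i v* C1) v* C2"
      proof -
        have "al i v* C1 = al i" unfolding row using False by (auto simp: C1_def vec_eq_iff al_nth)
        then show ?thesis by simp
      qed
      finally show ?thesis by (simp add: vector_matrix_mul_assoc)
    qed
    then show ?thesis unfolding row by (simp add: vec_eq_iff)
  qed
  then have "det M * det g = det C1 * det C2 * det M" by (metis det_mul)
  moreover have "det M \<noteq> 0"
  proof -
    \<comment> \<open>\<open>\<tau>\<close> vanishes on \<open>X\<close> and is injective on
      \<open>P\<close>, which separates the two parts of \<open>x v* M\<close>; independence of
      \<open>b\<close> settles the part in \<open>X\<close>.\<close>
    have "x = 0" if x: "x v* M = 0" for x
    proof -
      let ?y = "(\<Sum>r\<in>?J. (x $ r) *\<^sub>R b (h r))"
      have yX: "?y \<in> X" using b hk by (intro subspace_sum subspace_scale subspace_X) auto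
      have p: "(x $ s) *\<^sub>R al s + (x $ t) *\<^sub>R al t = - ?y" using x unfolding vM2 by (simp add: add_eq_0_iff2)
      have "\<tau> ((x $ s) *\<^sub>R al s + (x $ t) *\<^sub>R al t) = 0" unfolding p using yX by (simp add: X_iff \<tau>_minus)
      then have "x $ s + x $ t * \<epsilon> = 0" by (simp add: \<tau>_linear)
      then have st0: "x $ s = 0" "x $ t = 0" unfolding \<epsilon>_def complex_eq_iff by auto
      then have "?y = 0" using p by simp
      moreover have "?y = (\<Sum>i<k. x $ (inv_into ?J h i) *\<^sub>R b i)"
      proof -
        have "(\<Sum>i<k. x $ (inv_into ?J h i) *\<^sub>R b i) = (\<Sum>r\<in>?J. x $ (inv_into ?J h (h r)) *\<^sub>R b (h r))"
          by (rule sum.reindex_bij_betw[OF h, symmetric])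
        also have "\<dots> = ?y" using h unfolding bij_betw_def by (intro sum.cong) auto
        finally show ?thesis by simp
      qed
      ultimately have z: "x $ (inv_into ?J h i) = 0" if "i < k" for i using ind[of "\<lambda>i. x $ (inv_into ?J h i)"] that by simp
      have "x $ r = 0" for r
      proof (cases "r \<in> {s,t}")
        case True then show ?thesis using st0 by auto
      next
        case False
        then have "inv_into ?J h (h r) = r" using h unfolding bij_betw_def by auto
        then show ?thesis using z[OF hk[OF False]] by simp
      qed
      then show ?thesis by (simp add: vec_eq_iff)
    qed
    then have "\<exists>B. B ** transpose M = mat 1" unfolding matrix_left_invertible_ker by simp
    then have "invertible (transpose M)" using invertible_left_inverse by blast
    then show ?thesis using invertible_det_nz det_transpose by metis
  qed
  ultimately have "det g = det C1 * det C2" by (simp add: mult.commute)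
  moreover have "det C1 = plane_sgn g"
  proof -
    have "det C1 = (\<Sum>p | p permutes {s,t}. of_int (sign p) * (\<Prod>i\<in>{s,t}. C1 $ i $ p i))"
      by (rule det_rows_id) (auto simp: C1_def)
    also have "\<dots> = (\<Prod>i\<in>{s,t}. C1 $ i $ i) - (\<Prod>i\<in>{s,t}. C1 $ i $ Transposition.transpose s t i)"
    proof -
      have "id \<noteq> Transposition.transpose s t" using st by (metis id_apply transpose_apply_first)
      then show ?thesis unfolding permutes_pair[OF st] using st by (simp add: sign_id sign_swap_id)
    qed
    also have "\<dots> = g $ s $ s * g $ t $ t - g $ s $ t * g $ t $ s" using st by (simp add: C1_def)
    finally show ?thesis using plane_det[OF g] by simp
  qed
  moreover have "det C2 = (\<Sum>p | p permutes {..<k}. of_int (sign p) * (\<Prod>i<k. c i (p i)))"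
  proof -
    have "det C2 = (\<Sum>p | p permutes ?J. of_int (sign p) * (\<Prod>i\<in>?J. C2 $ i $ p i))"
      by (rule det_rows_id) (auto simp: C2_def)
    also have "\<dots> = (\<Sum>p | p permutes ?J. of_int (sign p) * (\<Prod>i\<in>?J. c (h i) (h (p i))))"
    proof (intro sum.cong refl arg_cong2[of _ _ _ _ "(*)"] prod.cong)
      fix p i assume "p \<in> {p. p permutes ?J}" "i \<in> ?J"
      then have "p i \<in> ?J" by (metis mem_Collect_eq permutes_in_image)
      then show "C2 $ i $ p i = c (h i) (h (p i))" using \<open>i \<in> ?J\<close> by (simp add: C2_def)
    qed
    also have "\<dots> = (\<Sum>p | p permutes {..<k}. of_int (sign p) * (\<Prod>i<k. c i (p i)))"
      by (rule sum_permutes_transport[OF h]) simp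
    finally show ?thesis .
  qed
  ultimately show ?thesis by simp
qed

lemma alphaL_eq: assumes g: "g \<in> N" shows "alphaL m {s,t} g = of_real (plane_sgn g * det g)"
proof -
  have sq: "plane_sgn g * plane_sgn g = 1" by (simp add: plane_sgn_def)
  have "det_on X (\<lambda>v. v v* g) = plane_sgn g * det g"
    unfolding det_on_def
  proof (rule the_equality)
    obtain Bs where Bs: "Bs \<subseteq> X" "independent Bs" "X \<subseteq> span Bs" "card Bs = dim X" using basis_exists by blast
    have fB: "finite Bs" using Bs(2) independent_imp_finite by blast
    obtain b where b: "bij_betw b {..<card Bs} Bs"
      using ex_bij_betw_nat_finite[OF fB] by (auto simp: atLeast0LessThan)
    define k where "k = card Bs"
    have b: "bij_betw b {..<k} Bs" using b k_def by simp
    have inj: "inj_on b {..<k}" and im: "b ` {..<k} = Bs" using b unfolding bij_betw_def by auto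
    have bX: "b i \<in> X" if "i < k" for i using im Bs(1) that by auto
    have sp: "\<exists>a. v = (\<Sum>i<k. a i *\<^sub>R b i)" if "v \<in> X" for v
    proof -
      have "v \<in> span Bs" using Bs(3) that by blast
      then obtain u where "v = (\<Sum>x\<in>Bs. u x *\<^sub>R x)" unfolding span_finite[OF fB] by auto
      then have "v = (\<Sum>i<k. u (b i) *\<^sub>R b i)" using sum.reindex_bij_betw[OF b, of "\<lambda>x. u x *\<^sub>R x"] by simp
      then show ?thesis by (rule exI[of _ "\<lambda>i. u (b i)"])
    qed
    have ind: "a i = 0" if a: "(\<Sum>i<k. a i *\<^sub>R b i) = 0" and i: "i < k" for a i
    proof (rule ccontr)
      assume "a i \<noteq> 0"
      define u where "u x = a (inv_into {..<k} b x)" for x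
      have ub: "u (b j) = a j" if "j < k" for j using inj that by (simp add: u_def)
      have "(\<Sum>x\<in>Bs. u x *\<^sub>R x) = (\<Sum>j<k. u (b j) *\<^sub>R b j)" by (rule sum.reindex_bij_betw[OF b, symmetric])
      also have "\<dots> = 0" using a ub by simp
      finally have "(\<Sum>x\<in>Bs. u x *\<^sub>R x) = 0" .
      moreover have "b i \<in> Bs" "u (b i) \<noteq> 0" using im i ub[OF i] \<open>a i \<noteq> 0\<close> by auto
      ultimately have "dependent Bs" unfolding dependent_finite[OF fB] by blast
      then show False using Bs(2) by simp
    qed
    have "\<forall>i. \<exists>ci. i < k \<longrightarrow> b i v* g = (\<Sum>j<k. ci j *\<^sub>R b j)" using sp N_X[OF g bX] by blast
    then obtain c where c: "\<And>i. i < k \<Longrightarrow> b i v* g = (\<Sum>j<k. c i j *\<^sub>R b j)" by metis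
    have "det g = plane_sgn g * (\<Sum>p | p permutes {..<k}. of_int (sign p) * (\<Prod>i<k. c i (p i)))"
      by (rule det_X[OF g, of k b c]) (erule bX, erule sp, erule (1) ind, erule c)
    then have sd: "plane_sgn g * det g = (\<Sum>p | p permutes {..<k}. of_int (sign p) * (\<Prod>i<k. c i (p i)))"
      using sq by (simp flip: mult.assoc)
    show "\<exists>(n::nat) b c. (\<forall>i<n. b i \<in> X) \<and> (\<forall>v\<in>X. \<exists>a. v = (\<Sum>i<n. a i *\<^sub>R b i))
      \<and> (\<forall>a. (\<Sum>i<n. a i *\<^sub>R b i) = 0 \<longrightarrow> (\<forall>i<n. a i = 0))
      \<and> (\<forall>i<n. b i v* g = (\<Sum>j<n. c i j *\<^sub>R b j))
      \<and> plane_sgn g * det g = (\<Sum>p | p permutes {..<n}. of_int (sign p) * (\<Prod>i<n. c i (p i)))"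
    proof (rule exI[of _ k], rule exI[of _ b], rule exI[of _ c], intro conjI allI impI ballI)
      show "(\<Sum>i<k. a i *\<^sub>R b i) = 0 \<Longrightarrow> i < k \<Longrightarrow> a i = 0" for a i by (erule (1) ind)
    qed (use bX sp c sd in auto)
  next
    fix d assume "\<exists>(n::nat) b c. (\<forall>i<n. b i \<in> X) \<and> (\<forall>v\<in>X. \<exists>a. v = (\<Sum>i<n. a i *\<^sub>R b i))
      \<and> (\<forall>a. (\<Sum>i<n. a i *\<^sub>R b i) = 0 \<longrightarrow> (\<forall>i<n. a i = 0))
      \<and> (\<forall>i<n. b i v* g = (\<Sum>j<n. c i j *\<^sub>R b j))
      \<and> d = (\<Sum>p | p permutes {..<n}. of_int (sign p) * (\<Prod>i<n. c i (p i)))"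
    then obtain k :: nat and b c where *: "\<forall>i<k. b i \<in> X" "\<forall>v\<in>X. \<exists>a. v = (\<Sum>i<k. a i *\<^sub>R b i)"
      "\<forall>a. (\<Sum>i<k. a i *\<^sub>R b i) = 0 \<longrightarrow> (\<forall>i<k. a i = 0)" "\<forall>i<k. b i v* g = (\<Sum>j<k. c i j *\<^sub>R b j)"
      "d = (\<Sum>p | p permutes {..<k}. of_int (sign p) * (\<Prod>i<k. c i (p i)))" by (elim exE conjE)
    have "det g = plane_sgn g * d" unfolding *(5) by (rule det_X[OF g]) (use * in blast)+
    then show "d = plane_sgn g * det g" using sq by (simp flip: mult.assoc)
  qed
  then show ?thesis by (simp add: alphaL_def)
qed

lemma eps_alphaL: assumes "g \<in> N" shows "eps g * alphaL m {s,t} g = of_real (plane_sgn g)"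
proof -
  have "eps g * alphaL m {s,t} g = of_real (plane_sgn g * (det g * det g))"
    unfolding alphaL_eq[OF assms] eps_def by (simp add: mult_ac)
  then show ?thesis using det_W_sq[OF N_W[OF assms]] by simp
qed

end

section \<open>Induced characters\<close>

text \<open>For odd \<open>n\<close> the only square root that is an \<open>n\<close>-th root of
  unity is \<open>z ^ ((n + 1) div 2)\<close>. For even \<open>n\<close> every square root satisfies
  \<open>x ^ n = z ^ (n div 2)\<close>, which is 1 or -1, so either both square roots count or
  none.\<close>

lemma card_sqrt_roots:
  fixes z :: complex
  assumes n: "0 < n" and z: "z ^ n = 1"
  shows "(of_nat (card {x::complex. x ^ n = 1 \<and> x * x = z}) :: complex) = 1 + (if even n then z ^ (n div 2) else 0)"
proof (cases "even n")
  case False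
  then obtain j where j: "n = 2 * j + 1" using oddE by blast
  have "x = z ^ (j + 1)" if "x ^ n = 1" "x * x = z" for x
  proof -
    have "z ^ (j + 1) = x ^ (2 * (j + 1))" using that(2) by (simp add: power_mult power2_eq_square)
    also have "\<dots> = x ^ n * x" by (simp add: j)
    finally show ?thesis using that by simp
  qed
  moreover have "(z ^ (j + 1)) ^ n = 1" using z by (metis mult.commute power_mult power_one)
  moreover have "z ^ (j + 1) * z ^ (j + 1) = z"
  proof -
    have "z ^ (j + 1) * z ^ (j + 1) = z ^ n * z" by (simp add: j flip: power_add) (simp add: mult_2)
    then show ?thesis using z by simp
  qed
  ultimately have "{x::complex. x ^ n = 1 \<and> x * x = z} = {z ^ (j + 1)}" by blast
  then show ?thesis using False by simp
next
  case True
  then obtain j where j: "n = 2 * j" by blast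
  have xn: "x ^ n = z ^ j" if "x * x = z" for x using that by (simp add: j power_mult power2_eq_square)
  have "z ^ j * z ^ j = 1" using z by (simp add: j mult_2 power_add)
  then have "z ^ j = 1 \<or> z ^ j = -1" by (metis square_eq_1_iff)
  then show ?thesis
  proof
    assume 1: "z ^ j = 1"
    define c where "c = csqrt z"
    have c: "c * c = z" unfolding c_def by (metis power2_csqrt power2_eq_square)
    have "c \<noteq> 0" using c z n by (auto simp: power_0_left)
    have "{x::complex. x ^ n = 1 \<and> x * x = z} = {c, -c}"
      using xn 1 c square_eq_iff[of _ c] by auto
    moreover have "c \<noteq> - c" using \<open>c \<noteq> 0\<close> by simp
    ultimately show ?thesis using True 1 j by simp
  next
    assume m1: "z ^ j = -1"
    then have "{x::complex. x ^ n = 1 \<and> x * x = z} = {}" using xn by auto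
    then have "card {x::complex. x ^ n = 1 \<and> x * x = z} = 0" by (simp only: card.empty)
    then show ?thesis using True m1 j by simp
  qed
qed

context finite_rank2
begin

lemma count_refl: assumes "z \<in> R"
  shows "(of_nat (card {x\<in>R. z * cnj x = x}) :: complex) = 1 + (if even n then z ^ (n div 2) else 0)"
proof -
  have "z * cnj x = x \<longleftrightarrow> x * x = z" if "x \<in> R" for x
  proof -
    have x: "x * cnj x = 1" using root_norm1 that by simp
    show ?thesis
    proof
      assume "z * cnj x = x"
      then have "x * x = z * (x * cnj x)" by (metis mult.assoc mult.commute)
      then show "x * x = z" using x by simp
    next
      assume "x * x = z"
      then have "z * cnj x = x * (x * cnj x)" by (simp add: mult.assoc)
      then show "z * cnj x = x" using x by simp
    qed
  qed
  then have "{x\<in>R. z * cnj x = x} = {x. x ^ n = 1 \<and> x * x = z}" by auto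
  then show ?thesis using card_sqrt_roots[OF n_pos] assms by simp
qed

text \<open>Multiplication by \<open>z\<close> fixes all \<open>n\<close> roots or none, and so does
  the geometric sum take the value \<open>n\<close> or 0.\<close>

lemma count_rot: assumes "z \<in> R"
  shows "(of_nat (card {x\<in>R. z * x = x}) :: complex) - 1 = (\<Sum>k\<in>{1..<n}. z ^ k)"
proof -
  have s: "(\<Sum>k<n. z ^ k) = 1 + (\<Sum>k\<in>{1..<n}. z ^ k)"
  proof -
    have "{..<n} = insert 0 {1..<n}" using n_pos by auto
    then show ?thesis by simp
  qed
  have "(of_nat (card {x\<in>R. z * x = x}) :: complex) = (\<Sum>k<n. z ^ k)"
  proof (cases "z = 1")
    case True then show ?thesis using card_roots by simp
  next
    case False
    have "{x\<in>R. z * x = x} = {}" using False n_pos by (auto simp: power_0_left)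
    then have "card {x\<in>R. z * x = x} = 0" by (simp only: card.empty)
    moreover have "(\<Sum>k<n. z ^ k) = 0" using geometric_sum[OF False, of n] assms by simp
    ultimately show ?thesis by (simp only: of_nat_0)
  qed
  then show ?thesis using s by simp
qed

text \<open>The common shape of the two characters: \<open>e\<close> is 1 for \<open>PsiT\<close>
  and -1 for \<open>PhiT\<close>. On reversing elements only the exponent of the half turn
  contributes.\<close>

definition ind_val :: "complex \<Rightarrow> 's mat \<Rightarrow> complex" where
  "ind_val e g = (if ori g then (\<Sum>k\<in>{1..<n}. mu g ^ k) else if even n then e * mu g ^ (n div 2) else 0)"

lemma Psi_Val: assumes "g \<in> N" shows "PsiT m {s,t} g = ind_val 1 g"
proof -
  have "mu g \<in> R" using mu_root[OF assms] by simp
  then show ?thesis unfolding PsiT_eq[OF assms] ind_val_def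
    using count_rot[of "mu g"] count_refl[of "mu g"] by simp
qed

lemma Phi_Val: assumes "g \<in> N" shows "PhiT m {s,t} g = ind_val (-1) g"
proof -
  have mR: "mu g \<in> R" using mu_root[OF assms] by simp
  then have mz: "mu g * \<zeta> \<in> R" using \<zeta>_n by (simp add: power_mult_distrib)
  \<comment> \<open>The factor \<open>\<zeta>\<close> in \<open>lab_act\<close> is thereby turned
    into the sign \<open>e = -1\<close>.\<close>
  have "\<zeta> ^ (n div 2) = -1" if "even n"
  proof -
    have "real (n div 2) * (2 * \<theta>) = pi" using n\<theta> that by (auto simp: real_of_nat_div)
    then show ?thesis unfolding \<zeta>_def Complex.DeMoivre by simp
  qed
  then have "even n \<Longrightarrow> (mu g * \<zeta>) ^ (n div 2) = - (mu g ^ (n div 2))" by (simp add: power_mult_distrib)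
  then show ?thesis unfolding PhiT_eq[OF assms] ind_val_def lab_act_def
    using count_rot[OF mR] count_refl[OF mz] by simp
qed

text \<open>The cuspidal elements of \<open>WL\<close> are the nontrivial rotations of the plane.\<close>

definition rot_cls :: "'s mat \<Rightarrow> 's mat set" where
  "rot_cls w = {u \<in> WL. ori u \<and> (lam u = lam w \<or> lam u = cnj (lam w))}"

definition rots :: "'s mat set" where "rots = {w \<in> WL. ori w \<and> lam w \<noteq> 1}"

lemma rots_D: "w \<in> rots \<Longrightarrow> w \<in> WL" "w \<in> rots \<Longrightarrow> ori w" "w \<in> rots \<Longrightarrow> lam w ^ n = 1"
  using WL_ulam[of w] by (auto simp: rots_def ulam_def)

lemma conj_rot_cls: assumes "w \<in> rots" shows "(\<lambda>x. conj w x) ` WL = rot_cls w"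
proof (intro set_eqI iffI)
  fix u assume "u \<in> (\<lambda>x. conj w x) ` WL"
  then obtain x where x: "x \<in> WL" "u = iv x ** w ** x" unfolding conj_def by blast
  then show "u \<in> rot_cls w" using N_conj(2)[OF WL_N[OF x(1)]] lam_conj[OF WL_N[OF x(1)]] rots_D[OF assms]
    unfolding rot_cls_def by auto
next
  fix u assume u: "u \<in> rot_cls w"
  have w: "w \<in> WL" "ori w" using rots_D assms by auto
  have s: "\<sigma> s \<in> WL" "\<sigma> s \<in> N" by (simp_all add: sref_WJ)
  have "u = conj w (mat 1) \<or> u = conj w (\<sigma> s)"
  proof (cases "lam u = lam w")
    case True
    then have "u = w" using u w WL_unique unfolding rot_cls_def by blast
    then show ?thesis by (simp add: conj_def)
  next
    case False
    then have "u = iv (\<sigma> s) ** w ** \<sigma> s"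
      using u w s N_conj(2)[OF s(2) w(1)] lam_conj[OF s(2) w(1)] \<sigma>_act unfolding rot_cls_def
      by (intro WL_unique) auto
    then show ?thesis by (simp add: conj_def)
  qed
  then show "u \<in> (\<lambda>x. conj w x) ` WL" using s by auto
qed

lemma cusp_classes_eq: "cusp_classes m {s,t} = rot_cls ` rots"
proof -
  have "cusp_classes m {s,t} = (\<lambda>w. (\<lambda>x. conj w x) ` WL) ` rots"
    unfolding cusp_classes_def cuspidal_iff rots_def by blast
  then show ?thesis using conj_rot_cls by (simp cong: image_cong)
qed

lemma rot_cls_eq: "u \<in> rot_cls w \<Longrightarrow> rot_cls u = rot_cls w"
  unfolding rot_cls_def by auto

lemma rot_cls_self: "w \<in> rots \<Longrightarrow> w \<in> rot_cls w" unfolding rot_cls_def rots_def by simp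

lemma rot_cls_sub: assumes "w \<in> rots" shows "rot_cls w \<subseteq> rots"
proof -
  have "cnj (lam w) \<noteq> 1" using assms by (simp add: rots_def)
  then show ?thesis using assms unfolding rot_cls_def rots_def by auto
qed

lemma finite_rots: "finite rots" using WJ_sub by (intro fin_sub) (auto simp: rots_def)

lemma sum_classes: "(\<Sum>C\<in>rot_cls ` rots. \<Sum>u\<in>C. H u) = (\<Sum>u\<in>rots. H u :: complex)"
proof -
  have "\<Union>(rot_cls ` rots) = rots" using rot_cls_self rot_cls_sub by blast
  moreover have "(\<Sum>u\<in>\<Union>(rot_cls ` rots). H u) = (\<Sum>C\<in>rot_cls ` rots. \<Sum>u\<in>C. H u)"
  proof (subst sum.Union_disjoint)
    show "\<forall>A\<in>rot_cls ` rots. finite A" using finite_rots rot_cls_sub finite_subset by blast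
    show "\<forall>A\<in>rot_cls ` rots. \<forall>B\<in>rot_cls ` rots. A \<noteq> B \<longrightarrow> A \<inter> B = {}" using rot_cls_eq by blast
  qed simp
  ultimately show ?thesis by simp
qed

definition rot_idx :: "'s mat \<Rightarrow> nat" where "rot_idx w = (THE k. k < n \<and> lam w = \<zeta> ^ k)"

lemma \<zeta>_bij: "bij_betw (\<lambda>k. \<zeta> ^ k) {..<n} R"
proof -
  have "(\<lambda>k. \<zeta> ^ k) = (\<lambda>k. cis (2 * pi * real k / real n))"
    unfolding \<zeta>_def Complex.DeMoivre \<theta>_def by (simp add: mult_ac)
  then show ?thesis using Complex.bij_betw_roots_unity[OF n_pos] by simp
qed

lemma \<zeta>_inj: "k < n \<Longrightarrow> l < n \<Longrightarrow> \<zeta> ^ k = \<zeta> ^ l \<longleftrightarrow> k = l"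
  using \<zeta>_bij unfolding bij_betw_def inj_on_def by auto

lemma rot_idx_I: "k < n \<Longrightarrow> lam w = \<zeta> ^ k \<Longrightarrow> rot_idx w = k"
  unfolding rot_idx_def by (rule the_equality) (auto simp: \<zeta>_inj)

lemma rot_idx: assumes "w \<in> rots" shows "0 < rot_idx w" "rot_idx w < n" "lam w = \<zeta> ^ rot_idx w"
proof -
  have "lam w \<in> (\<lambda>k. \<zeta> ^ k) ` {..<n}"
    using \<zeta>_bij rots_D(3)[OF assms] unfolding bij_betw_def by simp
  then obtain k where k: "k < n" "lam w = \<zeta> ^ k" by auto
  then have i: "rot_idx w = k" by (rule rot_idx_I)
  then show "rot_idx w < n" "lam w = \<zeta> ^ rot_idx w" using k by auto
  have "k \<noteq> 0" using k assms unfolding rots_def by (metis (mono_tags, lifting) mem_Collect_eq power_0)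
  then show "0 < rot_idx w" using i by simp
qed

lemma rot_idx_bij: "bij_betw rot_idx rots {1..<n}"
  unfolding bij_betw_def
proof
  show "inj_on rot_idx rots"
  proof (rule inj_onI)
    fix u w assume "u \<in> rots" "w \<in> rots" "rot_idx u = rot_idx w"
    then show "u = w" using rot_idx(3) rots_D(1,2) by (intro WL_unique) auto
  qed
  show "rot_idx ` rots = {1..<n}"
  proof
    show "rot_idx ` rots \<subseteq> {1..<n}" using rot_idx(1,2) by force
    show "{1..<n} \<subseteq> rot_idx ` rots"
    proof
      fix k assume k: "k \<in> {1..<n}"
      have "(\<zeta> ^ k) ^ n = 1" using \<zeta>_n by (metis mult.commute power_mult power_one)
      then obtain w where w: "w \<in> WL" "ori w = True" "ulam w = \<zeta> ^ k" using WL_ex by blast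
      have "\<zeta> ^ k \<noteq> 1" using \<zeta>_inj[of k 0] k by auto
      then have "w \<in> rots" "lam w = \<zeta> ^ k" using w by (auto simp: rots_def ulam_def)
      then show "k \<in> rot_idx ` rots" using rot_idx_I k by (intro image_eqI[of _ _ w]) auto
    qed
  qed
qed

text \<open>A nontrivial rotation has \<open>X\<close> as its exact fixed space, so whatever
  commutes with it preserves \<open>X\<close>. Conjugates of \<open>WL\<close> by such elements then
  fix \<open>X\<close> pointwise and lie in \<open>WL\<close> by
  \<open>Fix_stabilizer\<close>.\<close>

lemma centralizer_N: assumes "w \<in> rots" "x \<in> W" "x ** w = w ** x" shows "x \<in> N"
proof -
  have w: "w \<in> WL" "ori w" "lam w \<noteq> 1" using assms(1) by (auto simp: rots_def)
  have wW: "w \<in> W" using w WJ_sub by blast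
  have fixw: "v v* w = v \<longleftrightarrow> v \<in> X" for v
  proof
    assume "v v* w = v"
    then have "lam w * \<tau> v = \<tau> v" using act_\<tau>[OF WL_N[OF w(1)], of v] w(2) by (simp add: act_def)
    then show "v \<in> X" using w(3) by (simp add: X_iff)
  next
    assume "v \<in> X" then show "v v* w = v" using w(1) unfolding Fix_def by blast
  qed
  have pres: "v v* y \<in> X" if "y \<in> W" "y ** w = w ** y" "v \<in> X" for v y
  proof -
    have "v v* y v* w = v v* w v* y" using that(2) by (simp add: vector_matrix_mul_assoc)
    then show ?thesis using fixw that(3) by metis
  qed
  have cj: "y ** u ** iv y \<in> WL" if y: "y \<in> W" "y ** w = w ** y" and u: "u \<in> WL" for y u
  proof (rule Fix_stabilizer)
    show "y ** u ** iv y \<in> W" using y u WJ_sub by (auto intro!: WJ_mult WJ_inv)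
    show "\<forall>v\<in>X. v v* (y ** u ** iv y) = v"
    proof
      fix v assume "v \<in> X"
      then have "v v* y \<in> X" using pres y by blast
      then have "v v* y v* u = v v* y" using u unfolding Fix_def by blast
      then have "v v* y v* u v* iv y = v" using y by simp
      then show "v v* (y ** u ** iv y) = v" by (simp add: vector_matrix_mul_assoc)
    qed
  qed
  have ivx: "iv x \<in> W" "iv x ** w = w ** iv x"
  proof -
    show "iv x \<in> W" using assms(2) by (rule WJ_inv)
    have "iv x ** w = iv x ** (w ** x) ** iv x" using assms(2) by (simp add: matrix_mul_assoc)
    also have "\<dots> = iv x ** (x ** w) ** iv x" using assms(3) by simp
    also have "\<dots> = w ** iv x" using assms(2) by (simp add: matrix_mul_assoc)
    finally show "iv x ** w = w ** iv x" .
  qed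
  show ?thesis using cj[OF assms(2,3)] cj[OF ivx] assms(2) by (intro N_I) simp_all
qed

lemma \<zeta>_cnj: "cnj (\<zeta> ^ k) = \<zeta> ^ l" if "k + l = n" for k l
proof -
  have "\<zeta> ^ k * cnj (\<zeta> ^ k) = 1" using root_norm1 \<zeta>_n by (metis mult.commute power_mult power_one)
  moreover have "\<zeta> ^ k * \<zeta> ^ l = 1" using \<zeta>_n that by (simp flip: power_add)
  moreover have "\<zeta> ^ k \<noteq> 0" by (simp add: \<zeta>_def)
  ultimately show ?thesis by (metis mult_left_cancel)
qed

text \<open>A reversing element inverts every rotation, so it commutes with \<open>w\<close> only if
  \<open>w\<close> is the half turn.\<close>

lemma centralizer_eq: assumes "w \<in> rots"
  shows "centralizer m w = {x \<in> N. ori x \<or> 2 * rot_idx w = n}"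
proof -
  have w: "w \<in> WL" "ori w" using assms by (auto simp: rots_def)
  have r: "cnj (lam w) = lam w \<longleftrightarrow> 2 * rot_idx w = n"
  proof -
    have "cnj (lam w) = \<zeta> ^ (n - rot_idx w)" using rot_idx[OF assms] \<zeta>_cnj[of "rot_idx w" "n - rot_idx w"] by simp
    then have "cnj (lam w) = lam w \<longleftrightarrow> n - rot_idx w = rot_idx w"
      using rot_idx[OF assms] \<zeta>_inj[of "n - rot_idx w" "rot_idx w"] by simp
    then show ?thesis using rot_idx(2)[OF assms] by auto
  qed
  have "x ** w = w ** x \<longleftrightarrow> ori x \<or> 2 * rot_idx w = n" if x: "x \<in> N" for x
  proof -
    have W: "x \<in> W" using N_W[OF x] .
    have "x ** w = w ** x \<longleftrightarrow> iv x ** w ** x = w"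
    proof
      assume "x ** w = w ** x"
      then have "iv x ** (x ** w) = iv x ** w ** x" by (simp add: matrix_mul_assoc)
      then show "iv x ** w ** x = w" using W by simp
    next
      assume "iv x ** w ** x = w"
      then have "x ** (iv x ** w ** x) = x ** w" by simp
      then show "x ** w = w ** x" using W by (simp add: matrix_mul_assoc)
    qed
    also have "\<dots> \<longleftrightarrow> lam (iv x ** w ** x) = lam w"
      using WL_unique[OF N_conj(2)[OF x w(1)] w(1) lam_conj(1)[OF x w(1)]] by auto
    also have "\<dots> \<longleftrightarrow> ori x \<or> 2 * rot_idx w = n" unfolding lam_conj[OF x w(1)] using w r by auto
    finally show ?thesis .
  qed
  then show ?thesis unfolding centralizer_def using centralizer_N[OF assms] N_W by blast
qed

section \<open>Linear characters of the centralizers and their induction\<close>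

definition rot_chr :: "complex \<Rightarrow> nat \<Rightarrow> 's mat \<Rightarrow> complex" where
  "rot_chr e k x = (if ori x then 1 else e) * mu x ^ k"

lemma mu_mult: assumes "x \<in> N" "y \<in> N" shows "mu (x ** y) = mu y * (if ori y then mu x else cnj (mu x))"
  unfolding act_mult[OF assms] act_def by simp

text \<open>A reversing factor replaces \<open>mu x\<close> by its conjugate. This is harmless when
  \<open>2 * k = n\<close>, because then \<open>mu x ^ k\<close> is 1 or -1.\<close>

lemma rot_chr_mult: assumes e: "e * e = 1" and xy: "x \<in> N" "y \<in> N" and k: "(ori x \<and> ori y) \<or> 2 * k = n"
  shows "rot_chr e k (x ** y) = rot_chr e k x * rot_chr e k y"
proof (cases "ori x \<and> ori y")
  case True
  then show ?thesis unfolding rot_chr_def using act_mult(2)[OF xy] mu_mult[OF xy]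
    by (simp add: power_mult_distrib mult_ac)
next
  case False
  then have k: "2 * k = n" using k by blast
  have "mu x ^ k * mu x ^ k = 1" using mu_root[OF xy(1)] by (simp flip: k add: mult_2 power_add)
  then have "mu x ^ k = 1 \<or> mu x ^ k = -1" by (metis square_eq_1_iff)
  then have c: "cnj (mu x) ^ k = mu x ^ k" by (metis complex_cnj_minus complex_cnj_one complex_cnj_power)
  have "mu (x ** y) ^ k = mu x ^ k * mu y ^ k"
    unfolding mu_mult[OF xy] using c by (auto simp: power_mult_distrib mult_ac)
  moreover have "(if ori (x ** y) then 1 else e) = (if ori x then 1 else e) * (if ori y then 1 else e)"
    using act_mult(2)[OF xy] e by auto
  ultimately show ?thesis unfolding rot_chr_def by (simp add: mult_ac)
qed

lemma rot_chr_lin_char: assumes "e * e = 1" "w \<in> rots" shows "lin_char (centralizer m w) (rot_chr e (rot_idx w))"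
  unfolding lin_char_def centralizer_eq[OF assms(2)]
proof (intro conjI ballI)
  have "e \<noteq> 0" using assms(1) by auto
  then show "rot_chr e (rot_idx w) x \<noteq> 0" if "x \<in> {x \<in> N. ori x \<or> 2 * rot_idx w = n}" for x
    using lam_nz[of x] that by (auto simp: rot_chr_def)
  show "rot_chr e (rot_idx w) (x ** y) = rot_chr e (rot_idx w) x * rot_chr e (rot_idx w) y"
    if "x \<in> {x \<in> N. ori x \<or> 2 * rot_idx w = n}" "y \<in> {x \<in> N. ori x \<or> 2 * rot_idx w = n}" for x y
    using that by (intro rot_chr_mult[OF assms(1)]) auto
qed

lemma N_card: "card {x\<in>N. \<not> ori x} = card {x\<in>N. ori x}" "finite N" "card {x\<in>N. ori x} \<noteq> 0"
proof -
  show f: "finite N" using N_W by (intro fin_sub) blast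
  have "bij_betw (\<lambda>x. \<sigma> s ** x) {x\<in>N. \<not> ori x} {x\<in>N. ori x}"
    by (rule bij_betw_byWitness[where f' = "\<lambda>x. \<sigma> s ** x"])
      (auto simp: N_mult act_mult \<sigma>_act)
  then show "card {x\<in>N. \<not> ori x} = card {x\<in>N. ori x}" by (rule bij_betw_same_card)
  have "mat 1 \<in> {x\<in>N. ori x}" using one_act by simp
  moreover have "finite {x\<in>N. ori x}" using f by simp
  ultimately show "card {x\<in>N. ori x} \<noteq> 0" by (metis card_0_eq empty_iff)
qed

lemma N_conj_act: assumes "x \<in> N" "g \<in> N"
  shows "x ** g ** iv x \<in> N" "ori (x ** g ** iv x) = ori g"
    "ori g \<Longrightarrow> mu (x ** g ** iv x) = (if ori x then mu g else cnj (mu g))"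
proof -
  let ?y = "x ** g ** iv x"
  show y: "?y \<in> N" using assms by (intro N_mult N_inv)
  have e: "?y ** x = x ** g" using N_W[OF assms(1)] by simp
  have o: "ori (?y ** x) = ori (x ** g)" "lam (?y ** x) = lam (x ** g)" using e by simp_all
  then show "ori ?y = ori g" using act_mult(2)[OF y assms(1)] act_mult(2)[OF assms] by auto
  assume g: "ori g"
  have "lam x * (if ori x then lam ?y else cnj (lam ?y)) = lam x * lam g"
    using o(2) g unfolding act_mult(1)[OF y assms(1)] act_mult(1)[OF assms] act_def by (auto simp: mult.commute)
  then have "(if ori x then lam ?y else cnj (lam ?y)) = lam g" using lam_nz[OF assms(1)] by simp
  then have "lam ?y = (if ori x then lam g else cnj (lam g))" by (metis complex_cnj_cnj)
  then show "mu ?y = (if ori x then mu g else cnj (mu g))" by simp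
qed

text \<open>For the half turn the centralizer is all of \<open>N\<close> and its class is a single
  element. Otherwise the centralizer consists of the orientation preserving elements, half of
  \<open>N\<close>: the induced value is \<open>mu g ^ k\<close> plus its conjugate
  \<open>mu g ^ (n - k)\<close> on these and 0 on the others, and the class consists of the
  rotations with exponents \<open>k\<close> and \<open>n - k\<close>. Writing the value as a sum
  over the class lets the classes be merged into one sum over all exponents.\<close>

lemma Ind_rot_chr: assumes e: "e * e = 1" and w: "w \<in> rots" and g: "g \<in> N"
  shows "Ind (centralizer m w) N (rot_chr e (rot_idx w)) g =
    (\<Sum>u\<in>rot_cls w. if ori g then mu g ^ rot_idx u else if 2 * rot_idx u = n then e * mu g ^ rot_idx u else 0)"
proof (cases "2 * rot_idx w = n")
  case True
  have H: "centralizer m w = N" unfolding centralizer_eq[OF w] using True by simp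
  have "rot_chr e (rot_idx w) (x ** g ** iv x) = rot_chr e (rot_idx w) g" if x: "x \<in> N" for x
  proof -
    have "rot_chr e (rot_idx w) (x ** g ** iv x) * rot_chr e (rot_idx w) x = rot_chr e (rot_idx w) (x ** g ** iv x ** x)"
      using True x g N_conj_act(1)[OF x g] by (intro rot_chr_mult[OF e, symmetric]) auto
    also have "\<dots> = rot_chr e (rot_idx w) (x ** g)" using N_W[OF x] by simp
    also have "\<dots> = rot_chr e (rot_idx w) x * rot_chr e (rot_idx w) g" using True x g by (intro rot_chr_mult[OF e]) auto
    finally have "rot_chr e (rot_idx w) (x ** g ** iv x) * rot_chr e (rot_idx w) x = rot_chr e (rot_idx w) g * rot_chr e (rot_idx w) x"
      by (simp add: mult.commute)
    moreover have "rot_chr e (rot_idx w) x \<noteq> 0" using rot_chr_lin_char[OF e w] x unfolding lin_char_def H by blast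
    ultimately show ?thesis by simp
  qed
  then have "(\<Sum>x\<in>N. if x ** g ** iv x \<in> N then rot_chr e (rot_idx w) (x ** g ** iv x) else 0) = (\<Sum>x\<in>N. rot_chr e (rot_idx w) g)"
    using N_conj_act(1)[OF _ g] by (intro sum.cong) auto
  then have I: "Ind (centralizer m w) N (rot_chr e (rot_idx w)) g = rot_chr e (rot_idx w) g"
  proof -
    have "card N \<noteq> 0" using N_card(2) N_one by (metis card_0_eq empty_iff)
    then show ?thesis
      unfolding Ind_def H
      using \<open>(\<Sum>x\<in>N. if x ** g ** iv x \<in> N then rot_chr e (rot_idx w) (x ** g ** iv x) else 0) = (\<Sum>x\<in>N. rot_chr e (rot_idx w) g)\<close>
      by simp
  qed
  have "rot_cls w = {w}"
  proof -
    have "cnj (lam w) = lam w" using \<zeta>_cnj[of "rot_idx w" "rot_idx w"] True rot_idx(3)[OF w] by simp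
    then show ?thesis using rots_D[OF w] WL_unique unfolding rot_cls_def by auto
  qed
  then show ?thesis unfolding I using True by (simp add: rot_chr_def)
next
  case False
  let ?k = "rot_idx w"
  have k: "0 < ?k" "?k < n" "lam w = \<zeta> ^ ?k" using rot_idx[OF w] by auto
  have H: "centralizer m w = {x\<in>N. ori x}" unfolding centralizer_eq[OF w] using False by simp
  obtain w' where w': "w' \<in> rots" "rot_idx w' = n - ?k"
  proof -
    have "n - ?k \<in> rot_idx ` rots" using rot_idx_bij k unfolding bij_betw_def by auto
    then show ?thesis using that by auto
  qed
  have l': "lam w' = cnj (lam w)" using rot_idx(3)[OF w'(1)] w'(2) k \<zeta>_cnj[of ?k "n - ?k"] by simp
  have cl: "rot_cls w = {w, w'}"
  proof -
    have 1: "u = w" if "u \<in> WL" "ori u" "lam u = lam w" for u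
      using that rots_D[OF w] by (intro WL_unique) simp_all
    have 2: "u = w'" if "u \<in> WL" "ori u" "lam u = cnj (lam w)" for u
      using that rots_D[OF w'(1)] l' by (intro WL_unique) simp_all
    show ?thesis
    proof
      show "rot_cls w \<subseteq> {w, w'}" unfolding rot_cls_def using 1 2 by blast
      show "{w, w'} \<subseteq> rot_cls w" unfolding rot_cls_def using l' rots_D[OF w] rots_D[OF w'(1)] by simp
    qed
  qed
  have ne: "w \<noteq> w'" "2 * rot_idx w' \<noteq> n" using False k w'(2) by auto
  show ?thesis
  proof (cases "ori g")
    case True
    have mc: "cnj (mu g) ^ ?k = mu g ^ (n - ?k)"
    proof -
      have "mu g * cnj (mu g) = 1" using root_norm1 mu_root[OF g] by blast
      then have "mu g ^ ?k * cnj (mu g) ^ ?k = 1" by (metis power_mult_distrib power_one)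
      moreover have "mu g ^ ?k * mu g ^ (n - ?k) = 1" using mu_root[OF g] k by (simp flip: power_add)
      moreover have "mu g ^ ?k \<noteq> 0" using lam_nz[OF g] by simp
      ultimately show ?thesis by (metis mult_left_cancel)
    qed
    have "(\<Sum>x\<in>N. if x ** g ** iv x \<in> {x\<in>N. ori x} then rot_chr e ?k (x ** g ** iv x) else 0)
       = (\<Sum>x\<in>N. if ori x then mu g ^ ?k else cnj (mu g) ^ ?k)"
      using N_conj_act[OF _ g] True by (intro sum.cong) (auto simp: rot_chr_def)
    also have "\<dots> = of_nat (card {x\<in>N. ori x}) * mu g ^ ?k + of_nat (card {x\<in>N. \<not> ori x}) * cnj (mu g) ^ ?k"
      using N_card(2) by (simp add: sum.If_cases Int_def)
    also have "\<dots> = of_nat (card {x\<in>N. ori x}) * (mu g ^ ?k + mu g ^ (n - ?k))"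
      unfolding N_card(1) mc by (simp add: distrib_left)
    finally have S: "(\<Sum>x\<in>N. if x ** g ** iv x \<in> {x\<in>N. ori x} then rot_chr e ?k (x ** g ** iv x) else 0) = \<dots>" .
    have "Ind (centralizer m w) N (rot_chr e ?k) g = mu g ^ ?k + mu g ^ (n - ?k)"
      unfolding Ind_def H S using N_card(3) by simp
    then show ?thesis unfolding cl using True ne w'(2) by simp
  next
    case ng: False
    have "(\<Sum>x\<in>N. if x ** g ** iv x \<in> {x\<in>N. ori x} then rot_chr e ?k (x ** g ** iv x) else 0) = 0"
      using N_conj_act[OF _ g] ng by (intro sum.neutral) auto
    then have "Ind (centralizer m w) N (rot_chr e ?k) g = 0" unfolding Ind_def H by simp
    then show ?thesis unfolding cl using ng ne False by simp
  qed
qed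

lemma Ind_sum: assumes e: "e * e = 1" and g: "g \<in> N" and rep: "\<forall>C\<in>cusp_classes m {s,t}. rep C \<in> C"
  shows "(\<Sum>C\<in>cusp_classes m {s,t}. Ind (centralizer m (rep C)) N (rot_chr e (rot_idx (rep C))) g) = ind_val e g"
proof -
  let ?H = "\<lambda>k. if ori g then mu g ^ k else if 2 * k = n then e * mu g ^ k else 0"
  have "(\<Sum>C\<in>rot_cls ` rots. Ind (centralizer m (rep C)) N (rot_chr e (rot_idx (rep C))) g) = (\<Sum>C\<in>rot_cls ` rots. \<Sum>u\<in>C. ?H (rot_idx u))"
  proof (rule sum.cong, simp)
    fix C assume C: "C \<in> rot_cls ` rots"
    then have r: "rep C \<in> C" using rep unfolding cusp_classes_eq by blast
    obtain w where w: "w \<in> rots" "C = rot_cls w" using C by blast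
    have "rep C \<in> rots" using r w rot_cls_sub by blast
    moreover have "rot_cls (rep C) = C" using rot_cls_eq r w by blast
    ultimately show "Ind (centralizer m (rep C)) N (rot_chr e (rot_idx (rep C))) g = (\<Sum>u\<in>C. ?H (rot_idx u))"
      using Ind_rot_chr[OF e _ g, of "rep C"] by simp
  qed
  also have "\<dots> = (\<Sum>u\<in>rots. ?H (rot_idx u))" by (rule sum_classes)
  also have "\<dots> = (\<Sum>k\<in>{1..<n}. ?H k)" by (rule sum.reindex_bij_betw[OF rot_idx_bij])
  also have "\<dots> = ind_val e g"
  proof (cases "ori g")
    case True then show ?thesis by (simp add: ind_val_def)
  next
    case False
    show ?thesis
    proof (cases "even n")
      case True
      then obtain j where j: "n = 2 * j" by blast
      have "(\<Sum>k\<in>{1..<n}. ?H k) = (\<Sum>k\<in>{1..<n}. if k = j then e * mu g ^ k else 0)"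
        using False j by (intro sum.cong) auto
      then show ?thesis using False True j n_ge_2 by (simp add: ind_val_def)
    next
      case odd: False
      then have "2 * k \<noteq> n" for k by (metis dvd_triv_left)
      then have "(\<Sum>k\<in>{1..<n}. ?H k) = 0" using False by (intro sum.neutral) simp
      then show ?thesis using False odd by (simp add: ind_val_def)
    qed
  qed
  finally show ?thesis unfolding cusp_classes_eq .
qed

lemma rep_rots: assumes "\<forall>C\<in>cusp_classes m {s,t}. rep C \<in> C" "C \<in> cusp_classes m {s,t}" shows "rep C \<in> rots"
  using assms rot_cls_sub unfolding cusp_classes_eq by blast

theorem induced_decomposition:
  assumes rep: "\<forall>C\<in>cusp_classes m {s,t}. rep C \<in> C"
  shows "\<exists>\<phi> \<psi>.
    (\<forall>C\<in>cusp_classes m {s,t}. lin_char (centralizer m (rep C)) (\<phi> C)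
                          \<and> lin_char (centralizer m (rep C)) (\<psi> C))
  \<and> (\<forall>g\<in>N. PhiT m {s,t} g = (\<Sum>C\<in>cusp_classes m {s,t}. Ind (centralizer m (rep C)) N (\<phi> C) g))
  \<and> (\<forall>g\<in>N. PsiT m {s,t} g = (\<Sum>C\<in>cusp_classes m {s,t}. Ind (centralizer m (rep C)) N (\<psi> C) g))
  \<and> (\<forall>C\<in>cusp_classes m {s,t}. \<forall>x\<in>centralizer m (rep C). \<psi> C x = \<phi> C x * eps x * alphaL m {s,t} x)"
proof (intro exI conjI ballI)
  let ?\<phi> = "\<lambda>C. rot_chr (-1) (rot_idx (rep C))" and ?\<psi> = "\<lambda>C. rot_chr 1 (rot_idx (rep C))"
  fix C assume C: "C \<in> cusp_classes m {s,t}"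
  have K: "rep C \<in> rots" by (rule rep_rots[OF rep C])
  show "lin_char (centralizer m (rep C)) (?\<phi> C)" "lin_char (centralizer m (rep C)) (?\<psi> C)"
    by (rule rot_chr_lin_char[OF _ K], simp)+
  fix x assume "x \<in> centralizer m (rep C)"
  then have "x \<in> N" unfolding centralizer_eq[OF K] by simp
  then have "?\<phi> C x * (eps x * alphaL m {s,t} x) = ?\<psi> C x"
    unfolding eps_alphaL[OF \<open>x \<in> N\<close>] by (simp add: rot_chr_def plane_sgn_def)
  then show "?\<psi> C x = ?\<phi> C x * eps x * alphaL m {s,t} x" by (simp add: mult.assoc)
next
  fix g assume g: "g \<in> N"
  show "PhiT m {s,t} g = (\<Sum>C\<in>cusp_classes m {s,t}. Ind (centralizer m (rep C)) N (rot_chr (-1) (rot_idx (rep C))) g)"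
    using Ind_sum[OF _ g rep, of "-1"] Phi_Val[OF g] by simp
  show "PsiT m {s,t} g = (\<Sum>C\<in>cusp_classes m {s,t}. Ind (centralizer m (rep C)) N (rot_chr 1 (rot_idx (rep C))) g)"
    using Ind_sum[OF _ g rep, of 1] Psi_Val[OF g] by simp
qed

end

theorem theorem5p15:
  fixes m :: "'s::finite \<Rightarrow> 's \<Rightarrow> nat" and L :: "'s set"
    and rep :: "'s mat set \<Rightarrow> 's mat"
  assumes "coxeter_matrix m"
    and "finite (Wgrp m)"
    and "CARD('s) \<ge> 3"
    and "card L = 2"
    and "\<forall>C\<in>cusp_classes m L. rep C \<in> C"
  shows "\<exists>\<phi> \<psi>.
    (\<forall>C\<in>cusp_classes m L. lin_char (centralizer m (rep C)) (\<phi> C)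
                          \<and> lin_char (centralizer m (rep C)) (\<psi> C))
  \<and> (\<forall>g\<in>normalizer m (WJ m L). PhiT m L g =
        (\<Sum>C\<in>cusp_classes m L. Ind (centralizer m (rep C)) (normalizer m (WJ m L)) (\<phi> C) g))
  \<and> (\<forall>g\<in>normalizer m (WJ m L). PsiT m L g =
        (\<Sum>C\<in>cusp_classes m L. Ind (centralizer m (rep C)) (normalizer m (WJ m L)) (\<psi> C) g))
  \<and> (\<forall>C\<in>cusp_classes m L. \<forall>x\<in>centralizer m (rep C).
        \<psi> C x = \<phi> C x * eps x * alphaL m L x)"
proof -
  obtain s t where L: "L = {s, t}" "s \<noteq> t" using assms(4) by (meson card_2_iff)
  interpret finite_rank2 m s t by unfold_locales (use assms L in auto)
  show ?thesis using induced_decomposition assms(5) unfolding L(1) by blast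
qed

end
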